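(* Let $(\epsilon_N)$ be a sequence of positive real numbers such that $$\lim_{N\to\infty}N\,\epsilon_N=0,$$ and for each $N$ let $f(t)=g(t)+\epsilon_N X$, $t\in\mathbb{R}^2$, be the perturbed Gaussian field with perturbation parameter $\epsilon=\epsilon_N$. Let $T$ be a bounded rectangle in $\mathbb{R}^2$ with non-empty interior, $T^{(N)}=\{Nt:t\in T\}$, and $u\in\mathbb{R}$. Then $$Y^{\epsilon_N}_{T^{(N)}}(u)=|T^{(N)}|^{1/2}\left(C_2^{/T^{(N)}}(f,u)-\mathbb{E}[C_2^{/T^{(N)}}(f,u)]\right)\longrightarrow\mathcal{N}(0,v(u))\quad\text{in distribution as }N\to\infty.$$
   Context: **Gaussian field.** $g=\{g(t),t\in\mathbb{R}^2\}$ is a real Gaussian random field, stationary and isotropic, with $\mathbb{E}[g(0)]=0$, $\mathrm{Var}\,g(0)=\sigma_g^2$ with $\sigma_g>0$, gradient covariance matrix $\mathrm{Var}\,g'(0)=\lambda I_2$ with $\lambda>0$ ($I_2$ the $2\times2$ identity matrix), and whose covariance function $r(t)=\mathrm{Cov}(g(0),g(t))$ is $\mathcal{C}^4$ and satisfies $|r(t)|=O(\|t\|^{-\alpha})$ as $\|t\|\to\infty$ for some $\alpha>2$. **Perturbation.** $X$ is a real random variable, independent of $g$, with $\mathbb{E}[|X|^3]<+\infty$ and $\mathbb{E}[X]=0$. **Excursion area.** $|\cdot|$ is two-dimensional Lebesgue measure. For a field $h$, $u\in\mathbb{R}$ and $S$ a bounded rectangle in $\mathbb{R}^2$ with non-empty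 interior, $C_2^{/S}(h,u)=|\{t\in S: h(t)\ge u\}|/|S|$. **Variance function.** With $\rho(t)=r(t)/\sigma_g^2$, $$v(u)=\frac1{2\pi}\int_{\mathbb{R}^2}\int_0^{\rho(t)}\frac{1}{\sqrt{1-r^2}}\exp\left\{-\frac{u^2}{\sigma_g^2(1+r)}\right\}dr\,dt,\quad u\in\mathbb{R}.$$ *)

theory Defs
  imports "HOL-Probability.Probability"
begin

type_synonym 'w field2 = "real^2 \<Rightarrow> 'w \<Rightarrow> real"

definition covariance :: "'w measure \<Rightarrow> ('w \<Rightarrow> real) \<Rightarrow> ('w \<Rightarrow> real) \<Rightarrow> real" where
  "covariance M X Y =
     (\<integral>\<omega>. (X \<omega> - (\<integral>\<omega>'. X \<omega>' \<partial>M)) * (Y \<omega> - (\<integral>\<omega>'. Y \<omega>' \<partial>M)) \<partial>M)"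

definition covariance_matrix :: "'w measure \<Rightarrow> ('w \<Rightarrow> real^'n) \<Rightarrow> real^'n^'n" where
  "covariance_matrix M G = (\<chi> i j. covariance M (\<lambda>\<omega>. G \<omega> $ i) (\<lambda>\<omega>. G \<omega> $ j))"

text \<open>The second parameter is the variance; variance 0 gives the Dirac mass at the mean.\<close>
definition normal_law :: "real \<Rightarrow> real \<Rightarrow> real measure" where
  "normal_law m s =
     (if s = 0 then return borel m
      else density lborel (\<lambda>x. ennreal (normal_density m (sqrt s) x)))"

text \<open>Joint measurability makes the area of an excursion set a random variable; no path
  continuity is assumed.\<close>
definition measurable_field :: "'w measure \<Rightarrow> 'w field2 \<Rightarrow> bool" where
  "measurable_field M g \<longleftrightarrow> (\<lambda>(t, \<omega>). g t \<omega>) \<in> borel_measurable (borel \<Otimes>\<^sub>M M)"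

definition gaussian_field :: "'w measure \<Rightarrow> 'w field2 \<Rightarrow> bool" where
  "gaussian_field M g \<longleftrightarrow>
     (\<forall>t. g t \<in> borel_measurable M) \<and>
     (\<forall>I a. finite I \<longrightarrow>
        (\<exists>m s. s \<ge> 0 \<and> distr M borel (\<lambda>\<omega>. \<Sum>t\<in>I. a t * g t \<omega>) = normal_law m s))"

definition fidi :: "'w measure \<Rightarrow> 'w field2 \<Rightarrow> (real^2) set \<Rightarrow> (real^2 \<Rightarrow> real) measure" where
  "fidi M g I = distr M (\<Pi>\<^sub>M t\<in>I. borel) (\<lambda>\<omega>. \<lambda>t\<in>I. g t \<omega>)"

definition stationary :: "'w measure \<Rightarrow> 'w field2 \<Rightarrow> bool" where
  "stationary M g \<longleftrightarrow> (\<forall>s I. finite I \<longrightarrow> fidi M (\<lambda>t. g (t + s)) I = fidi M g I)"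

definition isotropic :: "'w measure \<Rightarrow> 'w field2 \<Rightarrow> bool" where
  "isotropic M g \<longleftrightarrow>
     (\<forall>Q I. rotation_matrix Q \<and> finite I \<longrightarrow> fidi M (\<lambda>t. g (Q *v t)) I = fidi M g I)"

text \<open>The gradient is taken in the mean-square sense, the partial derivatives being limits of
  difference quotients in \<open>L\<^sup>2\<close>. If the paths of a Gaussian field are almost surely differentiable
  at \<open>t\<close>, their gradient at \<open>t\<close> is also the mean-square gradient.\<close>
definition ms_gradient_at ::
    "'w measure \<Rightarrow> 'w field2 \<Rightarrow> real^2 \<Rightarrow> ('w \<Rightarrow> real^2) \<Rightarrow> bool" where
  "ms_gradient_at M g t G \<longleftrightarrow>
     G \<in> borel_measurable M \<and>
     (\<forall>i. integrable M (\<lambda>\<omega>. (G \<omega> $ i)\<^sup>2) \<and>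
        ((\<lambda>h. \<integral>\<omega>. ((g (t + h *\<^sub>R axis i 1) \<omega> - g t \<omega>) / h - G \<omega> $ i)\<^sup>2 \<partial>M)
           \<longlongrightarrow> 0) (at 0))"

definition field_cov :: "'w measure \<Rightarrow> 'w field2 \<Rightarrow> real^2 \<Rightarrow> real" where
  "field_cov M g t = covariance M (g 0) (g t)"

fun C_k :: "nat \<Rightarrow> ('a::euclidean_space \<Rightarrow> real) \<Rightarrow> bool" where
  "C_k 0 f \<longleftrightarrow> continuous_on UNIV f"
| "C_k (Suc k) f \<longleftrightarrow>
     f differentiable_on UNIV \<and> (\<forall>b\<in>Basis. C_k k (\<lambda>x. frechet_derivative f (at x) b))"

text \<open>Independence of the variable and of the sigma-algebra generated by the whole field.\<close>
definition indep_of_field :: "'w measure \<Rightarrow> ('w \<Rightarrow> real) \<Rightarrow> 'w field2 \<Rightarrow> bool" where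
  "indep_of_field M X g \<longleftrightarrow>
     prob_space.indep_set M
       (sets (vimage_algebra (space M) X borel))
       (sets (vimage_algebra (space M) (\<lambda>\<omega> t. g t \<omega>) (\<Pi>\<^sub>M t\<in>UNIV. borel)))"

text \<open>The sides need not be parallel to the coordinate axes, and any part of the boundary
  delimited by open or closed sides may be absent.\<close>
definition bounded_rectangle :: "(real^2) set \<Rightarrow> bool" where
  "bounded_rectangle S \<longleftrightarrow>
     (\<exists>Q I J. rotation_matrix Q \<and> is_interval I \<and> bounded I \<and> is_interval J \<and> bounded J \<and>
        S = (\<lambda>t. Q *v t) ` {t. t $ 1 \<in> I \<and> t $ 2 \<in> J})"

abbreviation area :: "(real^2) set \<Rightarrow> real" where
  "area S \<equiv> measure lborel S"

definition excursion_area :: "(real^2) set \<Rightarrow> (real^2 \<Rightarrow> real) \<Rightarrow> real \<Rightarrow> real" where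
  "excursion_area S h u = area {t \<in> S. h t \<ge> u} / area S"

definition perturbed_field :: "'w field2 \<Rightarrow> ('w \<Rightarrow> real) \<Rightarrow> real \<Rightarrow> 'w field2" where
  "perturbed_field g X \<epsilon> t \<omega> = g t \<omega> + \<epsilon> * X \<omega>"

definition normalized_area :: "'w measure \<Rightarrow> 'w field2 \<Rightarrow> (real^2) set \<Rightarrow> real \<Rightarrow> 'w \<Rightarrow> real" where
  "normalized_area M f S u \<omega> =
     sqrt (area S) * (excursion_area S (\<lambda>t. f t \<omega>) u
                      - (\<integral>\<omega>'. excursion_area S (\<lambda>t. f t \<omega>') u \<partial>M))"

text \<open>The inner integral is oriented: it changes sign when \<open>r t\<close> is negative.\<close>
definition asymptotic_variance :: "real \<Rightarrow> (real^2 \<Rightarrow> real) \<Rightarrow> real \<Rightarrow> real" where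
  "asymptotic_variance \<sigma> r u =
     1 / (2 * pi) *
     (LINT t|lborel. LBINT s=0..ereal (r t / \<sigma>\<^sup>2).
        1 / sqrt (1 - s\<^sup>2) * exp (- (u\<^sup>2 / (\<sigma>\<^sup>2 * (1 + s)))))"

end

theory Submission
  imports Defs "HOL-Real_Asymp.Real_Asymp"
begin

text \<open>Since \<open>N * \<epsilon> N\<close> tends to 0 and the Gaussian density is bounded, the perturbation moves the
  normalised area by an amount tending to 0 in mean, so it suffices to treat the unperturbed field.

  If the indicator of \<open>{u..}\<close> is replaced by a trigonometric polynomial \<open>\<phi>\<close>, every expectation is
  computed from \<open>E (cis h) = exp (- E (h\<^sup>2) / 2)\<close> for \<open>h\<close> in the linear span of the field; no multivariate
  Gaussian law is needed. For \<open>F = \<integral> \<phi> (g t) dt\<close> over the window, Gaussian integration by parts along the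
  Ornstein-Uhlenbeck path \<open>\<tau> \<mapsto> exp (- a\<^sup>2 (1 - \<tau>\<^sup>2) / 2) cis (a \<tau> g t)\<close> (Stein's method) shows that
  the characteristic function \<open>\<chi>\<close> of \<open>F\<close> almost satisfies \<open>\<chi>' s = - s Var F \<chi> s\<close>; the
  error is the fluctuation of a quadratic functional, controlled by a fourfold integral of the integrable covariance.

  The general case follows from Gebelein's inequality \<open>\<bar>Cov (f X, f Y)\<bar> \<le> \<bar>\<rho>\<bar> Var (f X)\<close>, which makes the
  approximation of the indicator uniform in the window, and the limiting variance is identified by Plackett's
  identity for the derivative of \<open>P (X \<ge> u, Y \<ge> u)\<close> in the correlation.\<close>

subsection \<open>Integration lemmas\<close>

text \<open>Every scale is set by \<open>R = \<integral> \<bar>rho\<bar>\<close>, finite because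
  \<alpha> > 2 in the plane. Gebelein bounds the second moment of the integral over \<open>S\<close>
  of a centred \<psi> by \<open>R * area S\<close> times the normal second moment of \<psi>, so
  exchanging the indicator for a polynomial costs a small fraction of the correct scale
  \<open>sqrt (area S)\<close>, whatever the window. For a polynomial, the quadratic functional has
  variance at most a constant times \<open>R ^ 3 * area S\<close>: it fluctuates by order
  \<open>sqrt (area S)\<close> against a normalisation by \<open>area S\<close>, which leaves an
  error of order \<open>1 / sqrt (area S)\<close> in the characteristic function. That constant is
  not controlled in terms of the quality of the approximation, so the polynomial is fixed before the
  window grows. The perturbation moves the area by order \<open>\<epsilon> * area S\<close> in mean,
  hence the normalised area by order \<open>N * \<epsilon> N\<close>. Plackett's identity requires
  correlations strictly between -1 and 1; a correlation of modulus 1 at some nonzero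
  \<open>t\<close> would recur at all multiples of \<open>t\<close> and contradict the
  decay.\<close>

lemma borel_measurable_cis [measurable]: "cis \<in> borel_measurable borel"
  by (intro borel_measurable_continuous_onI continuous_on_cis continuous_on_id)

lemma norm_cis_sub_affine_le: "norm (cis x - 1 - \<i> * of_real x) \<le> x\<^sup>2 / 2"
  using iexp_approx1[of x 1] by (simp add: cis_conv_exp algebra_simps power2_eq_square)

lemma norm_cis_diff_le: "norm (cis x - cis y) \<le> \<bar>x - y\<bar>"
proof -
  have "cis x - cis y = cis y * (cis (x - y) - 1)"
    by (simp add: right_diff_distrib cis_mult)
  then have "norm (cis x - cis y) = norm (cis (x - y) - 1)"
    by (simp add: norm_mult)
  also have "\<dots> \<le> \<bar>x - y\<bar>"
    using iexp_approx1[of "x - y" 0] by (simp add: cis_conv_exp)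
  finally show ?thesis .
qed

text \<open>Derivatives of expectations of \<open>cis\<close> come from a second-order Taylor bound
  valid for every increment, so no limit has to be taken under an integral sign.\<close>

lemma has_vector_derivative_quadratic_remainder:
  fixes f :: "real \<Rightarrow> 'a::real_normed_vector"
  assumes "\<And>y. norm (f y - f x - (y - x) *\<^sub>R D) \<le> K * (y - x)\<^sup>2"
  shows "(f has_vector_derivative D) (at x)"
  unfolding has_vector_derivative_def has_derivative_at
proof (intro conjI bounded_linear_scaleR_left)
  show "(\<lambda>h. norm (f (x + h) - f x - h *\<^sub>R D) / norm h) \<midarrow>0\<rightarrow> 0"
  proof (rule Lim_null_comparison)
    show "\<forall>\<^sub>F h in at 0. norm (norm (f (x + h) - f x - h *\<^sub>R D) / norm h) \<le> K * \<bar>h\<bar>"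
    proof (rule eventually_at_filter[THEN iffD2], intro always_eventually allI impI)
      fix h :: real assume "h \<noteq> 0"
      then show "norm (norm (f (x + h) - f x - h *\<^sub>R D) / norm h) \<le> K * \<bar>h\<bar>"
        using assms[of "x + h"] by (simp add: divide_le_eq power2_eq_square abs_mult[symmetric] mult.assoc)
    qed
    show "((\<lambda>h::real. K * \<bar>h\<bar>) \<longlongrightarrow> 0) (at 0)"
      by (auto intro!: tendsto_eq_intros)
  qed
qed

lemma (in finite_measure) integrable_of_square:
  fixes X :: "'a \<Rightarrow> real"
  assumes [measurable]: "X \<in> borel_measurable M" and "integrable M (\<lambda>x. (X x)\<^sup>2)"
  shows "integrable M X"
proof (rule Bochner_Integration.integrable_bound)
  show "integrable M (\<lambda>x. 1 + (X x)\<^sup>2)" using assms by simp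
  have "\<bar>a\<bar> \<le> 1 + a\<^sup>2" for a :: real
    using sum_squares_bound[of 1 "\<bar>a\<bar>"] zero_le_power2[of a] by simp
  then show "AE x in M. norm (X x) \<le> norm (1 + (X x)\<^sup>2)" by auto
qed simp

text \<open>A non-integrable \<open>f\<close> has Bochner integral 0, so a dominating function
  suffices and later uses never establish integrability of \<open>f\<close>.\<close>

lemma norm_integral_le:
  fixes f :: "'a \<Rightarrow> 'b::{banach, second_countable_topology}"
  assumes "integrable M g" "\<And>x. x \<in> space M \<Longrightarrow> norm (f x) \<le> g x"
  shows "norm (integral\<^sup>L M f) \<le> integral\<^sup>L M g"
  by (rule order_trans[OF integral_norm_bound integral_mono'])
     (use assms in \<open>auto intro: order_trans[OF norm_ge_zero]\<close>)

lemma integrable_mult_bounded: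
  fixes f g :: "'a \<Rightarrow> complex"
  assumes "integrable M f" "g \<in> borel_measurable M" "\<And>x. x \<in> space M \<Longrightarrow> norm (g x) \<le> B"
  shows "integrable M (\<lambda>x. f x * g x)"
proof (rule Bochner_Integration.integrable_bound)
  show "integrable M (\<lambda>x. B * norm (f x))" using assms by simp
  show "AE x in M. norm (f x * g x) \<le> norm (B * norm (f x))"
  proof (rule AE_I2)
    fix x assume "x \<in> space M"
    then have "norm (f x) * norm (g x) \<le> norm (f x) * B" using assms(3) by (intro mult_left_mono) auto
    then show "norm (f x * g x) \<le> norm (B * norm (f x))" by (simp add: norm_mult mult.commute)
  qed
qed (use assms in measurable)

text \<open>The bounded weight \<open>C\<close> lets one statement differentiate a plain
  characteristic function, one weighted by a functional of the field, and, on a product measure, an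
  integral of these over the window.\<close>

lemma (in finite_measure) has_vector_derivative_integral_cis:
  fixes X :: "'a \<Rightarrow> real" and C :: "'a \<Rightarrow> complex"
  assumes [measurable]: "X \<in> borel_measurable M" "C \<in> borel_measurable M"
    and X2: "integrable M (\<lambda>x. (X x)\<^sup>2)"
    and C: "\<And>x. x \<in> space M \<Longrightarrow> norm (C x) \<le> B"
  shows "((\<lambda>\<tau>. \<integral>x. cis (\<tau> * X x) * C x \<partial>M) has_vector_derivative
            (\<integral>x. \<i> * of_real (X x) * (cis (\<tau> * X x) * C x) \<partial>M)) (at \<tau>)"
proof (rule has_vector_derivative_quadratic_remainder)
  fix y :: real
  have I0: "integrable M (\<lambda>x. cis (t * X x) * C x)" for t
    by (rule integrable_const_bound[where B=B]) (auto intro!: AE_I2 C simp: norm_mult)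
  have IX: "integrable M (\<lambda>x. \<i> * of_real (X x))"
    using integrable_of_square[OF _ X2] by simp
  have I1: "integrable M (\<lambda>x. \<i> * of_real (X x) * (cis (\<tau> * X x) * C x))"
    by (rule integrable_mult_bounded[OF IX, where B=B]) (auto intro!: C simp: norm_mult)
  have "(\<integral>x. cis (y * X x) * C x \<partial>M) - (\<integral>x. cis (\<tau> * X x) * C x \<partial>M)
          - (y - \<tau>) *\<^sub>R (\<integral>x. \<i> * of_real (X x) * (cis (\<tau> * X x) * C x) \<partial>M)
      = (\<integral>x. cis (y * X x) * C x - cis (\<tau> * X x) * C x
              - (y - \<tau>) *\<^sub>R (\<i> * of_real (X x) * (cis (\<tau> * X x) * C x)) \<partial>M)"
    using I0 I1 by simp
  also have "norm \<dots> \<le> (\<integral>x. B / 2 * (y - \<tau>)\<^sup>2 * (X x)\<^sup>2 \<partial>M)"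
  proof (rule norm_integral_le)
    fix x assume x: "x \<in> space M"
    \<comment> \<open>Factoring out \<open>cis (\<tau> * X x)\<close> reduces the expansion at
      \<tau> to the one at 0.\<close>
    have *: "cis (y * X x) = cis (\<tau> * X x) * cis ((y - \<tau>) * X x)"
      by (simp add: cis_mult algebra_simps)
    have "cis (y * X x) * C x - cis (\<tau> * X x) * C x
            - (y - \<tau>) *\<^sub>R (\<i> * of_real (X x) * (cis (\<tau> * X x) * C x))
        = cis (\<tau> * X x) * C x * (cis ((y - \<tau>) * X x) - 1 - \<i> * of_real ((y - \<tau>) * X x))"
      unfolding * by (simp add: algebra_simps scaleR_conv_of_real)
    also have "norm \<dots> \<le> B * (((y - \<tau>) * X x)\<^sup>2 / 2)"
      unfolding norm_mult using C[OF x] order_trans[OF norm_ge_zero C[OF x]]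
      by (intro mult_mono norm_cis_sub_affine_le) auto
    finally show "norm (cis (y * X x) * C x - cis (\<tau> * X x) * C x
            - (y - \<tau>) *\<^sub>R (\<i> * of_real (X x) * (cis (\<tau> * X x) * C x))) \<le> B / 2 * (y - \<tau>)\<^sup>2 * (X x)\<^sup>2"
      by (simp add: power_mult_distrib)
  qed (use I0 I1 X2 in auto)
  finally show "norm ((\<integral>x. cis (y * X x) * C x \<partial>M) - (\<integral>x. cis (\<tau> * X x) * C x \<partial>M)
          - (y - \<tau>) *\<^sub>R (\<integral>x. \<i> * of_real (X x) * (cis (\<tau> * X x) * C x) \<partial>M))
        \<le> (B / 2 * (\<integral>x. (X x)\<^sup>2 \<partial>M)) * (y - \<tau>)\<^sup>2"
    by (simp add: mult_ac)
qed

text \<open>The bound may depend on \<open>y\<close> but not on \<open>x\<close>: an unbounded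
  integrable random variable is allowed as a factor while the other variable runs over a finite
  measure.\<close>

lemma
  fixes f :: "'a \<Rightarrow> 'b \<Rightarrow> 'c::{banach, second_countable_topology}" and k :: "'b \<Rightarrow> real"
  assumes "finite_measure N" "finite_measure M"
    and f: "(\<lambda>(x, y). f x y) \<in> borel_measurable (N \<Otimes>\<^sub>M M)"
    and k: "integrable M k"
    and b: "\<And>x y. x \<in> space N \<Longrightarrow> y \<in> space M \<Longrightarrow> norm (f x y) \<le> k y"
  shows Fubini_bounded_swap: "(\<integral>y. (\<integral>x. f x y \<partial>N) \<partial>M) = (\<integral>x. (\<integral>y. f x y \<partial>M) \<partial>N)"
    and Fubini_bounded_pair: "(\<integral>z. f (fst z) (snd z) \<partial>(N \<Otimes>\<^sub>M M)) = (\<integral>x. (\<integral>y. f x y \<partial>M) \<partial>N)"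
proof -
  interpret N: finite_measure N by fact
  interpret M: finite_measure M by fact
  interpret pair_sigma_finite N M ..
  note f[measurable]
  have I: "integrable M (\<lambda>y. f x y)" if "x \<in> space N" for x
    by (rule Bochner_Integration.integrable_bound[OF k])
       (use that b in \<open>auto intro!: AE_I2 order_trans[OF b]\<close>)
  have int: "integrable (N \<Otimes>\<^sub>M M) (\<lambda>(x, y). f x y)"
  proof (rule Fubini_integrable[OF f])
    show "integrable N (\<lambda>x. \<integral>y. norm (case (x, y) of (x, y) \<Rightarrow> f x y) \<partial>M)"
    proof (rule N.integrable_const_bound[where B="\<integral>y. k y \<partial>M"])
      show "AE x in N. norm (\<integral>y. norm (case (x, y) of (x, y) \<Rightarrow> f x y) \<partial>M) \<le> (\<integral>y. k y \<partial>M)"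
        using I k b by (auto intro!: AE_I2 integral_mono)
    qed simp
    show "AE x in N. integrable M (\<lambda>y. case (x, y) of (x, y) \<Rightarrow> f x y)" using I by (auto intro!: AE_I2)
  qed
  show "(\<integral>y. (\<integral>x. f x y \<partial>N) \<partial>M) = (\<integral>x. (\<integral>y. f x y \<partial>M) \<partial>N)"
    by (rule Fubini_integral[OF int])
  show "(\<integral>z. f (fst z) (snd z) \<partial>(N \<Otimes>\<^sub>M M)) = (\<integral>x. (\<integral>y. f x y \<partial>M) \<partial>N)"
    using integral_fst'[OF int] by (simp add: case_prod_beta')
qed

subsection \<open>Gaussian spaces and integration by parts\<close>

lemma abs_mult_le_squares: "\<bar>x * y\<bar> \<le> (x\<^sup>2 + y\<^sup>2) / 2" for x y :: real
  using sum_squares_bound[of "\<bar>x\<bar>" "\<bar>y\<bar>"] by (simp add: abs_mult)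

lemma exp_neg_lipschitz:
  fixes x y :: real
  assumes "0 \<le> x" "0 \<le> y"
  shows "\<bar>exp (- x) - exp (- y)\<bar> \<le> \<bar>x - y\<bar>"
proof -
  have *: "exp (- a) - exp (- (a + d)) \<le> d" if "0 \<le> a" "0 \<le> d" for a d :: real
  proof -
    have "exp (- a) * (1 - exp (- d)) \<le> 1 * d"
    proof (rule mult_mono)
      show "1 - exp (- d) \<le> d" using exp_ge_add_one_self[of "- d"] by linarith
    qed (use that in simp_all)
    then show ?thesis by (simp add: right_diff_distrib exp_add[symmetric])
  qed
  show ?thesis
  proof (cases "x \<le> y")
    case True
    then show ?thesis using *[of x "y - x"] assms by simp
  next
    case False
    then show ?thesis using *[of y "x - y"] assms by simp
  qed
qed

section \<open>Trigonometric polynomials and bounded random variables\<close>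

definition trig :: "real set \<Rightarrow> (real \<Rightarrow> complex) \<Rightarrow> real \<Rightarrow> complex" where
  "trig I c x = (\<Sum>a\<in>I. c a * cis (a * x))"

text \<open>These are the coefficients of the derivative: \<open>trig I (dcoef c)\<close> is the
  derivative of \<open>trig I c\<close>.\<close>

abbreviation dcoef :: "(real \<Rightarrow> complex) \<Rightarrow> real \<Rightarrow> complex" where
  "dcoef c \<equiv> (\<lambda>a. c a * (\<i> * of_real a))"

lemma borel_measurable_trig [measurable]: "trig I c \<in> borel_measurable borel"
  unfolding trig_def by measurable

lemma norm_trig_le: "norm (trig I c x) \<le> (\<Sum>a\<in>I. norm (c a))"
  unfolding trig_def by (rule order_trans[OF norm_sum]) (simp add: norm_mult)

text \<open>The bound holds everywhere on the space rather than almost everywhere, so sums and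
  products stay bounded with no null sets to track.\<close>

definition bounded_rv :: "'a measure \<Rightarrow> ('a \<Rightarrow> complex) \<Rightarrow> bool" where
  "bounded_rv M f \<longleftrightarrow> f \<in> borel_measurable M \<and> (\<exists>K. \<forall>x\<in>space M. norm (f x) \<le> K)"

lemma bounded_rvI: "f \<in> borel_measurable M \<Longrightarrow> (\<And>x. x \<in> space M \<Longrightarrow> norm (f x) \<le> K) \<Longrightarrow> bounded_rv M f"
  by (auto simp: bounded_rv_def)

lemma bounded_rv_measurable: "bounded_rv M f \<Longrightarrow> f \<in> borel_measurable M"
  by (auto simp: bounded_rv_def)

lemma bounded_rvE:
  assumes "bounded_rv M f"
  obtains K where "0 \<le> K" "\<And>x. x \<in> space M \<Longrightarrow> norm (f x) \<le> K"
proof -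
  obtain K where "\<forall>x\<in>space M. norm (f x) \<le> K" using assms by (auto simp: bounded_rv_def)
  then show ?thesis by (intro that[of "max K 0"]) force+
qed

lemma bounded_rv_const: "bounded_rv M (\<lambda>x. z)"
  by (rule bounded_rvI) auto

lemma bounded_rv_add:
  assumes "bounded_rv M f" "bounded_rv M g" shows "bounded_rv M (\<lambda>x. f x + g x)"
proof -
  obtain K L where "\<And>x. x \<in> space M \<Longrightarrow> norm (f x) \<le> K" "\<And>x. x \<in> space M \<Longrightarrow> norm (g x) \<le> L"
    using bounded_rvE[OF assms(1)] bounded_rvE[OF assms(2)] by metis
  then show ?thesis using bounded_rv_measurable[OF assms(1)] bounded_rv_measurable[OF assms(2)]
    by (intro bounded_rvI[where K="K + L"]) (auto intro: norm_triangle_le add_mono)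
qed

lemma bounded_rv_mult:
  assumes "bounded_rv M f" "bounded_rv M g" shows "bounded_rv M (\<lambda>x. f x * g x)"
proof -
  obtain K L where "0 \<le> K" "\<And>x. x \<in> space M \<Longrightarrow> norm (f x) \<le> K" "\<And>x. x \<in> space M \<Longrightarrow> norm (g x) \<le> L"
    using bounded_rvE[OF assms(1)] bounded_rvE[OF assms(2)] by metis
  then show ?thesis using bounded_rv_measurable[OF assms(1)] bounded_rv_measurable[OF assms(2)]
    by (intro bounded_rvI[where K="K * L"]) (auto simp: norm_mult intro!: mult_mono)
qed

lemma (in finite_measure) integrable_bounded_rv: "bounded_rv M f \<Longrightarrow> integrable M f"
  unfolding bounded_rv_def by (auto intro!: integrable_const_bound AE_I2)

text \<open>\<open>H\<close> is a linear space of centred, jointly Gaussian random variables; joint Gaussianity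
  is expressed by the characteristic functions of its elements.\<close>

locale gaussian_space = prob_space M for M :: "'w measure" +
  fixes H :: "('w \<Rightarrow> real) set"
  assumes H_measurable: "h \<in> H \<Longrightarrow> h \<in> borel_measurable M"
    and H_square: "h \<in> H \<Longrightarrow> integrable M (\<lambda>\<omega>. (h \<omega>)\<^sup>2)"
    and H_add: "h \<in> H \<Longrightarrow> k \<in> H \<Longrightarrow> (\<lambda>\<omega>. h \<omega> + k \<omega>) \<in> H"
    and H_scale: "h \<in> H \<Longrightarrow> (\<lambda>\<omega>. a * h \<omega>) \<in> H"
    and H_char: "h \<in> H \<Longrightarrow> (\<integral>\<omega>. cis (h \<omega>) \<partial>M) = of_real (exp (- (\<integral>\<omega>. (h \<omega>)\<^sup>2 \<partial>M) / 2))"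
begin

text \<open>Members of \<open>H\<close> are centred, so the plain product moment is the
  covariance.\<close>

definition cov :: "('w \<Rightarrow> real) \<Rightarrow> ('w \<Rightarrow> real) \<Rightarrow> real" where
  "cov h k = (\<integral>\<omega>. h \<omega> * k \<omega> \<partial>M)"

lemma cov_commute: "cov h k = cov k h"
  by (simp add: cov_def mult.commute)

lemma integrable_mult_H:
  assumes "h \<in> H" "k \<in> H" shows "integrable M (\<lambda>\<omega>. h \<omega> * k \<omega>)"
proof (rule Bochner_Integration.integrable_bound)
  show "integrable M (\<lambda>\<omega>. ((h \<omega>)\<^sup>2 + (k \<omega>)\<^sup>2) / 2)" using assms by (auto intro!: H_square)
  show "AE x in M. norm (h x * k x) \<le> norm (((h x)\<^sup>2 + (k x)\<^sup>2) / 2)"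
    using abs_mult_le_squares by (auto intro!: AE_I2)
  show "(\<lambda>\<omega>. h \<omega> * k \<omega>) \<in> borel_measurable M"
    using H_measurable[OF assms(1)] H_measurable[OF assms(2)] by measurable
qed

lemma abs_cov_le: "h \<in> H \<Longrightarrow> k \<in> H \<Longrightarrow> \<bar>cov h k\<bar> \<le> (cov h h + cov k k) / 2"
proof -
  assume *: "h \<in> H" "k \<in> H"
  have "\<bar>cov h k\<bar> \<le> (\<integral>\<omega>. ((h \<omega>)\<^sup>2 + (k \<omega>)\<^sup>2) / 2 \<partial>M)"
    unfolding cov_def real_norm_def[symmetric]
    by (rule norm_integral_le) (use * H_square abs_mult_le_squares in auto)
  also have "\<dots> = (cov h h + cov k k) / 2"
    using * by (simp add: H_square cov_def power2_eq_square[symmetric])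
  finally show ?thesis .
qed

lemma cov_add_right: "h \<in> H \<Longrightarrow> k \<in> H \<Longrightarrow> l \<in> H \<Longrightarrow> cov h (\<lambda>\<omega>. k \<omega> + l \<omega>) = cov h k + cov h l"
  using integrable_mult_H by (simp add: cov_def distrib_left)

lemma cov_scale_right: "cov h (\<lambda>\<omega>. a * k \<omega>) = a * cov h k"
  using Bochner_Integration.integral_mult_right_zero[of M a "\<lambda>\<omega>. h \<omega> * k \<omega>"]
  by (simp add: cov_def mult_ac)

lemma cov_add_left: "h \<in> H \<Longrightarrow> k \<in> H \<Longrightarrow> l \<in> H \<Longrightarrow> cov (\<lambda>\<omega>. k \<omega> + l \<omega>) h = cov k h + cov l h"
  by (metis cov_commute cov_add_right)

lemma cov_scale_left: "cov (\<lambda>\<omega>. a * k \<omega>) h = a * cov k h"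
  by (metis cov_commute cov_scale_right)

lemma char_H: "h \<in> H \<Longrightarrow> (\<integral>\<omega>. cis (h \<omega>) \<partial>M) = of_real (exp (- cov h h / 2))"
  using H_char by (simp add: cov_def power2_eq_square)

lemma char_H_add:
  "h \<in> H \<Longrightarrow> k \<in> H \<Longrightarrow>
    (\<integral>\<omega>. cis (h \<omega> + k \<omega>) \<partial>M) = of_real (exp (- (cov h h + cov k k + 2 * cov h k) / 2))"
  by (subst char_H[OF H_add]) (auto simp: cov_add_left cov_add_right H_add cov_commute[of k h] algebra_simps)

lemma cov_self_nonneg: "0 \<le> cov h h"
  unfolding cov_def by (rule integral_nonneg_AE) simp

lemma H_integrable: "h \<in> H \<Longrightarrow> integrable M h"
  using integrable_of_square H_measurable H_square by blast

text \<open>Both terms are exponentials of nonpositive numbers that differ by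
  \<open>cov h k\<close>, and \<open>exp\<close> is 1-Lipschitz there. This is how decay of
  correlation enters the fourfold integral.\<close>

lemma norm_char_diff_le:
  assumes "h \<in> H" "k \<in> H"
  shows "norm ((\<integral>\<omega>. cis (h \<omega> + k \<omega>) \<partial>M) - (\<integral>\<omega>. cis (h \<omega>) \<partial>M) * (\<integral>\<omega>. cis (k \<omega>) \<partial>M)) \<le> \<bar>cov h k\<bar>"
proof -
  have eq: "(\<integral>\<omega>. cis (h \<omega> + k \<omega>) \<partial>M) - (\<integral>\<omega>. cis (h \<omega>) \<partial>M) * (\<integral>\<omega>. cis (k \<omega>) \<partial>M)
    = of_real (exp (- ((cov h h + cov k k + 2 * cov h k) / 2)) - exp (- ((cov h h + cov k k) / 2)))"
  proof -
    have "exp (- ((cov h h + cov k k) / 2)) = exp (- cov h h / 2) * exp (- cov k k / 2)"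
      unfolding mult_exp_exp by (rule arg_cong[where f=exp]) (simp add: field_simps)
    then show ?thesis
      unfolding char_H[OF assms(1)] char_H[OF assms(2)] char_H_add[OF assms]
      by (simp only: of_real_diff of_real_mult minus_divide_left)
  qed
  have "\<bar>exp (- ((cov h h + cov k k + 2 * cov h k) / 2)) - exp (- ((cov h h + cov k k) / 2))\<bar>
      \<le> \<bar>(cov h h + cov k k + 2 * cov h k) / 2 - (cov h h + cov k k) / 2\<bar>"
  proof (rule exp_neg_lipschitz)
    have "- cov h k \<le> (cov h h + cov k k) / 2"
      using abs_cov_le[OF assms] by (rule order_trans[OF abs_ge_minus_self])
    then show "0 \<le> (cov h h + cov k k + 2 * cov h k) / 2" by simp
    show "0 \<le> (cov h h + cov k k) / 2" by (simp add: cov_self_nonneg)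
  qed
  also have "(cov h h + cov k k + 2 * cov h k) / 2 - (cov h h + cov k k) / 2 = cov h k"
    by (simp add: field_simps)
  finally show ?thesis unfolding eq norm_of_real .
qed

text \<open>The function \<open>\<tau> \<mapsto> E (cis (\<tau> * k + h))\<close> is differentiated
  at 0 in two ways: under the expectation, and through the explicit exponential of its
  variance.\<close>

lemma gaussian_ibp_cis:
  assumes "h \<in> H" "k \<in> H"
  shows "(\<integral>\<omega>. of_real (k \<omega>) * cis (h \<omega>) \<partial>M) = \<i> * of_real (cov k h) * (\<integral>\<omega>. cis (h \<omega>) \<partial>M)"
proof -
  have [measurable]: "h \<in> borel_measurable M" "k \<in> borel_measurable M"
    using assms H_measurable by auto
  have "((\<lambda>\<tau>. \<integral>\<omega>. cis (\<tau> * k \<omega>) * cis (h \<omega>) \<partial>M) has_vector_derivative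
            (\<integral>\<omega>. \<i> * of_real (k \<omega>) * (cis (0 * k \<omega>) * cis (h \<omega>)) \<partial>M)) (at 0)"
    using assms by (intro has_vector_derivative_integral_cis[where B=1]) (auto simp: H_square)
  moreover have "(\<integral>\<omega>. cis (\<tau> * k \<omega>) * cis (h \<omega>) \<partial>M)
        = of_real (exp (- (cov h h + \<tau>\<^sup>2 * cov k k + 2 * \<tau> * cov k h) / 2))" for \<tau>
    unfolding cis_mult using assms
    by (subst char_H_add) (auto simp: H_scale cov_scale_left cov_scale_right power2_eq_square algebra_simps)
  moreover have "((\<lambda>\<tau>. of_real (exp (- (cov h h + \<tau>\<^sup>2 * cov k k + 2 * \<tau> * cov k h) / 2)) :: complex) has_vector_derivative
        of_real (exp (- cov h h / 2) * (- cov k h))) (at 0)"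
    by (rule has_vector_derivative_of_real) (auto intro!: derivative_eq_intros)
  ultimately have "(\<integral>\<omega>. \<i> * of_real (k \<omega>) * (cis (0 * k \<omega>) * cis (h \<omega>)) \<partial>M) = of_real (exp (- cov h h / 2) * (- cov k h))"
    using vector_derivative_unique_at by simp
  then have "\<i> * (\<integral>\<omega>. of_real (k \<omega>) * cis (h \<omega>) \<partial>M) = \<i> * (\<i> * of_real (cov k h) * (\<integral>\<omega>. cis (h \<omega>) \<partial>M))"
    using assms by (simp add: char_H mult.assoc)
  then show ?thesis by simp
qed

end

text \<open>The index set is an abstract finite measure space, later Lebesgue measure restricted to
  a window. Unit variance makes the Gaussian mean of \<open>trig I c (g t)\<close> the same for
  every \<open>t\<close>.\<close>

locale gaussian_integral = gaussian_space M H + mu: finite_measure \<mu>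
  for M :: "'w measure" and H and \<mu> :: "'s measure" +
  fixes g :: "'s \<Rightarrow> 'w \<Rightarrow> real" and I :: "real set" and c :: "real \<Rightarrow> complex"
  assumes g_H: "t \<in> space \<mu> \<Longrightarrow> g t \<in> H"
    and g_measurable: "(\<lambda>(t, \<omega>). g t \<omega>) \<in> borel_measurable (\<mu> \<Otimes>\<^sub>M M)"
    and g_unit: "t \<in> space \<mu> \<Longrightarrow> cov (g t) (g t) = 1"
    and finite_I: "finite I"
begin

lemma measurable_g [measurable (raw)]:
  assumes [measurable]: "f \<in> measurable N \<mu>" "h \<in> measurable N M"
  shows "(\<lambda>x. g (f x) (h x)) \<in> borel_measurable N"
proof -
  have "(\<lambda>x. (\<lambda>(t, \<omega>). g t \<omega>) (f x, h x)) \<in> borel_measurable N"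
    by (rule measurable_compose[OF _ g_measurable]) measurable
  then show ?thesis by simp
qed

definition F :: "'w \<Rightarrow> complex" where
  "F \<omega> = (\<integral>t. trig I c (g t \<omega>) \<partial>\<mu>)"

lemma bounded_rv_trig: "bounded_rv M (\<lambda>\<omega>. trig I d (g t \<omega>))" if "t \<in> space \<mu>"
  using that by (intro bounded_rvI[OF _ norm_trig_le]) measurable

lemma bounded_rv_cis: "bounded_rv M (\<lambda>\<omega>. cis (h \<omega>))" if "h \<in> H"
  using H_measurable[OF that] by (intro bounded_rvI[where K=1]) auto

lemma bounded_rv_F: "bounded_rv M F"
proof (rule bounded_rvI)
  show "F \<in> borel_measurable M" unfolding F_def by measurable
  fix \<omega> assume "\<omega> \<in> space M"
  show "norm (F \<omega>) \<le> (\<integral>t. (\<Sum>a\<in>I. norm (c a)) \<partial>\<mu>)"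
    unfolding F_def by (rule norm_integral_le) (auto intro: norm_trig_le)
qed

lemma cov_measurable [measurable]:
  assumes "k \<in> H" shows "(\<lambda>t. cov k (g t)) \<in> borel_measurable \<mu>"
proof -
  note [measurable] = H_measurable[OF assms]
  show ?thesis unfolding cov_def by measurable
qed

lemma cov_g_bound: "k \<in> H \<Longrightarrow> t \<in> space \<mu> \<Longrightarrow> \<bar>cov k (g t)\<bar> \<le> (cov k k + 1) / 2"
  using abs_cov_le[of k "g t"] g_H g_unit by simp

text \<open>\<open>ibp B D\<close>: Gaussian integration by parts holds for the functional \<open>B\<close>, whose derivative
  in the direction of the value of the field at \<open>t\<close> is \<open>\<phi>' (g t) * D\<close> with \<open>\<phi> = trig I c\<close>.\<close>

definition ibp :: "('w \<Rightarrow> complex) \<Rightarrow> ('w \<Rightarrow> complex) \<Rightarrow> bool" where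
  "ibp B D \<longleftrightarrow> bounded_rv M B \<and> bounded_rv M D \<and>
     (\<forall>h\<in>H. \<forall>k\<in>H. (\<integral>\<omega>. of_real (k \<omega>) * (cis (h \<omega>) * B \<omega>) \<partial>M) =
        \<i> * of_real (cov k h) * (\<integral>\<omega>. cis (h \<omega>) * B \<omega> \<partial>M)
        + (\<integral>t. of_real (cov k (g t)) * (\<integral>\<omega>. trig I (dcoef c) (g t \<omega>) * (cis (h \<omega>) * D \<omega>) \<partial>M) \<partial>\<mu>))"

lemma ibpD:
  assumes "ibp B D" "h \<in> H" "k \<in> H"
  shows "(\<integral>\<omega>. of_real (k \<omega>) * (cis (h \<omega>) * B \<omega>) \<partial>M) =
        \<i> * of_real (cov k h) * (\<integral>\<omega>. cis (h \<omega>) * B \<omega> \<partial>M)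
        + (\<integral>t. of_real (cov k (g t)) * (\<integral>\<omega>. trig I (dcoef c) (g t \<omega>) * (cis (h \<omega>) * D \<omega>) \<partial>M) \<partial>\<mu>)"
  using assms by (auto simp: ibp_def)

lemma ibp_bounded: "ibp B D \<Longrightarrow> bounded_rv M B" "ibp B D \<Longrightarrow> bounded_rv M D"
  by (auto simp: ibp_def)

lemma ibp_one: "ibp (\<lambda>_. 1) (\<lambda>_. 0)"
  unfolding ibp_def by (auto simp: gaussian_ibp_cis bounded_rv_const)

lemma bounded_inner:
  assumes "k \<in> H" "bounded_rv M C"
  shows "bounded_rv \<mu> (\<lambda>t. of_real (cov k (g t)) * (\<integral>\<omega>. trig I d (g t \<omega>) * C \<omega> \<partial>M))"
proof -
  obtain K where K: "0 \<le> K" "\<And>\<omega>. \<omega> \<in> space M \<Longrightarrow> norm (C \<omega>) \<le> K"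
    using bounded_rvE[OF assms(2)] by metis
  note [measurable] = bounded_rv_measurable[OF assms(2)] assms(1)
  show ?thesis
  proof (rule bounded_rvI[where K="(cov k k + 1) / 2 * ((\<Sum>a\<in>I. norm (d a)) * K)"])
    fix t assume t: "t \<in> space \<mu>"
    have "norm (\<integral>\<omega>. trig I d (g t \<omega>) * C \<omega> \<partial>M) \<le> (\<integral>\<omega>. (\<Sum>a\<in>I. norm (d a)) * K \<partial>M)"
      by (rule norm_integral_le) (auto simp: norm_mult intro!: mult_mono norm_trig_le K sum_nonneg)
    then show "norm (of_real (cov k (g t)) * (\<integral>\<omega>. trig I d (g t \<omega>) * C \<omega> \<partial>M))
        \<le> (cov k k + 1) / 2 * ((\<Sum>a\<in>I. norm (d a)) * K)"
      unfolding norm_mult using cov_g_bound[OF assms(1) t]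
      by (intro mult_mono) (auto simp: prob_space)
  qed measurable
qed

text \<open>Linearity, multiplication by \<open>F\<close> and bounded pointwise limits are the
  closure rules that generate \<open>exp (z * F)\<close> from the constant 1. No differentiation on
  the probability space has to be defined.\<close>

lemma ibp_lincomb:
  assumes "ibp B D" "ibp B' D'"
  shows "ibp (\<lambda>\<omega>. B \<omega> + z * B' \<omega>) (\<lambda>\<omega>. D \<omega> + z * D' \<omega>)"
  unfolding ibp_def
proof (intro conjI ballI)
  show "bounded_rv M (\<lambda>\<omega>. B \<omega> + z * B' \<omega>)" "bounded_rv M (\<lambda>\<omega>. D \<omega> + z * D' \<omega>)"
    by (intro bounded_rv_add bounded_rv_mult[of M "\<lambda>_. z"] bounded_rv_const ibp_bounded(1)[OF assms(1)]
        ibp_bounded(2)[OF assms(1)] ibp_bounded(1)[OF assms(2)] ibp_bounded(2)[OF assms(2)])+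
  fix h k assume h: "h \<in> H" and k: "k \<in> H"
  have k': "integrable M (\<lambda>\<omega>. of_real (k \<omega>) :: complex)" using H_integrable[OF k] by simp
  have I: "integrable M (\<lambda>\<omega>. of_real (k \<omega>) * (cis (h \<omega>) * C \<omega>))" 
    and J: "integrable M (\<lambda>\<omega>. cis (h \<omega>) * C \<omega>)" 
    and L: "t \<in> space \<mu> \<Longrightarrow> integrable M (\<lambda>\<omega>. trig I d (g t \<omega>) * (cis (h \<omega>) * C \<omega>))"
    and N: "integrable \<mu> (\<lambda>t. of_real (cov k (g t)) * (\<integral>\<omega>. trig I d (g t \<omega>) * (cis (h \<omega>) * C \<omega>) \<partial>M))"
    if C: "bounded_rv M C" for C d t
  proof -
    have *: "bounded_rv M (\<lambda>\<omega>. cis (h \<omega>) * C \<omega>)"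
      by (intro bounded_rv_mult bounded_rv_cis h C)
    from bounded_rvE[OF *] obtain K where K: "\<And>\<omega>. \<omega> \<in> space M \<Longrightarrow> norm (cis (h \<omega>) * C \<omega>) \<le> K" by blast
    show "integrable M (\<lambda>\<omega>. of_real (k \<omega>) * (cis (h \<omega>) * C \<omega>))"
      by (rule integrable_mult_bounded[OF k' bounded_rv_measurable[OF *] K])
    show "integrable M (\<lambda>\<omega>. cis (h \<omega>) * C \<omega>)" using * by (rule integrable_bounded_rv)
    show "t \<in> space \<mu> \<Longrightarrow> integrable M (\<lambda>\<omega>. trig I d (g t \<omega>) * (cis (h \<omega>) * C \<omega>))"
      by (intro integrable_bounded_rv bounded_rv_mult[of M _ "\<lambda>\<omega>. cis (h \<omega>) * C \<omega>"] bounded_rv_trig *)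
    show "integrable \<mu> (\<lambda>t. of_real (cov k (g t)) * (\<integral>\<omega>. trig I d (g t \<omega>) * (cis (h \<omega>) * C \<omega>) \<partial>M))"
      by (intro mu.integrable_bounded_rv bounded_inner k *)
  qed
  note b = ibp_bounded[OF assms(1)] ibp_bounded[OF assms(2)]
  let ?G = "\<lambda>C t. \<integral>\<omega>. trig I (dcoef c) (g t \<omega>) * (cis (h \<omega>) * C \<omega>) \<partial>M"
  have lin: "(\<integral>\<omega>. v \<omega> + z * w \<omega> \<partial>N) = (\<integral>\<omega>. v \<omega> \<partial>N) + z * (\<integral>\<omega>. w \<omega> \<partial>N)"
    if "integrable N v" "integrable N w" for v w :: "'x \<Rightarrow> complex" and N
    using that by simp
  have dist: "x * (y * (u + z * w)) = x * (y * u) + z * (x * (y * w))"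
    "y * (u + z * w) = y * u + z * (y * w)" for x y u w :: complex
    by (simp_all add: algebra_simps)
  have e: "(\<integral>t. of_real (cov k (g t)) * ?G (\<lambda>\<omega>. D \<omega> + z * D' \<omega>) t \<partial>\<mu>)
     = (\<integral>t. of_real (cov k (g t)) * ?G D t + z * (of_real (cov k (g t)) * ?G D' t) \<partial>\<mu>)"
  proof (intro Bochner_Integration.integral_cong refl)
    fix t assume t: "t \<in> space \<mu>"
    show "of_real (cov k (g t)) * ?G (\<lambda>\<omega>. D \<omega> + z * D' \<omega>) t =
      of_real (cov k (g t)) * ?G D t + z * (of_real (cov k (g t)) * ?G D' t)"
      unfolding dist(1) lin[OF L[OF b(2) t] L[OF b(4) t]] dist(2) ..
  qed
  show "(\<integral>\<omega>. of_real (k \<omega>) * (cis (h \<omega>) * (B \<omega> + z * B' \<omega>)) \<partial>M) =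
        \<i> * of_real (cov k h) * (\<integral>\<omega>. cis (h \<omega>) * (B \<omega> + z * B' \<omega>) \<partial>M)
        + (\<integral>t. of_real (cov k (g t)) * ?G (\<lambda>\<omega>. D \<omega> + z * D' \<omega>) t \<partial>\<mu>)"
    unfolding e
    unfolding lin[OF N[OF b(2)] N[OF b(4)]] dist(1) dist(2) lin[OF I[OF b(1)] I[OF b(3)]] lin[OF J[OF b(1)] J[OF b(3)]]
      ibpD[OF assms(1) h k] ibpD[OF assms(2) h k] by (simp only: ring_distribs ac_simps)
qed

lemma integral_trig_expand:
  assumes K: "integrable M K" and C: "bounded_rv M C" and t: "t \<in> space \<mu>"
  shows "(\<integral>\<omega>. K \<omega> * (trig I d (g t \<omega>) * C \<omega>) \<partial>M)
       = (\<Sum>a\<in>I. d a * (\<integral>\<omega>. K \<omega> * (cis (a * g t \<omega>) * C \<omega>) \<partial>M))"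
proof -
  have int: "integrable M (\<lambda>\<omega>. K \<omega> * (cis (a * g t \<omega>) * C \<omega>))" for a
  proof -
    have "bounded_rv M (\<lambda>\<omega>. cis (a * g t \<omega>) * C \<omega>)"
      using g_H[OF t] by (intro bounded_rv_mult bounded_rv_cis C H_scale)
    then show ?thesis by (auto simp: bounded_rv_def intro: integrable_mult_bounded[OF K])
  qed
  have "(\<integral>\<omega>. K \<omega> * (trig I d (g t \<omega>) * C \<omega>) \<partial>M)
      = (\<integral>\<omega>. (\<Sum>a\<in>I. d a * (K \<omega> * (cis (a * g t \<omega>) * C \<omega>))) \<partial>M)"
    by (intro Bochner_Integration.integral_cong refl)
       (simp add: trig_def sum_distrib_left sum_distrib_right mult_ac)
  also have "\<dots> = (\<Sum>a\<in>I. d a * (\<integral>\<omega>. K \<omega> * (cis (a * g t \<omega>) * C \<omega>) \<partial>M))"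
    using int by (subst Bochner_Integration.integral_sum) auto
  finally show ?thesis .
qed

lemma bounded_rv_Fubini:
  assumes K: "integrable M K" and C: "bounded_rv M C"
  shows "(\<integral>\<omega>. K \<omega> * ((\<integral>t. trig I d (g t \<omega>) \<partial>\<mu>) * C \<omega>) \<partial>M)
       = (\<integral>t. (\<integral>\<omega>. K \<omega> * (trig I d (g t \<omega>) * C \<omega>) \<partial>M) \<partial>\<mu>)"
proof -
  obtain B where B: "0 \<le> B" "\<And>x. x \<in> space M \<Longrightarrow> norm (C x) \<le> B" using bounded_rvE[OF C] by metis
  note [measurable] = bounded_rv_measurable[OF C] borel_measurable_integrable[OF K]
  have "(\<integral>\<omega>. K \<omega> * ((\<integral>t. trig I d (g t \<omega>) \<partial>\<mu>) * C \<omega>) \<partial>M)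
      = (\<integral>\<omega>. (\<integral>t. K \<omega> * (trig I d (g t \<omega>) * C \<omega>) \<partial>\<mu>) \<partial>M)"
    by simp
  also have "\<dots> = (\<integral>t. (\<integral>\<omega>. K \<omega> * (trig I d (g t \<omega>) * C \<omega>) \<partial>M) \<partial>\<mu>)"
  proof (rule Fubini_bounded_swap[OF mu.finite_measure_axioms finite_measure_axioms])
    show "integrable M (\<lambda>\<omega>. norm (K \<omega>) * ((\<Sum>a\<in>I. norm (d a)) * B))" using K by simp
    show "norm (K \<omega> * (trig I d (g t \<omega>) * C \<omega>)) \<le> norm (K \<omega>) * ((\<Sum>a\<in>I. norm (d a)) * B)"
      if "\<omega> \<in> space M" for t \<omega>
      unfolding norm_mult using that by (intro mult_left_mono mult_mono norm_trig_le B) (auto intro: sum_nonneg)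
  qed measurable
  finally show ?thesis .
qed

lemma bounded_rv_inner_fst:
  assumes "bounded_rv M C"
  shows "bounded_rv \<mu> (\<lambda>t. \<integral>\<omega>. trig I d (g t \<omega>) * C \<omega> \<partial>M)"
proof -
  obtain B where B: "0 \<le> B" "\<And>x. x \<in> space M \<Longrightarrow> norm (C x) \<le> B" using bounded_rvE[OF assms] by metis
  note [measurable] = bounded_rv_measurable[OF assms]
  show ?thesis
  proof (rule bounded_rvI)
    show "norm (\<integral>\<omega>. trig I d (g t \<omega>) * C \<omega> \<partial>M) \<le> (\<integral>\<omega>. (\<Sum>a\<in>I. norm (d a)) * B \<partial>M)" for t
      by (rule norm_integral_le) (auto simp: norm_mult intro!: mult_mono norm_trig_le B sum_nonneg)
  qed measurable
qed

text \<open>Multiplication by \<open>cis (a * g t)\<close> merely shifts \<open>h\<close> to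
  \<open>h + a * g t\<close> inside \<open>H\<close>, and \<open>ibp\<close> is quantified over all
  such \<open>h\<close>. The second term on the right collects the extra covariances
  \<open>a * cov k (g t)\<close>; this is the reason for the factor \<open>cis (h \<omega>)\<close>
  in \<open>ibp\<close>.\<close>

lemma ibp_mult_trig:
  assumes ibp: "ibp B D" and h: "h \<in> H" and k: "k \<in> H" and t: "t \<in> space \<mu>"
  shows "(\<integral>\<omega>. of_real (k \<omega>) * cis (h \<omega>) * (trig I c (g t \<omega>) * B \<omega>) \<partial>M) =
     \<i> * of_real (cov k h) * (\<integral>\<omega>. cis (h \<omega>) * (trig I c (g t \<omega>) * B \<omega>) \<partial>M)
     + of_real (cov k (g t)) * (\<integral>\<omega>. cis (h \<omega>) * (trig I (dcoef c) (g t \<omega>) * B \<omega>) \<partial>M)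
     + (\<integral>s. of_real (cov k (g s)) *
           (\<integral>\<omega>. trig I (dcoef c) (g s \<omega>) * cis (h \<omega>) * (trig I c (g t \<omega>) * D \<omega>) \<partial>M) \<partial>\<mu>)"
proof -
  note b = ibp_bounded[OF ibp]
  have kint: "integrable M (\<lambda>\<omega>. of_real (k \<omega>) :: complex)" using H_integrable[OF k] by simp
  have kh: "integrable M (\<lambda>\<omega>. of_real (k \<omega>) * cis (h \<omega>))"
    using bounded_rv_cis[OF h] by (auto simp: bounded_rv_def intro: integrable_mult_bounded[OF kint])
  have sh: "integrable M (\<lambda>\<omega>. trig I (dcoef c) (g s \<omega>) * cis (h \<omega>))" if "s \<in> space \<mu>" for s
    using that by (intro integrable_bounded_rv bounded_rv_mult bounded_rv_trig bounded_rv_cis h)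
  have hH: "(\<lambda>\<omega>. h \<omega> + a * g t \<omega>) \<in> H" for a using h g_H[OF t] by (intro H_add H_scale)
  define P where "P a = (\<integral>\<omega>. cis (h \<omega>) * (cis (a * g t \<omega>) * B \<omega>) \<partial>M)" for a
  define Q where "Q a s = of_real (cov k (g s)) *
      (\<integral>\<omega>. trig I (dcoef c) (g s \<omega>) * cis (h \<omega>) * (cis (a * g t \<omega>) * D \<omega>) \<partial>M)" for a s
  have Qint: "integrable \<mu> (Q a)" for a
  proof -
    have "bounded_rv \<mu> (\<lambda>s. of_real (cov k (g s)) *
      (\<integral>\<omega>. trig I (dcoef c) (g s \<omega>) * (cis (h \<omega>) * (cis (a * g t \<omega>) * D \<omega>)) \<partial>M))"
      using g_H[OF t] by (intro bounded_inner k bounded_rv_mult bounded_rv_cis h b H_scale)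
    then show ?thesis unfolding Q_def by (intro mu.integrable_bounded_rv) (simp add: mult.assoc)
  qed
  have "(\<integral>\<omega>. of_real (k \<omega>) * cis (h \<omega>) * (trig I c (g t \<omega>) * B \<omega>) \<partial>M)
     = (\<Sum>a\<in>I. c a * (\<integral>\<omega>. of_real (k \<omega>) * cis (h \<omega>) * (cis (a * g t \<omega>) * B \<omega>) \<partial>M))"
    by (rule integral_trig_expand[OF kh b(1) t])
  also have "\<dots> = (\<Sum>a\<in>I. c a * (\<i> * of_real (cov k h + a * cov k (g t)) * P a + (\<integral>s. Q a s \<partial>\<mu>)))"
  proof (intro sum.cong refl arg_cong2[where f="(*)"])
    fix a
    have "(\<integral>\<omega>. of_real (k \<omega>) * cis (h \<omega>) * (cis (a * g t \<omega>) * B \<omega>) \<partial>M)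
        = (\<integral>\<omega>. of_real (k \<omega>) * (cis (h \<omega> + a * g t \<omega>) * B \<omega>) \<partial>M)"
      by (simp add: cis_mult[symmetric] mult.assoc)
    also have "\<dots> = \<i> * of_real (cov k (\<lambda>\<omega>. h \<omega> + a * g t \<omega>)) * (\<integral>\<omega>. cis (h \<omega> + a * g t \<omega>) * B \<omega> \<partial>M)
        + (\<integral>s. of_real (cov k (g s)) * (\<integral>\<omega>. trig I (dcoef c) (g s \<omega>) * (cis (h \<omega> + a * g t \<omega>) * D \<omega>) \<partial>M) \<partial>\<mu>)"
      by (rule ibpD[OF ibp hH k])
    also have "cov k (\<lambda>\<omega>. h \<omega> + a * g t \<omega>) = cov k h + a * cov k (g t)"
      using h k g_H[OF t] by (simp add: cov_add_right cov_scale_right H_scale)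
    finally show "(\<integral>\<omega>. of_real (k \<omega>) * cis (h \<omega>) * (cis (a * g t \<omega>) * B \<omega>) \<partial>M)
        = \<i> * of_real (cov k h + a * cov k (g t)) * P a + (\<integral>s. Q a s \<partial>\<mu>)"
      by (simp add: P_def Q_def cis_mult[symmetric] mult.assoc)
  qed
  also have "\<dots> = \<i> * of_real (cov k h) * (\<Sum>a\<in>I. c a * P a) + of_real (cov k (g t)) * (\<Sum>a\<in>I. dcoef c a * P a)
      + (\<Sum>a\<in>I. \<integral>s. c a * Q a s \<partial>\<mu>)"
    by (simp add: sum.distrib sum_distrib_left algebra_simps)
  also have "(\<Sum>a\<in>I. \<integral>s. c a * Q a s \<partial>\<mu>) = (\<integral>s. (\<Sum>a\<in>I. c a * Q a s) \<partial>\<mu>)"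
    using Qint by (subst Bochner_Integration.integral_sum) auto
  also have "\<dots> = (\<integral>s. of_real (cov k (g s)) *
           (\<integral>\<omega>. trig I (dcoef c) (g s \<omega>) * cis (h \<omega>) * (trig I c (g t \<omega>) * D \<omega>) \<partial>M) \<partial>\<mu>)"
  proof (intro Bochner_Integration.integral_cong refl)
    fix s assume s: "s \<in> space \<mu>"
    show "(\<Sum>a\<in>I. c a * Q a s) = of_real (cov k (g s)) *
           (\<integral>\<omega>. trig I (dcoef c) (g s \<omega>) * cis (h \<omega>) * (trig I c (g t \<omega>) * D \<omega>) \<partial>M)"
      unfolding Q_def integral_trig_expand[OF sh[OF s] b(2) t] sum_distrib_left
      by (intro sum.cong refl mult.left_commute)
  qed
  also have "(\<Sum>a\<in>I. c a * P a) = (\<integral>\<omega>. cis (h \<omega>) * (trig I c (g t \<omega>) * B \<omega>) \<partial>M)"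
    unfolding P_def by (rule integral_trig_expand[symmetric, OF integrable_bounded_rv[OF bounded_rv_cis[OF h]] b(1) t])
  also have "(\<Sum>a\<in>I. dcoef c a * P a) = (\<integral>\<omega>. cis (h \<omega>) * (trig I (dcoef c) (g t \<omega>) * B \<omega>) \<partial>M)"
    unfolding P_def by (rule integral_trig_expand[symmetric, OF integrable_bounded_rv[OF bounded_rv_cis[OF h]] b(1) t])
  finally show ?thesis .
qed

text \<open>The new derivative is the Leibniz rule: the derivative of \<open>F\<close> towards the
  value at \<open>t\<close> is \<open>\<phi>' (g t) * 1\<close>, so the factor accompanying
  \<open>\<phi>' (g t)\<close> becomes \<open>B + F * D\<close>.\<close>

lemma ibp_mult:
  assumes ibp: "ibp B D"
  shows "ibp (\<lambda>\<omega>. F \<omega> * B \<omega>) (\<lambda>\<omega>. B \<omega> + F \<omega> * D \<omega>)"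
  unfolding ibp_def
proof (intro conjI ballI)
  note b = ibp_bounded[OF ibp]
  show "bounded_rv M (\<lambda>\<omega>. F \<omega> * B \<omega>)" by (intro bounded_rv_mult bounded_rv_F b)
  show "bounded_rv M (\<lambda>\<omega>. B \<omega> + F \<omega> * D \<omega>)" by (intro bounded_rv_add bounded_rv_mult bounded_rv_F b)
  fix h k assume h: "h \<in> H" and k: "k \<in> H"
  have [measurable]: "h \<in> borel_measurable M" "k \<in> borel_measurable M" "k \<in> H"
    "B \<in> borel_measurable M" "D \<in> borel_measurable M"
    using h k H_measurable b bounded_rv_measurable by auto
  have kint: "integrable M (\<lambda>\<omega>. of_real (k \<omega>) :: complex)" using H_integrable[OF k] by simp
  have kh: "integrable M (\<lambda>\<omega>. of_real (k \<omega>) * cis (h \<omega>))"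
    using bounded_rv_cis[OF h] by (auto simp: bounded_rv_def intro: integrable_mult_bounded[OF kint])
  have ch: "integrable M (\<lambda>\<omega>. cis (h \<omega>))" by (rule integrable_bounded_rv[OF bounded_rv_cis[OF h]])
  have sh: "integrable M (\<lambda>\<omega>. trig I (dcoef c) (g s \<omega>) * cis (h \<omega>))" if "s \<in> space \<mu>" for s
    using that by (intro integrable_bounded_rv bounded_rv_mult bounded_rv_trig bounded_rv_cis h)
  define P where "P t = (\<integral>\<omega>. cis (h \<omega>) * (trig I c (g t \<omega>) * B \<omega>) \<partial>M)" for t
  define Q where "Q t = of_real (cov k (g t)) * (\<integral>\<omega>. trig I (dcoef c) (g t \<omega>) * (cis (h \<omega>) * B \<omega>) \<partial>M)" for t
  define N where "N s t = (\<integral>\<omega>. trig I (dcoef c) (g s \<omega>) * cis (h \<omega>) * (trig I c (g t \<omega>) * D \<omega>) \<partial>M)" for s t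
  define S where "S s = of_real (cov k (g s)) * (\<integral>\<omega>. trig I (dcoef c) (g s \<omega>) * (cis (h \<omega>) * (F \<omega> * D \<omega>)) \<partial>M)" for s
  have Pint: "integrable \<mu> P"
    using bounded_rv_inner_fst[of "\<lambda>\<omega>. cis (h \<omega>) * B \<omega>" c] bounded_rv_mult[OF bounded_rv_cis[OF h] b(1)]
    unfolding P_def by (intro mu.integrable_bounded_rv) (simp add: mult.left_commute)
  have Qint: "integrable \<mu> Q"
    unfolding Q_def by (intro mu.integrable_bounded_rv bounded_inner k bounded_rv_mult bounded_rv_cis h b)
  have Sint: "integrable \<mu> S"
    unfolding S_def by (intro mu.integrable_bounded_rv bounded_inner k bounded_rv_mult bounded_rv_cis h b bounded_rv_F)
  obtain K where K: "0 \<le> K" "\<And>x. x \<in> space M \<Longrightarrow> norm (D x) \<le> K" using bounded_rvE[OF b(2)] by metis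
  define L where "L = (cov k k + 1) / 2 * ((\<Sum>a\<in>I. norm (dcoef c a)) * ((\<Sum>a\<in>I. norm (c a)) * K))"
  have N_meas: "(\<lambda>(s, t). of_real (cov k (g s)) * N s t) \<in> borel_measurable (\<mu> \<Otimes>\<^sub>M \<mu>)"
    unfolding N_def by measurable
  have N_le: "norm (of_real (cov k (g s)) * N s t) \<le> L" if "s \<in> space \<mu>" for s t
  proof -
    have "norm (N s t) \<le> (\<integral>\<omega>. (\<Sum>a\<in>I. norm (dcoef c a)) * ((\<Sum>a\<in>I. norm (c a)) * K) \<partial>M)"
      unfolding N_def
    proof (rule norm_integral_le)
      fix \<omega> assume \<omega>: "\<omega> \<in> space M"
      show "norm (trig I (dcoef c) (g s \<omega>) * cis (h \<omega>) * (trig I c (g t \<omega>) * D \<omega>))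
        \<le> (\<Sum>a\<in>I. norm (dcoef c a)) * ((\<Sum>a\<in>I. norm (c a)) * K)"
        unfolding norm_mult norm_cis mult_1_right
        by (intro mult_mono norm_trig_le[of I "dcoef c", unfolded norm_mult] norm_trig_le K \<omega> mult_nonneg_nonneg sum_nonneg norm_ge_zero)
    qed simp
    then show ?thesis
      unfolding norm_mult L_def using cov_g_bound[OF k that] by (intro mult_mono) (auto simp: prob_space norm_mult)
  qed
  have "(\<integral>\<omega>. of_real (k \<omega>) * (cis (h \<omega>) * (F \<omega> * B \<omega>)) \<partial>M)
      = (\<integral>t. (\<integral>\<omega>. of_real (k \<omega>) * cis (h \<omega>) * (trig I c (g t \<omega>) * B \<omega>) \<partial>M) \<partial>\<mu>)"
    unfolding F_def using bounded_rv_Fubini[OF kh b(1), of c] by (simp only: mult.assoc)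
  also have "\<dots> = (\<integral>t. \<i> * of_real (cov k h) * P t + Q t + (\<integral>s. of_real (cov k (g s)) * N s t \<partial>\<mu>) \<partial>\<mu>)"
    by (intro Bochner_Integration.integral_cong refl)
       (simp only: ibp_mult_trig[OF ibp h k] P_def Q_def N_def mult.left_commute[of "trig I (dcoef c) (g _ _)" "cis _"])
  also have "\<dots> = \<i> * of_real (cov k h) * (\<integral>t. P t \<partial>\<mu>) + (\<integral>t. Q t \<partial>\<mu>)
       + (\<integral>t. (\<integral>s. of_real (cov k (g s)) * N s t \<partial>\<mu>) \<partial>\<mu>)"
  proof -
    have "integrable \<mu> (\<lambda>t. \<integral>s. of_real (cov k (g s)) * N s t \<partial>\<mu>)"
    proof (rule mu.integrable_bounded_rv, rule bounded_rvI)
      show "norm (\<integral>s. of_real (cov k (g s)) * N s t \<partial>\<mu>) \<le> (\<integral>s. L \<partial>\<mu>)" for t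
        by (rule norm_integral_le) (auto simp: N_le)
    qed (unfold N_def, measurable)
    then show ?thesis using Pint Qint by simp
  qed
  \<comment> \<open>Exchanging \<open>s\<close> and \<open>t\<close> lets the inner integral over
    \<open>t\<close> recombine into \<open>F\<close>.\<close>
  also have "(\<integral>t. (\<integral>s. of_real (cov k (g s)) * N s t \<partial>\<mu>) \<partial>\<mu>)
       = (\<integral>s. (\<integral>t. of_real (cov k (g s)) * N s t \<partial>\<mu>) \<partial>\<mu>)"
    by (rule Fubini_bounded_swap[OF mu.finite_measure_axioms mu.finite_measure_axioms N_meas, where k="\<lambda>_. L"])
       (simp_all add: N_le)
  also have "\<dots> = (\<integral>s. S s \<partial>\<mu>)"
  proof (intro Bochner_Integration.integral_cong refl)
    fix s assume s: "s \<in> space \<mu>"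
    have "(\<integral>t. N s t \<partial>\<mu>) = (\<integral>\<omega>. trig I (dcoef c) (g s \<omega>) * (cis (h \<omega>) * (F \<omega> * D \<omega>)) \<partial>M)"
      unfolding N_def F_def using bounded_rv_Fubini[OF sh[OF s] b(2), of c] by (simp only: mult.assoc)
    then show "(\<integral>t. of_real (cov k (g s)) * N s t \<partial>\<mu>) = S s"
      unfolding S_def by simp
  qed
  also have "(\<integral>t. P t \<partial>\<mu>) = (\<integral>\<omega>. cis (h \<omega>) * (F \<omega> * B \<omega>) \<partial>M)"
    unfolding P_def F_def by (rule bounded_rv_Fubini[OF ch b(1), symmetric])
  also have "\<i> * of_real (cov k h) * (\<integral>\<omega>. cis (h \<omega>) * (F \<omega> * B \<omega>) \<partial>M) + (\<integral>t. Q t \<partial>\<mu>) + (\<integral>s. S s \<partial>\<mu>)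
     = \<i> * of_real (cov k h) * (\<integral>\<omega>. cis (h \<omega>) * (F \<omega> * B \<omega>) \<partial>M) + (\<integral>t. Q t + S t \<partial>\<mu>)"
    using Qint Sint by simp
  also have "(\<integral>t. Q t + S t \<partial>\<mu>) =
     (\<integral>t. of_real (cov k (g t)) * (\<integral>\<omega>. trig I (dcoef c) (g t \<omega>) * (cis (h \<omega>) * (B \<omega> + F \<omega> * D \<omega>)) \<partial>M) \<partial>\<mu>)"
  proof (intro Bochner_Integration.integral_cong refl)
    fix t assume t: "t \<in> space \<mu>"
    have 1: "integrable M (\<lambda>\<omega>. trig I (dcoef c) (g t \<omega>) * (cis (h \<omega>) * B \<omega>))"
      and 2: "integrable M (\<lambda>\<omega>. trig I (dcoef c) (g t \<omega>) * (cis (h \<omega>) * (F \<omega> * D \<omega>)))"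
      using t by (intro integrable_bounded_rv bounded_rv_mult bounded_rv_trig bounded_rv_cis h b bounded_rv_F; assumption)+
    show "Q t + S t = of_real (cov k (g t)) * (\<integral>\<omega>. trig I (dcoef c) (g t \<omega>) * (cis (h \<omega>) * (B \<omega> + F \<omega> * D \<omega>)) \<partial>M)"
      unfolding Q_def S_def distrib_left[of "cis _"] distrib_left[of "trig _ _ _"] Bochner_Integration.integral_add[OF 1 2]
      by (rule distrib_left[symmetric])
  qed
  finally show "(\<integral>\<omega>. of_real (k \<omega>) * (cis (h \<omega>) * (F \<omega> * B \<omega>)) \<partial>M) =
        \<i> * of_real (cov k h) * (\<integral>\<omega>. cis (h \<omega>) * (F \<omega> * B \<omega>) \<partial>M)
        + (\<integral>t. of_real (cov k (g t)) * (\<integral>\<omega>. trig I (dcoef c) (g t \<omega>) * (cis (h \<omega>) * (B \<omega> + F \<omega> * D \<omega>)) \<partial>M) \<partial>\<mu>)" .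
qed

text \<open>One bound \<open>K\<close> for all \<open>B n\<close> and \<open>D n\<close> dominates
  both sides of the identity; on the left it is multiplied by the integrable variable
  \<open>\<bar>k\<bar>\<close>.\<close>

lemma ibp_limit:
  assumes ibp: "\<And>n. ibp (B n) (D n)"
    and lim: "\<And>\<omega>. \<omega> \<in> space M \<Longrightarrow> (\<lambda>n. B n \<omega>) \<longlonglongrightarrow> B' \<omega>" "\<And>\<omega>. \<omega> \<in> space M \<Longrightarrow> (\<lambda>n. D n \<omega>) \<longlonglongrightarrow> D' \<omega>"
    and bound: "\<And>n \<omega>. \<omega> \<in> space M \<Longrightarrow> norm (B n \<omega>) \<le> K" "\<And>n \<omega>. \<omega> \<in> space M \<Longrightarrow> norm (D n \<omega>) \<le> K"
  shows "ibp B' D'"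
proof -
  note [measurable] = bounded_rv_measurable[OF ibp_bounded(1)[OF ibp]] bounded_rv_measurable[OF ibp_bounded(2)[OF ibp]]
  have [measurable]: "B' \<in> borel_measurable M" "D' \<in> borel_measurable M"
    by (rule borel_measurable_LIMSEQ_metric[OF _ lim(1)], measurable)
       (rule borel_measurable_LIMSEQ_metric[OF _ lim(2)], measurable)
  have bound': "norm (B' \<omega>) \<le> K" "norm (D' \<omega>) \<le> K" if "\<omega> \<in> space M" for \<omega>
    using LIMSEQ_le_const2[OF tendsto_norm[OF lim(1)[OF that]]] LIMSEQ_le_const2[OF tendsto_norm[OF lim(2)[OF that]]]
      bound[OF that] by auto
  show ?thesis unfolding ibp_def
  proof (intro conjI ballI)
    show "bounded_rv M B'" "bounded_rv M D'" using bound' by (auto intro: bounded_rvI[where K=K])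
    fix h k assume h: "h \<in> H" and k: "k \<in> H"
    have [measurable]: "h \<in> borel_measurable M" "k \<in> borel_measurable M" "k \<in> H"
      using h k H_measurable by auto
    let ?c = "\<Sum>a\<in>I. norm (dcoef c a)"
    let ?R = "\<lambda>B D. \<i> * of_real (cov k h) * (\<integral>\<omega>. cis (h \<omega>) * B \<omega> \<partial>M)
        + (\<integral>t. of_real (cov k (g t)) * (\<integral>\<omega>. trig I (dcoef c) (g t \<omega>) * (cis (h \<omega>) * D \<omega>) \<partial>M) \<partial>\<mu>)"
    have "(\<lambda>n. \<integral>\<omega>. of_real (k \<omega>) * (cis (h \<omega>) * B n \<omega>) \<partial>M) \<longlonglongrightarrow> (\<integral>\<omega>. of_real (k \<omega>) * (cis (h \<omega>) * B' \<omega>) \<partial>M)"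
      by (rule integral_dominated_convergence[where w="\<lambda>\<omega>. \<bar>k \<omega>\<bar> * K"])
         (use H_integrable[OF k] in \<open>auto intro!: AE_I2 tendsto_intros lim mult_left_mono bound simp: norm_mult\<close>)
    moreover have "(\<lambda>n. ?R (B n) (D n)) \<longlonglongrightarrow> ?R B' D'"
    proof (intro tendsto_add tendsto_mult tendsto_const)
      show "(\<lambda>n. \<integral>\<omega>. cis (h \<omega>) * B n \<omega> \<partial>M) \<longlonglongrightarrow> (\<integral>\<omega>. cis (h \<omega>) * B' \<omega> \<partial>M)"
        by (rule integral_dominated_convergence[where w="\<lambda>\<omega>. K"])
           (auto intro!: AE_I2 tendsto_intros lim bound simp: norm_mult)
      have Dn: "norm (trig I (dcoef c) (g t \<omega>) * (cis (h \<omega>) * D n \<omega>)) \<le> ?c * K" if "\<omega> \<in> space M" for n \<omega> t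
        unfolding norm_mult[of "trig _ _ _"] norm_mult[of "cis _"] norm_cis mult_1_left
        using that by (intro mult_mono norm_trig_le bound sum_nonneg norm_ge_zero)
      show "(\<lambda>n. \<integral>t. of_real (cov k (g t)) * (\<integral>\<omega>. trig I (dcoef c) (g t \<omega>) * (cis (h \<omega>) * D n \<omega>) \<partial>M) \<partial>\<mu>)
        \<longlonglongrightarrow> (\<integral>t. of_real (cov k (g t)) * (\<integral>\<omega>. trig I (dcoef c) (g t \<omega>) * (cis (h \<omega>) * D' \<omega>) \<partial>M) \<partial>\<mu>)"
      proof (rule integral_dominated_convergence[where w="\<lambda>t. (cov k k + 1) / 2 * (?c * K)"])
        show "AE t in \<mu>. (\<lambda>n. of_real (cov k (g t)) * (\<integral>\<omega>. trig I (dcoef c) (g t \<omega>) * (cis (h \<omega>) * D n \<omega>) \<partial>M))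
           \<longlonglongrightarrow> of_real (cov k (g t)) * (\<integral>\<omega>. trig I (dcoef c) (g t \<omega>) * (cis (h \<omega>) * D' \<omega>) \<partial>M)"
        proof (intro AE_I2 tendsto_mult tendsto_const integral_dominated_convergence[where w="\<lambda>\<omega>. ?c * K"])
          fix t n assume [measurable]: "t \<in> space \<mu>"
          show "(\<lambda>\<omega>. trig I (dcoef c) (g t \<omega>) * (cis (h \<omega>) * D' \<omega>)) \<in> borel_measurable M"
            "(\<lambda>\<omega>. trig I (dcoef c) (g t \<omega>) * (cis (h \<omega>) * D n \<omega>)) \<in> borel_measurable M" by measurable
        qed (auto intro!: lim Dn)
        show "AE t in \<mu>. norm (of_real (cov k (g t)) * (\<integral>\<omega>. trig I (dcoef c) (g t \<omega>) * (cis (h \<omega>) * D n \<omega>) \<partial>M))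
           \<le> (cov k k + 1) / 2 * (?c * K)" for n
        proof (rule AE_I2)
          fix t assume t: "t \<in> space \<mu>"
          have "norm (\<integral>\<omega>. trig I (dcoef c) (g t \<omega>) * (cis (h \<omega>) * D n \<omega>) \<partial>M) \<le> (\<integral>\<omega>. ?c * K \<partial>M)"
            by (rule norm_integral_le) (use Dn in auto)
          then show "norm (of_real (cov k (g t)) * (\<integral>\<omega>. trig I (dcoef c) (g t \<omega>) * (cis (h \<omega>) * D n \<omega>) \<partial>M))
           \<le> (cov k k + 1) / 2 * (?c * K)"
            unfolding norm_mult[of "of_real _"] using cov_g_bound[OF k t] by (intro mult_mono) (auto simp: prob_space)
        qed
      qed simp_all
    qed
    ultimately show "(\<integral>\<omega>. of_real (k \<omega>) * (cis (h \<omega>) * B' \<omega>) \<partial>M) = ?R B' D'"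
      unfolding ibpD[OF ibp h k] by (rule LIMSEQ_unique)
  qed
qed

end

subsection \<open>Characteristic functions of integrals of trigonometric polynomials\<close>

lemma norm_diff_le_vector_derivative:
  fixes f :: "real \<Rightarrow> 'a::real_normed_vector"
  assumes f: "\<And>x. x \<in> closed_segment a b \<Longrightarrow> (f has_vector_derivative f' x) (at x)"
    and B: "\<And>x. x \<in> closed_segment a b \<Longrightarrow> norm (f' x) \<le> B"
  shows "norm (f b - f a) \<le> B * \<bar>b - a\<bar>"
proof -
  have "norm (f b - f a) \<le> B * norm (b - a)"
  proof (rule differentiable_bound[OF convex_closed_segment])
    fix x assume x: "x \<in> closed_segment a b"
    show "(f has_derivative (\<lambda>h. h *\<^sub>R f' x)) (at x within closed_segment a b)"
      using f[OF x] unfolding has_vector_derivative_def by (rule has_derivative_at_withinI)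
    show "onorm (\<lambda>h. h *\<^sub>R f' x) \<le> B"
      using B[OF x] order_trans[OF norm_ge_zero B[OF x]]
      by (intro onorm_bound) (auto simp: mult.commute[of B] intro: mult_left_mono)
  qed auto
  then show ?thesis by simp
qed

text \<open>The upper bound is phrased with nonnegative integrals so that kernels of absolute
  covariances can be estimated pointwise, with no integrability to check.\<close>

lemma (in prob_space)
  fixes Z :: "'z \<Rightarrow> 'a \<Rightarrow> complex"
  assumes nu: "finite_measure \<nu>"
    and Z: "(\<lambda>(z, \<omega>). Z z \<omega>) \<in> borel_measurable (\<nu> \<Otimes>\<^sub>M M)"
    and bound: "\<And>z \<omega>. z \<in> space \<nu> \<Longrightarrow> \<omega> \<in> space M \<Longrightarrow> norm (Z z \<omega>) \<le> K"
  shows second_moment_integral_eq: "complex_of_real (\<integral>\<omega>. (norm (\<integral>z. Z z \<omega> \<partial>\<nu>))\<^sup>2 \<partial>M)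
      = (\<integral>z. (\<integral>z'. (\<integral>\<omega>. Z z \<omega> * cnj (Z z' \<omega>) \<partial>M) \<partial>\<nu>) \<partial>\<nu>)"
    and second_moment_integral_le:
      "(\<integral>\<^sup>+z. (\<integral>\<^sup>+z'. ennreal (norm (\<integral>\<omega>. Z z \<omega> * cnj (Z z' \<omega>) \<partial>M)) \<partial>\<nu>) \<partial>\<nu>) \<le> ennreal R \<Longrightarrow> 0 \<le> R \<Longrightarrow>
        (\<integral>\<omega>. (norm (\<integral>z. Z z \<omega> \<partial>\<nu>))\<^sup>2 \<partial>M) \<le> R"
proof -
  interpret nu: finite_measure \<nu> by fact
  have [measurable]: "cnj \<in> borel_measurable borel"
    by (intro borel_measurable_continuous_onI continuous_on_cnj continuous_on_id)
  have Z'[measurable (raw)]: "(\<lambda>x. Z (f x) (h x)) \<in> borel_measurable N"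
    if [measurable]: "f \<in> measurable N \<nu>" "h \<in> measurable N M" for f h and N :: "'n measure"
  proof -
    have "(\<lambda>x. (\<lambda>(z, \<omega>). Z z \<omega>) (f x, h x)) \<in> borel_measurable N"
      by (rule measurable_compose[OF _ Z]) measurable
    then show ?thesis by simp
  qed
  have Z2 [measurable]: "(\<lambda>(z, \<omega>). Z z \<omega>) \<in> borel_measurable (\<nu> \<Otimes>\<^sub>M M)" by fact
  define G where "G z z' = (\<integral>\<omega>. Z z \<omega> * cnj (Z z' \<omega>) \<partial>M)" for z z'
  have G_meas [measurable]: "(\<lambda>(z, z'). G z z') \<in> borel_measurable (\<nu> \<Otimes>\<^sub>M \<nu>)"
    unfolding G_def by measurable
  \<comment> \<open>\<open>K\<close> may be negative if \<open>space \<nu>\<close> is empty, hence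
    the absolute values.\<close>
  define L where "L = \<bar>K\<bar> * \<bar>K\<bar>"
  have ZZ: "norm (Z z \<omega> * cnj (Z z' \<omega>)) \<le> L"
    if "z \<in> space \<nu>" "z' \<in> space \<nu>" "\<omega> \<in> space M" for z z' \<omega>
    unfolding L_def norm_mult complex_mod_cnj using bound that
    by (intro mult_mono) (auto intro: order_trans[OF _ abs_ge_self])
  have G_le: "norm (G z z') \<le> L" if "z \<in> space \<nu>" "z' \<in> space \<nu>" for z z'
  proof -
    have "norm (G z z') \<le> (\<integral>\<omega>. L \<partial>M)"
      unfolding G_def by (rule norm_integral_le) (use that ZZ in auto)
    then show ?thesis by (simp add: prob_space)
  qed
  have Gint: "integrable \<nu> (\<lambda>z'. G z z')" if "z \<in> space \<nu>" for z
    using that G_le by (intro nu.integrable_const_bound[where B="L"]) auto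
  have "complex_of_real (\<integral>\<omega>. (norm (\<integral>z. Z z \<omega> \<partial>\<nu>))\<^sup>2 \<partial>M)
      = (\<integral>\<omega>. (\<integral>z. Z z \<omega> \<partial>\<nu>) * cnj (\<integral>z. Z z \<omega> \<partial>\<nu>) \<partial>M)"
    by (simp only: complex_norm_square[symmetric] integral_complex_of_real)
  also have "\<dots> = (\<integral>\<omega>. (\<integral>z. (\<integral>z'. Z z \<omega> * cnj (Z z' \<omega>) \<partial>\<nu>) \<partial>\<nu>) \<partial>M)"
    by simp
  also have "\<dots> = (\<integral>z. (\<integral>\<omega>. (\<integral>z'. Z z \<omega> * cnj (Z z' \<omega>) \<partial>\<nu>) \<partial>M) \<partial>\<nu>)"
  proof (rule Fubini_bounded_swap[OF nu finite_measure_axioms, where k="\<lambda>_. \<integral>z'. L \<partial>\<nu>"])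
    show "norm (\<integral>z'. Z z \<omega> * cnj (Z z' \<omega>) \<partial>\<nu>) \<le> (\<integral>z'. L \<partial>\<nu>)"
      if "z \<in> space \<nu>" "\<omega> \<in> space M" for z \<omega>
      using that ZZ by (intro norm_integral_le) auto
    show "(\<lambda>(z, \<omega>). \<integral>z'. Z z \<omega> * cnj (Z z' \<omega>) \<partial>\<nu>) \<in> borel_measurable (\<nu> \<Otimes>\<^sub>M M)"
      by measurable
  qed simp
  also have "\<dots> = (\<integral>z. (\<integral>z'. G z z' \<partial>\<nu>) \<partial>\<nu>)"
  proof (intro Bochner_Integration.integral_cong refl)
    fix z assume [measurable]: "z \<in> space \<nu>"
    show "(\<integral>\<omega>. (\<integral>z'. Z z \<omega> * cnj (Z z' \<omega>) \<partial>\<nu>) \<partial>M) = (\<integral>z'. G z z' \<partial>\<nu>)"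
      unfolding G_def
      by (rule Fubini_bounded_swap[OF nu finite_measure_axioms, where k="\<lambda>_. L"])
         (use \<open>z \<in> space \<nu>\<close> in \<open>auto intro!: ZZ\<close>)
  qed
  finally have eq: "complex_of_real (\<integral>\<omega>. (norm (\<integral>z. Z z \<omega> \<partial>\<nu>))\<^sup>2 \<partial>M) = (\<integral>z. (\<integral>z'. G z z' \<partial>\<nu>) \<partial>\<nu>)" .
  then show "complex_of_real (\<integral>\<omega>. (norm (\<integral>z. Z z \<omega> \<partial>\<nu>))\<^sup>2 \<partial>M)
      = (\<integral>z. (\<integral>z'. (\<integral>\<omega>. Z z \<omega> * cnj (Z z' \<omega>) \<partial>M) \<partial>\<nu>) \<partial>\<nu>)"
    unfolding G_def .
  assume R: "(\<integral>\<^sup>+z. (\<integral>\<^sup>+z'. ennreal (norm (\<integral>\<omega>. Z z \<omega> * cnj (Z z' \<omega>) \<partial>M)) \<partial>\<nu>) \<partial>\<nu>) \<le> ennreal R" "0 \<le> R"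
  have "ennreal (norm (\<integral>z. (\<integral>z'. G z z' \<partial>\<nu>) \<partial>\<nu>)) \<le> (\<integral>\<^sup>+z. ennreal (norm (\<integral>z'. G z z' \<partial>\<nu>)) \<partial>\<nu>)"
  proof (rule integral_norm_bound_ennreal, rule nu.integrable_const_bound, rule AE_I2)
    show "norm (\<integral>z'. G z z' \<partial>\<nu>) \<le> (\<integral>z'. L \<partial>\<nu>)" if "z \<in> space \<nu>" for z
      using that G_le by (intro norm_integral_le) auto
  qed measurable
  also have "\<dots> \<le> (\<integral>\<^sup>+z. (\<integral>\<^sup>+z'. ennreal (norm (G z z')) \<partial>\<nu>) \<partial>\<nu>)"
    using Gint by (intro nn_integral_mono integral_norm_bound_ennreal)
  also have "\<dots> \<le> ennreal R" using R(1) by (simp add: G_def)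
  finally have "norm (complex_of_real (\<integral>\<omega>. (norm (\<integral>z. Z z \<omega> \<partial>\<nu>))\<^sup>2 \<partial>M)) \<le> R"
    unfolding eq using R(2) by simp
  then show "(\<integral>\<omega>. (norm (\<integral>z. Z z \<omega> \<partial>\<nu>))\<^sup>2 \<partial>M) \<le> R" by simp
qed

section \<open>Integration by parts for exponentials of the functional\<close>

context gaussian_integral begin

text \<open>At \<open>n = 0\<close> the exponent \<open>n - 1\<close> truncates to 0 and the factor
  \<open>of_nat n\<close> removes the term.\<close>

lemma ibp_power: "ibp (\<lambda>\<omega>. F \<omega> ^ n) (\<lambda>\<omega>. of_nat n * F \<omega> ^ (n - 1))"
proof (induction n)
  case 0
  then show ?case using ibp_one by simp
next
  case (Suc n)
  have "F \<omega> ^ n + F \<omega> * (of_nat n * F \<omega> ^ (n - 1)) = of_nat (Suc n) * F \<omega> ^ (Suc n - 1)" for \<omega>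
    by (cases n) (simp_all add: algebra_simps)
  then show ?case using ibp_mult[OF Suc.IH] by simp
qed

text \<open>The chain rule is obtained from the power series: partial sums satisfy the rule by
  linearity, and boundedness of \<open>F\<close> dominates them by
  \<open>exp (norm z * K)\<close>.\<close>

lemma ibp_exp: "ibp (\<lambda>\<omega>. exp (z * F \<omega>)) (\<lambda>\<omega>. z * exp (z * F \<omega>))"
proof -
  define B where "B m \<omega> = (\<Sum>n<m. z ^ n / fact n * F \<omega> ^ n)" for m \<omega>
  define D where "D m \<omega> = (\<Sum>n<m. z ^ n / fact n * (of_nat n * F \<omega> ^ (n - 1)))" for m \<omega>
  have zero: "ibp (\<lambda>_. 0) (\<lambda>_. 0)" using ibp_lincomb[OF ibp_one ibp_one, of "-1"] by simp
  have BD: "ibp (B m) (D m)" for m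
  proof (induction m)
    case 0
    then show ?case using zero by (simp add: B_def[abs_def] D_def[abs_def])
  next
    case (Suc m)
    show ?case using ibp_lincomb[OF Suc.IH ibp_power[of m], of "z ^ m / fact m"]
      by (simp add: B_def[abs_def] D_def[abs_def])
  qed
  have D: "D (Suc m) \<omega> = z * B m \<omega>" for m \<omega>
  proof -
    have "D (Suc m) \<omega> = (\<Sum>n<m. z ^ Suc n / fact (Suc n) * (of_nat (Suc n) * F \<omega> ^ n))"
      unfolding D_def by (subst sum.lessThan_Suc_shift) simp
    also have "\<dots> = (\<Sum>n<m. z * (z ^ n / fact n * F \<omega> ^ n))"
    proof (rule sum.cong[OF refl])
      fix n
      show "z ^ Suc n / fact (Suc n) * (of_nat (Suc n) * F \<omega> ^ n) = z * (z ^ n / fact n * F \<omega> ^ n)"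
        unfolding fact_Suc power_Suc by (simp add: field_simps del: of_nat_Suc)
    qed
    finally show ?thesis by (simp add: B_def sum_distrib_left)
  qed
  have B: "(\<lambda>m. B m \<omega>) \<longlonglongrightarrow> exp (z * F \<omega>)" for \<omega>
    using exp_converges[of "z * F \<omega>"]
    by (simp add: sums_def B_def scaleR_conv_of_real power_mult_distrib divide_inverse mult_ac)
  obtain K where K: "0 \<le> K" "\<And>x. x \<in> space M \<Longrightarrow> norm (F x) \<le> K" using bounded_rvE[OF bounded_rv_F] by metis
  have B_le: "norm (B m \<omega>) \<le> exp (norm z * K)" if "\<omega> \<in> space M" for m \<omega>
  proof -
    have "norm (B m \<omega>) \<le> (\<Sum>n<m. (norm z * K) ^ n / fact n)"
      unfolding B_def
    proof (rule sum_norm_le)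
      fix n
      show "norm (z ^ n / fact n * F \<omega> ^ n) \<le> (norm z * K) ^ n / fact n"
        using power_mono[OF K(2)[OF that] norm_ge_zero, of n]
        by (simp add: norm_mult norm_divide norm_power power_mult_distrib divide_right_mono mult_left_mono)
    qed
    also have "\<dots> \<le> (\<Sum>n. (norm z * K) ^ n / fact n)"
      using summable_exp[of "norm z * K"] K by (intro sum_le_suminf) (auto simp: divide_inverse mult_ac)
    also have "\<dots> = exp (norm z * K)" by (simp add: exp_def scaleR_conv_of_real divide_inverse mult_ac)
    finally show ?thesis .
  qed
  show ?thesis
  proof (rule ibp_limit)
    \<comment> \<open>The index is shifted because \<open>D (Suc m) = z * B m\<close>: the
      derivative then inherits both the limit and the bound of \<open>B\<close>.\<close>
    show "ibp (B (Suc m)) (D (Suc m))" for m by (rule BD)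
    show "(\<lambda>m. B (Suc m) \<omega>) \<longlonglongrightarrow> exp (z * F \<omega>)" for \<omega> using B by (rule LIMSEQ_Suc)
    show "(\<lambda>m. D (Suc m) \<omega>) \<longlonglongrightarrow> z * exp (z * F \<omega>)" for \<omega>
      unfolding D by (intro tendsto_intros B)
    show "norm (B (Suc m) \<omega>) \<le> (1 + norm z) * exp (norm z * K)" if "\<omega> \<in> space M" for m \<omega>
      using B_le[OF that, of "Suc m"] by (rule order_trans) (simp add: algebra_simps)
    show "norm (D (Suc m) \<omega>) \<le> (1 + norm z) * exp (norm z * K)" if "\<omega> \<in> space M" for m \<omega>
      unfolding D norm_mult using B_le[OF that, of "m"] by (intro mult_mono) auto
  qed
qed

end

text \<open>Each of the four products is a path of three edges through the four integration points.
  Integrating leaf by leaf gives one factor \<open>R\<close> per edge, and the last point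
  contributes the total mass.\<close>

lemma (in finite_measure) nn_integral_kernel_product_le:
  fixes r :: "'a \<Rightarrow> 'a \<Rightarrow> ennreal"
  assumes r: "(\<lambda>(t, s). r t s) \<in> borel_measurable (M \<Otimes>\<^sub>M M)"
    and sym: "\<And>t s. r t s = r s t"
    and R: "\<And>t. t \<in> space M \<Longrightarrow> (\<integral>\<^sup>+s. r t s \<partial>M) \<le> R"
  shows "(\<integral>\<^sup>+z. (\<integral>\<^sup>+z'. r (fst z) (snd z) * (r (fst z') (snd z') *
            (r (fst z) (fst z') + r (fst z) (snd z') + r (snd z) (fst z') + r (snd z) (snd z')))
          \<partial>(M \<Otimes>\<^sub>M M)) \<partial>(M \<Otimes>\<^sub>M M)) \<le> 4 * R ^ 3 * emeasure M (space M)"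
proof -
  note pair_fst = nn_integral_fst
  interpret pair_sigma_finite M M ..
  have r' [measurable (raw)]: "(\<lambda>x. r (f x) (h x)) \<in> borel_measurable N"
    if [measurable]: "f \<in> measurable N M" "h \<in> measurable N M" for f h and N :: "'n measure"
  proof -
    have "(\<lambda>x. (\<lambda>(t, s). r t s) (f x, h x)) \<in> borel_measurable N"
      by (rule measurable_compose[OF _ r]) measurable
    then show ?thesis by simp
  qed
  have fst_le: "(\<integral>\<^sup>+z. r (fst z) (snd z) * r t (fst z) \<partial>(M \<Otimes>\<^sub>M M)) \<le> R * R" if [measurable]: "t \<in> space M" for t
  proof -
    have "(\<integral>\<^sup>+z. r (fst z) (snd z) * r t (fst z) \<partial>(M \<Otimes>\<^sub>M M)) = (\<integral>\<^sup>+x. (\<integral>\<^sup>+y. r x y * r t x \<partial>M) \<partial>M)"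
      by (rule trans[OF pair_fst[symmetric]]) simp_all
    also have "\<dots> = (\<integral>\<^sup>+x. (\<integral>\<^sup>+y. r x y \<partial>M) * r t x \<partial>M)"
      by (intro nn_integral_cong nn_integral_multc) simp
    also have "\<dots> \<le> (\<integral>\<^sup>+x. R * r t x \<partial>M)"
      by (intro nn_integral_mono mult_right_mono R) auto
    also have "\<dots> = R * (\<integral>\<^sup>+x. r t x \<partial>M)" by (intro nn_integral_cmult) simp
    also have "\<dots> \<le> R * R" using that by (intro mult_left_mono R) auto
    finally show ?thesis .
  qed
  have snd_le: "(\<integral>\<^sup>+z. r (fst z) (snd z) * r t (snd z) \<partial>(M \<Otimes>\<^sub>M M)) \<le> R * R" if [measurable]: "t \<in> space M" for t
  proof -
    have "(\<integral>\<^sup>+z. r (fst z) (snd z) * r t (snd z) \<partial>(M \<Otimes>\<^sub>M M)) = (\<integral>\<^sup>+y. (\<integral>\<^sup>+x. r x y * r t y \<partial>M) \<partial>M)"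
      by (rule trans[OF nn_integral_snd[symmetric]]) simp_all
    also have "\<dots> = (\<integral>\<^sup>+y. (\<integral>\<^sup>+x. r y x * r t y \<partial>M) \<partial>M)" by (simp only: sym)
    also have "\<dots> = (\<integral>\<^sup>+x. (\<integral>\<^sup>+y. r x y \<partial>M) * r t x \<partial>M)"
      by (intro nn_integral_cong nn_integral_multc) simp
    also have "\<dots> \<le> (\<integral>\<^sup>+x. R * r t x \<partial>M)"
      by (intro nn_integral_mono mult_right_mono R) auto
    also have "\<dots> = R * (\<integral>\<^sup>+x. r t x \<partial>M)" by (intro nn_integral_cmult) simp
    also have "\<dots> \<le> R * R" using that by (intro mult_left_mono R) auto
    finally show ?thesis .
  qed
  have "(\<integral>\<^sup>+z. (\<integral>\<^sup>+z'. r (fst z) (snd z) * (r (fst z') (snd z') *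
            (r (fst z) (fst z') + r (fst z) (snd z') + r (snd z) (fst z') + r (snd z) (snd z')))
          \<partial>(M \<Otimes>\<^sub>M M)) \<partial>(M \<Otimes>\<^sub>M M)) \<le> (\<integral>\<^sup>+z. r (fst z) (snd z) * (4 * (R * R)) \<partial>(M \<Otimes>\<^sub>M M))"
  proof (rule nn_integral_mono)
    fix z assume "z \<in> space (M \<Otimes>\<^sub>M M)"
    then have z: "fst z \<in> space M" "snd z \<in> space M" by (auto simp: space_pair_measure)
    note [measurable] = z
    have "(\<integral>\<^sup>+z'. r (fst z) (snd z) * (r (fst z') (snd z') *
            (r (fst z) (fst z') + r (fst z) (snd z') + r (snd z) (fst z') + r (snd z) (snd z'))) \<partial>(M \<Otimes>\<^sub>M M))
      = r (fst z) (snd z) * ((\<integral>\<^sup>+z'. r (fst z') (snd z') * r (fst z) (fst z') \<partial>(M \<Otimes>\<^sub>M M))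
        + (\<integral>\<^sup>+z'. r (fst z') (snd z') * r (fst z) (snd z') \<partial>(M \<Otimes>\<^sub>M M))
        + (\<integral>\<^sup>+z'. r (fst z') (snd z') * r (snd z) (fst z') \<partial>(M \<Otimes>\<^sub>M M))
        + (\<integral>\<^sup>+z'. r (fst z') (snd z') * r (snd z) (snd z') \<partial>(M \<Otimes>\<^sub>M M)))"
      by (simp add: nn_integral_cmult nn_integral_add distrib_left)
    also have "\<dots> \<le> r (fst z) (snd z) * (R * R + R * R + R * R + R * R)"
      by (intro mult_left_mono add_mono fst_le snd_le z) auto
    also have "R * R + R * R + R * R + R * R = 4 * (R * R)"
    proof -
      have "(4 :: ennreal) = 1 + 1 + 1 + 1" by simp
      then show ?thesis by (simp only: distrib_right mult_1_left)
    qed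
    finally show "(\<integral>\<^sup>+z'. r (fst z) (snd z) * (r (fst z') (snd z') *
            (r (fst z) (fst z') + r (fst z) (snd z') + r (snd z) (fst z') + r (snd z) (snd z'))) \<partial>(M \<Otimes>\<^sub>M M))
        \<le> r (fst z) (snd z) * (4 * (R * R))" .
  qed
  also have "\<dots> = (\<integral>\<^sup>+x. (\<integral>\<^sup>+y. r x y * (4 * (R * R)) \<partial>M) \<partial>M)"
    by (rule trans[OF pair_fst[symmetric]]) simp_all
  also have "\<dots> = (\<integral>\<^sup>+x. (\<integral>\<^sup>+y. r x y \<partial>M) * (4 * (R * R)) \<partial>M)"
    by (intro nn_integral_cong nn_integral_multc) simp
  also have "\<dots> \<le> (\<integral>\<^sup>+x. R * (4 * (R * R)) \<partial>M)"
    by (intro nn_integral_mono mult_right_mono R) auto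
  also have "\<dots> = 4 * R ^ 3 * emeasure M (space M)"
    by (simp add: power3_eq_cube mult_ac)
  finally show ?thesis .
qed

lemma (in prob_space) expectation_norm_le_sqrt:
  fixes U :: "'a \<Rightarrow> complex"
  assumes U: "bounded_rv M U"
  shows "(\<integral>\<omega>. norm (U \<omega>) \<partial>M) \<le> sqrt (\<integral>\<omega>. (norm (U \<omega>))\<^sup>2 \<partial>M)"
proof -
  obtain K where K: "0 \<le> K" "\<And>x. x \<in> space M \<Longrightarrow> norm (U x) \<le> K" using bounded_rvE[OF U] by metis
  have [measurable]: "U \<in> borel_measurable M" using bounded_rv_measurable[OF U] .
  have "integrable M (\<lambda>\<omega>. norm (U \<omega>))" using integrable_bounded_rv[OF U] by simp
  moreover have "integrable M (\<lambda>\<omega>. (norm (U \<omega>))\<^sup>2)"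
    by (rule integrable_const_bound[where B="K\<^sup>2"]) (auto intro!: AE_I2 power_mono K)
  ultimately have "(\<integral>\<omega>. norm (U \<omega>) \<partial>M)\<^sup>2 \<le> (\<integral>\<omega>. (norm (U \<omega>))\<^sup>2 \<partial>M)"
    using variance_eq[of "\<lambda>\<omega>. norm (U \<omega>)"] variance_positive[of "\<lambda>\<omega>. norm (U \<omega>)"] by simp
  then show ?thesis by (rule real_le_rsqrt)
qed

context gaussian_space begin

text \<open>The conjugate of \<open>cis (k j)\<close> is \<open>cis (- k j)\<close>, so every term
  of the expanded product is a difference of Gaussian characteristic functions as in
  \<open>norm_char_diff_le\<close>.\<close>

lemma norm_cov_cis_le:
  assumes J: "finite J" "finite J'" and h: "\<And>i. i \<in> J \<Longrightarrow> h i \<in> H" and k: "\<And>j. j \<in> J' \<Longrightarrow> k j \<in> H"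
  shows "norm (\<integral>\<omega>. (\<Sum>i\<in>J. u i * (cis (h i \<omega>) - (\<integral>\<omega>. cis (h i \<omega>) \<partial>M))) *
            cnj (\<Sum>j\<in>J'. v j * (cis (k j \<omega>) - (\<integral>\<omega>. cis (k j \<omega>) \<partial>M))) \<partial>M)
        \<le> (\<Sum>i\<in>J. \<Sum>j\<in>J'. norm (u i) * norm (v j) * \<bar>cov (h i) (k j)\<bar>)"
proof -
  define m where "m h = (\<integral>\<omega>. cis (h \<omega>) \<partial>M)" for h :: "'w \<Rightarrow> real"
  have cisint: "integrable M (\<lambda>\<omega>. cis (h \<omega>))" if "h \<in> H" for h
    using H_measurable[OF that] by (intro integrable_const_bound[where B=1]) auto
  have prod: "integrable M (\<lambda>\<omega>. (cis (h i \<omega>) - m (h i)) * cnj (cis (k j \<omega>) - m (k j)))"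
    and prod_le: "norm (\<integral>\<omega>. (cis (h i \<omega>) - m (h i)) * cnj (cis (k j \<omega>) - m (k j)) \<partial>M) \<le> \<bar>cov (h i) (k j)\<bar>"
    if "i \<in> J" "j \<in> J'" for i j
  proof -
    have kj: "(\<lambda>\<omega>. - k j \<omega>) \<in> H" using H_scale[OF k[OF that(2)], of "-1"] by simp
    have hk: "(\<lambda>\<omega>. h i \<omega> + - k j \<omega>) \<in> H" using H_add[OF h[OF that(1)] kj] .
    have mk: "m (\<lambda>\<omega>. - k j \<omega>) = cnj (m (k j))"
      unfolding m_def cis_cnj[symmetric] by simp
    have eq: "(\<lambda>\<omega>. (cis (h i \<omega>) - m (h i)) * cnj (cis (k j \<omega>) - m (k j))) =
      (\<lambda>\<omega>. cis (h i \<omega> + - k j \<omega>) - m (h i) * cis (- k j \<omega>) - (cnj (m (k j)) * cis (h i \<omega>) - m (h i) * cnj (m (k j))))"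
      by (simp only: fun_eq_iff complex_cnj_diff cis_cnj cis_mult[symmetric]) (simp add: algebra_simps)
    note ints = cisint[OF hk] cisint[OF kj] cisint[OF h[OF that(1)]]
    show "integrable M (\<lambda>\<omega>. (cis (h i \<omega>) - m (h i)) * cnj (cis (k j \<omega>) - m (k j)))"
      unfolding eq using ints by simp
    have "(\<integral>\<omega>. (cis (h i \<omega>) - m (h i)) * cnj (cis (k j \<omega>) - m (k j)) \<partial>M)
       = m (\<lambda>\<omega>. h i \<omega> + - k j \<omega>) - m (h i) * m (\<lambda>\<omega>. - k j \<omega>)"
      unfolding eq using ints by (simp add: m_def[symmetric] prob_space mk)
    then show "norm (\<integral>\<omega>. (cis (h i \<omega>) - m (h i)) * cnj (cis (k j \<omega>) - m (k j)) \<partial>M) \<le> \<bar>cov (h i) (k j)\<bar>"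
      using norm_char_diff_le[OF h[OF that(1)] kj] cov_scale_right[of "h i" "-1" "k j"]
      by (simp add: m_def)
  qed
  have "(\<integral>\<omega>. (\<Sum>i\<in>J. u i * (cis (h i \<omega>) - m (h i))) * cnj (\<Sum>j\<in>J'. v j * (cis (k j \<omega>) - m (k j))) \<partial>M)
     = (\<integral>\<omega>. (\<Sum>i\<in>J. \<Sum>j\<in>J'. (u i * cnj (v j)) * ((cis (h i \<omega>) - m (h i)) * cnj (cis (k j \<omega>) - m (k j)))) \<partial>M)"
    unfolding cnj_sum sum_product complex_cnj_mult
    by (intro Bochner_Integration.integral_cong refl sum.cong) (simp only: mult_ac)
  also have "\<dots> = (\<Sum>i\<in>J. \<Sum>j\<in>J'. (u i * cnj (v j)) * (\<integral>\<omega>. (cis (h i \<omega>) - m (h i)) * cnj (cis (k j \<omega>) - m (k j)) \<partial>M))"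
    using prod
    by (subst Bochner_Integration.integral_sum; (intro sum.cong refl)?)
       (auto intro!: Bochner_Integration.integrable_sum Bochner_Integration.integrable_mult_right)
  finally have eq: "(\<integral>\<omega>. (\<Sum>i\<in>J. u i * (cis (h i \<omega>) - m (h i))) * cnj (\<Sum>j\<in>J'. v j * (cis (k j \<omega>) - m (k j))) \<partial>M) = \<dots>" .
  show ?thesis
    unfolding m_def[symmetric] eq
  proof (intro sum_norm_le)
    fix i j assume ij: "i \<in> J" "j \<in> J'"
    show "norm (u i * cnj (v j) * (\<integral>\<omega>. (cis (h i \<omega>) - m (h i)) * cnj (cis (k j \<omega>) - m (k j)) \<partial>M))
       \<le> norm (u i) * norm (v j) * \<bar>cov (h i) (k j)\<bar>"
      unfolding norm_mult complex_mod_cnj using prod_le[OF ij, unfolded norm_mult] by (intro mult_left_mono) auto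
  qed
qed

end

section \<open>Stein's method for the integrated polynomial\<close>

context gaussian_integral begin

lemma rho_measurable [measurable]: "(\<lambda>(t, s). cov (g t) (g s)) \<in> borel_measurable (\<mu> \<Otimes>\<^sub>M \<mu>)"
  unfolding cov_def by measurable

lemma rho_measurable' [measurable (raw)]:
  assumes [measurable]: "f \<in> measurable N \<mu>" "h \<in> measurable N \<mu>"
  shows "(\<lambda>x. cov (g (f x)) (g (h x))) \<in> borel_measurable N"
proof -
  have "(\<lambda>x. (\<lambda>(t, s). cov (g t) (g s)) (f x, h x)) \<in> borel_measurable N"
    by (rule measurable_compose[OF _ rho_measurable]) measurable
  then show ?thesis by simp
qed

lemma abs_rho_le: "t \<in> space \<mu> \<Longrightarrow> s \<in> space \<mu> \<Longrightarrow> \<bar>cov (g t) (g s)\<bar> \<le> 1"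
  using abs_cov_le[of "g t" "g s"] g_H g_unit by simp

lemma abs_cov_lincomb_le:
  assumes sp: "t \<in> space \<mu>" "s \<in> space \<mu>" "t' \<in> space \<mu>" "s' \<in> space \<mu>"
    and A: "\<bar>x\<bar> \<le> A" "\<bar>y\<bar> \<le> A" "\<bar>x'\<bar> \<le> A" "\<bar>y'\<bar> \<le> A"
  shows "\<bar>cov (\<lambda>\<omega>. x * g s \<omega> + y * g t \<omega>) (\<lambda>\<omega>. x' * g s' \<omega> + y' * g t' \<omega>)\<bar>
    \<le> A\<^sup>2 * (\<bar>cov (g t) (g t')\<bar> + \<bar>cov (g t) (g s')\<bar> + \<bar>cov (g s) (g t')\<bar> + \<bar>cov (g s) (g s')\<bar>)"
proof -
  have *: "\<bar>p * (q * r)\<bar> \<le> A\<^sup>2 * \<bar>r\<bar>" if "\<bar>p\<bar> \<le> A" "\<bar>q\<bar> \<le> A" for p q r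
    unfolding power2_eq_square abs_mult mult.assoc[symmetric]
    using that by (intro mult_right_mono mult_mono) auto
  have "cov (\<lambda>\<omega>. x * g s \<omega> + y * g t \<omega>) (\<lambda>\<omega>. x' * g s' \<omega> + y' * g t' \<omega>)
    = x * (x' * cov (g s) (g s')) + x * (y' * cov (g s) (g t')) + (y * (x' * cov (g t) (g s')) + y * (y' * cov (g t) (g t')))"
    using sp by (simp add: cov_add_left cov_add_right H_add H_scale g_H cov_scale_left cov_scale_right distrib_left)
  also have "\<bar>\<dots>\<bar> \<le> \<bar>x * (x' * cov (g s) (g s'))\<bar> + \<bar>x * (y' * cov (g s) (g t'))\<bar> + (\<bar>y * (x' * cov (g t) (g s'))\<bar> + \<bar>y * (y' * cov (g t) (g t'))\<bar>)"
    by linarith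
  also have "\<dots> \<le> A\<^sup>2 * \<bar>cov (g s) (g s')\<bar> + A\<^sup>2 * \<bar>cov (g s) (g t')\<bar> + (A\<^sup>2 * \<bar>cov (g t) (g s')\<bar> + A\<^sup>2 * \<bar>cov (g t) (g t')\<bar>)"
    using A by (intro add_mono *)
  finally show ?thesis by (simp add: distrib_left)
qed

text \<open>As \<open>D\<close> has mean zero, it tests only the fluctuation \<open>U\<close> of the
  quadratic functional, and the result is at most \<open>L\<close> times the root of the second
  moment of \<open>U\<close>. In the constant, the fourth power comes from four trigonometric sums,
  \<open>A\<^sup>2\<close> from the two frequencies in each covariance, and 4, the mass and
  \<open>R ^ 3\<close> from \<open>nn_integral_kernel_product_le\<close>. The coefficients
  \<open>d\<close> are those of \<open>e\<close> damped by a weight of the interpolation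
  path.\<close>

lemma theta_bound:
  assumes R: "\<And>t. t \<in> space \<mu> \<Longrightarrow> (\<integral>\<^sup>+s. ennreal \<bar>cov (g t) (g s)\<bar> \<partial>\<mu>) \<le> ennreal R" "0 \<le> R"
    and A: "\<And>a. a \<in> I \<Longrightarrow> \<bar>a\<bar> \<le> A" "0 \<le> A"
    and d: "\<And>a. a \<in> I \<Longrightarrow> norm (d a) \<le> norm (e a)"
    and \<tau>: "\<bar>\<tau>\<bar> \<le> 1"
    and D: "bounded_rv M D" "\<And>\<omega>. \<omega> \<in> space M \<Longrightarrow> norm (D \<omega>) \<le> L" "0 \<le> L" "(\<integral>\<omega>. D \<omega> \<partial>M) = 0"
  shows "norm (\<integral>t. (\<integral>s. of_real (cov (g t) (g s)) *
             (\<integral>\<omega>. trig I e (g s \<omega>) * (trig I d (\<tau> * g t \<omega>) * D \<omega>) \<partial>M) \<partial>\<mu>) \<partial>\<mu>)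
         \<le> L * sqrt (4 * (\<Sum>a\<in>I. norm (e a)) ^ 4 * A\<^sup>2 * measure \<mu> (space \<mu>) * R ^ 3)"
proof -
  define E where "E = (\<Sum>a\<in>I. norm (e a))"
  have E: "0 \<le> E" "\<And>x. norm (trig I e x) \<le> E" "\<And>x. norm (trig I d x) \<le> E"
    using norm_trig_le[of I e] order_trans[OF norm_trig_le[of I d] sum_mono[OF d]] by (auto simp: E_def sum_nonneg)
  have [measurable]: "D \<in> borel_measurable M" using D bounded_rv_measurable by auto
  define Y where "Y t s \<omega> = trig I e (g s \<omega>) * trig I d (\<tau> * g t \<omega>)" for t s \<omega>
  define m where "m t s = (\<integral>\<omega>. Y t s \<omega> \<partial>M)" for t s
  \<comment> \<open>Subtracting the mean \<open>m\<close> is what later replaces absolute moments by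
    covariances.\<close>
  define Z where "Z z \<omega> = of_real (cov (g (fst z)) (g (snd z))) * (Y (fst z) (snd z) \<omega> - m (fst z) (snd z))" for z \<omega>
  have Y_le: "norm (Y t s \<omega>) \<le> E * E" for t s \<omega>
    unfolding Y_def norm_mult by (intro mult_mono E) auto
  have Y_meas [measurable (raw)]: "(\<lambda>x. Y (f x) (h x) (k x)) \<in> borel_measurable N"
    if [measurable]: "f \<in> measurable N \<mu>" "h \<in> measurable N \<mu>" "k \<in> measurable N M" for f h k and N :: "'n measure"
    unfolding Y_def by measurable
  have m_meas [measurable (raw)]: "(\<lambda>x. m (f x) (h x)) \<in> borel_measurable N"
    if [measurable]: "f \<in> measurable N \<mu>" "h \<in> measurable N \<mu>" for f h and N :: "'n measure"
    unfolding m_def by measurable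
  have m_le: "norm (m t s) \<le> E * E" for t s
  proof -
    have "norm (m t s) \<le> (\<integral>\<omega>. E * E \<partial>M)" unfolding m_def by (rule norm_integral_le) (auto simp: Y_le)
    then show ?thesis by (simp add: prob_space)
  qed
  have Y_int: "integrable M (Y t s)" if [measurable]: "t \<in> space \<mu>" "s \<in> space \<mu>" for t s
    by (rule integrable_const_bound[where B="E * E"]) (auto simp: Y_le)
  have Z_meas [measurable]: "(\<lambda>(z, \<omega>). Z z \<omega>) \<in> borel_measurable ((\<mu> \<Otimes>\<^sub>M \<mu>) \<Otimes>\<^sub>M M)"
    unfolding Z_def by measurable
  have Z_le: "norm (Z z \<omega>) \<le> 2 * (E * E)" if "z \<in> space (\<mu> \<Otimes>\<^sub>M \<mu>)" for z \<omega>
  proof -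
    have "norm (Z z \<omega>) \<le> 1 * (E * E + E * E)"
      unfolding Z_def norm_mult using that abs_rho_le[of "fst z" "snd z"]
      by (intro mult_mono order_trans[OF norm_triangle_ineq4] add_mono Y_le m_le) (auto simp: space_pair_measure)
    then show ?thesis by simp
  qed
  have nu: "finite_measure (\<mu> \<Otimes>\<^sub>M \<mu>)"
    by (rule finite_measure_pair_measure[OF mu.finite_measure_axioms mu.finite_measure_axioms])
  then interpret nu: finite_measure "\<mu> \<Otimes>\<^sub>M \<mu>" .
  define U where "U \<omega> = (\<integral>z. Z z \<omega> \<partial>(\<mu> \<Otimes>\<^sub>M \<mu>))" for \<omega>
  have U_bdd: "bounded_rv M U"
  proof (rule bounded_rvI)
    show "U \<in> borel_measurable M" unfolding U_def by measurable
    show "norm (U \<omega>) \<le> (\<integral>z. 2 * (E * E) \<partial>(\<mu> \<Otimes>\<^sub>M \<mu>))" for \<omega>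
      unfolding U_def by (rule norm_integral_le) (use Z_le in auto)
  qed
  \<comment> \<open>The subtracted mean contributes a multiple of the expectation of
    \<open>D\<close>, which is 0.\<close>
  have ZD: "of_real (cov (g t) (g s)) * (\<integral>\<omega>. trig I e (g s \<omega>) * (trig I d (\<tau> * g t \<omega>) * D \<omega>) \<partial>M)
      = (\<integral>\<omega>. Z (t, s) \<omega> * D \<omega> \<partial>M)" if ts: "t \<in> space \<mu>" "s \<in> space \<mu>" for t s
  proof -
    have YD: "integrable M (\<lambda>\<omega>. Y t s \<omega> * D \<omega>)"
      by (rule integrable_mult_bounded[OF Y_int[OF ts] _ D(2)]) auto
    have "(\<integral>\<omega>. Z (t, s) \<omega> * D \<omega> \<partial>M)
       = (\<integral>\<omega>. of_real (cov (g t) (g s)) * (Y t s \<omega> * D \<omega> - m t s * D \<omega>) \<partial>M)"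
      by (simp add: Z_def algebra_simps)
    also have "\<dots> = of_real (cov (g t) (g s)) * ((\<integral>\<omega>. Y t s \<omega> * D \<omega> \<partial>M) - m t s * (\<integral>\<omega>. D \<omega> \<partial>M))"
      using YD integrable_bounded_rv[OF D(1)] by simp
    finally show ?thesis by (simp add: D(4) Y_def mult.assoc)
  qed
  have "(\<integral>t. (\<integral>s. of_real (cov (g t) (g s)) *
             (\<integral>\<omega>. trig I e (g s \<omega>) * (trig I d (\<tau> * g t \<omega>) * D \<omega>) \<partial>M) \<partial>\<mu>) \<partial>\<mu>)
     = (\<integral>t. (\<integral>s. (\<integral>\<omega>. Z (t, s) \<omega> * D \<omega> \<partial>M) \<partial>\<mu>) \<partial>\<mu>)"
    by (intro Bochner_Integration.integral_cong refl ZD)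
  also have "\<dots> = (\<integral>z. (\<integral>\<omega>. Z (fst z, snd z) \<omega> * D \<omega> \<partial>M) \<partial>(\<mu> \<Otimes>\<^sub>M \<mu>))"
  proof (rule Fubini_bounded_pair[OF mu.finite_measure_axioms mu.finite_measure_axioms, symmetric,
        where k="\<lambda>_. 2 * (E * E) * L"])
    show "(\<lambda>(t, s). \<integral>\<omega>. Z (t, s) \<omega> * D \<omega> \<partial>M) \<in> borel_measurable (\<mu> \<Otimes>\<^sub>M \<mu>)"
      unfolding Z_def by measurable
    fix t s assume ts: "t \<in> space \<mu>" "s \<in> space \<mu>"
    have "norm (\<integral>\<omega>. Z (t, s) \<omega> * D \<omega> \<partial>M) \<le> (\<integral>\<omega>. 2 * (E * E) * L \<partial>M)"
    proof (rule norm_integral_le)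
      fix \<omega> assume "\<omega> \<in> space M"
      then show "norm (Z (t, s) \<omega> * D \<omega>) \<le> 2 * (E * E) * L"
        unfolding norm_mult using ts E(1)
        by (intro mult_mono Z_le D) (auto simp: space_pair_measure)
    qed simp
    then show "norm (\<integral>\<omega>. Z (t, s) \<omega> * D \<omega> \<partial>M) \<le> 2 * (E * E) * L" by (simp add: prob_space)
  qed simp
  also have "\<dots> = (\<integral>\<omega>. (\<integral>z. Z z \<omega> * D \<omega> \<partial>(\<mu> \<Otimes>\<^sub>M \<mu>)) \<partial>M)"
    unfolding prod.collapse
  proof (rule Fubini_bounded_swap[OF nu finite_measure_axioms, symmetric, where k="\<lambda>_. 2 * (E * E) * L"])
    show "norm (Z z \<omega> * D \<omega>) \<le> 2 * (E * E) * L" if "z \<in> space (\<mu> \<Otimes>\<^sub>M \<mu>)" "\<omega> \<in> space M" for z \<omega>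
      unfolding norm_mult using that E(1) by (intro mult_mono Z_le D) auto
  qed simp_all
  also have "\<dots> = (\<integral>\<omega>. U \<omega> * D \<omega> \<partial>M)" by (simp add: U_def)
  finally have eq: "(\<integral>t. (\<integral>s. of_real (cov (g t) (g s)) *
             (\<integral>\<omega>. trig I e (g s \<omega>) * (trig I d (\<tau> * g t \<omega>) * D \<omega>) \<partial>M) \<partial>\<mu>) \<partial>\<mu>) = (\<integral>\<omega>. U \<omega> * D \<omega> \<partial>M)" .
  have "norm (\<integral>\<omega>. U \<omega> * D \<omega> \<partial>M) \<le> (\<integral>\<omega>. L * norm (U \<omega>) \<partial>M)"
  proof (rule norm_integral_le)
    show "integrable M (\<lambda>\<omega>. L * norm (U \<omega>))" using integrable_bounded_rv[OF U_bdd] by simp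
    show "norm (U \<omega> * D \<omega>) \<le> L * norm (U \<omega>)" if "\<omega> \<in> space M" for \<omega>
      using mult_left_mono[OF D(2)[OF that] norm_ge_zero[of "U \<omega>"]] by (simp add: norm_mult mult.commute)
  qed
  also have "\<dots> = L * (\<integral>\<omega>. norm (U \<omega>) \<partial>M)" by simp
  also have "\<dots> \<le> L * sqrt (4 * E ^ 4 * A\<^sup>2 * measure \<mu> (space \<mu>) * R ^ 3)"
  proof (intro mult_left_mono D(3) order_trans[OF expectation_norm_le_sqrt[OF U_bdd] real_sqrt_le_mono])
    let ?r = "\<lambda>t s. ennreal \<bar>cov (g t) (g s)\<bar>"
    let ?C = "E ^ 4 * A\<^sup>2"
    have cov_Y: "norm (\<integral>\<omega>. Z z \<omega> * cnj (Z z' \<omega>) \<partial>M) \<le>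
       ?C * (\<bar>cov (g (fst z)) (g (snd z))\<bar> * (\<bar>cov (g (fst z')) (g (snd z'))\<bar> *
         (\<bar>cov (g (fst z)) (g (fst z'))\<bar> + \<bar>cov (g (fst z)) (g (snd z'))\<bar> +
          \<bar>cov (g (snd z)) (g (fst z'))\<bar> + \<bar>cov (g (snd z)) (g (snd z'))\<bar>)))"
      if z: "z \<in> space (\<mu> \<Otimes>\<^sub>M \<mu>)" "z' \<in> space (\<mu> \<Otimes>\<^sub>M \<mu>)" for z z'
    proof -
      obtain t s t' s' where ts: "z = (t, s)" "z' = (t', s')" by fastforce
      have sp: "t \<in> space \<mu>" "s \<in> space \<mu>" "t' \<in> space \<mu>" "s' \<in> space \<mu>"
        using z by (auto simp: ts space_pair_measure)
      define u where "u p = e (fst p) * d (snd p)" for p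
      \<comment> \<open>A product of two exponentials is one exponential of a member of
        \<open>H\<close>; \<open>p\<close> is the pair of frequencies attached to \<open>s\<close>
        and \<open>t\<close>, the second scaled by \<tau>.\<close>
      define h where "h t s p \<omega> = fst p * g s \<omega> + (snd p * \<tau>) * g t \<omega>" for t s p \<omega>
      have hH: "h t s p \<in> H" if "t \<in> space \<mu>" "s \<in> space \<mu>" for t s p
        unfolding h_def[abs_def] using that by (intro H_add H_scale g_H)
      have Y_eq: "Y t s \<omega> = (\<Sum>p\<in>I \<times> I. u p * cis (h t s p \<omega>))" for t s \<omega>
        unfolding Y_def trig_def sum_product sum.cartesian_product u_def h_def
        by (intro sum.cong refl) (auto simp: cis_mult[symmetric] mult_ac)
      have m_eq: "m t s = (\<Sum>p\<in>I \<times> I. u p * (\<integral>\<omega>. cis (h t s p \<omega>) \<partial>M))"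
        if "t \<in> space \<mu>" "s \<in> space \<mu>" for t s
        unfolding m_def Y_eq
        by (subst Bochner_Integration.integral_sum)
           (auto intro!: Bochner_Integration.integrable_mult_right integrable_bounded_rv[OF bounded_rv_cis[OF hH[OF that]]])
      have Y0: "Y t s \<omega> - m t s = (\<Sum>p\<in>I \<times> I. u p * (cis (h t s p \<omega>) - (\<integral>\<omega>. cis (h t s p \<omega>) \<partial>M)))"
        if "t \<in> space \<mu>" "s \<in> space \<mu>" for t s \<omega>
        unfolding Y_eq m_eq[OF that] by (simp add: sum_subtractf right_diff_distrib)
      let ?S = "\<bar>cov (g t) (g t')\<bar> + \<bar>cov (g t) (g s')\<bar> + \<bar>cov (g s) (g t')\<bar> + \<bar>cov (g s) (g s')\<bar>"
      have u_sum: "(\<Sum>p\<in>I \<times> I. norm (u p)) \<le> E * E"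
      proof -
        have "(\<Sum>p\<in>I \<times> I. norm (u p)) = (\<Sum>a\<in>I. norm (e a)) * (\<Sum>a\<in>I. norm (d a))"
          unfolding sum_product sum.cartesian_product u_def by (intro sum.cong refl) (auto simp: norm_mult)
        also have "\<dots> \<le> E * E" unfolding E_def
          by (intro mult_left_mono sum_mono d) (auto simp: sum_nonneg)
        finally show ?thesis .
      qed
      have tau: "\<bar>b * \<tau>\<bar> \<le> A" if "b \<in> I" for b
        using mult_mono[OF A(1)[OF that] \<tau>] A(2) by (simp add: abs_mult)
      have "norm (\<integral>\<omega>. (Y t s \<omega> - m t s) * cnj (Y t' s' \<omega> - m t' s') \<partial>M)
         \<le> (\<Sum>p\<in>I \<times> I. \<Sum>q\<in>I \<times> I. norm (u p) * norm (u q) * \<bar>cov (h t s p) (h t' s' q)\<bar>)"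
        unfolding Y0[OF sp(1,2)] Y0[OF sp(3,4)]
        by (rule norm_cov_cis_le) (auto intro: finite_I hH sp)
      also have "\<dots> \<le> (\<Sum>p\<in>I \<times> I. \<Sum>q\<in>I \<times> I. norm (u p) * norm (u q) * (A\<^sup>2 * ?S))"
        unfolding h_def[abs_def]
        by (intro sum_mono mult_left_mono abs_cov_lincomb_le sp A tau) (auto simp: A)
      also have "\<dots> = (\<Sum>p\<in>I \<times> I. norm (u p)) * (\<Sum>q\<in>I \<times> I. norm (u q)) * (A\<^sup>2 * ?S)"
        unfolding sum_product by (simp only: sum_distrib_right)
      also have "\<dots> \<le> (E * E) * (E * E) * (A\<^sup>2 * ?S)"
        using E(1) by (intro mult_right_mono mult_mono u_sum) (auto simp: sum_nonneg)
      also have "\<dots> = ?C * ?S" by (simp add: power4_eq_xxxx mult_ac)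
      finally have *: "norm (\<integral>\<omega>. (Y t s \<omega> - m t s) * cnj (Y t' s' \<omega> - m t' s') \<partial>M) \<le> ?C * ?S" .
      have "(\<integral>\<omega>. Z z \<omega> * cnj (Z z' \<omega>) \<partial>M) = of_real (cov (g t) (g s) * cov (g t') (g s')) *
          (\<integral>\<omega>. (Y t s \<omega> - m t s) * cnj (Y t' s' \<omega> - m t' s') \<partial>M)"
        unfolding Bochner_Integration.integral_mult_right_zero[symmetric] ts Z_def fst_conv snd_conv
        by (intro Bochner_Integration.integral_cong refl) (simp add: mult_ac)
      then have "norm (\<integral>\<omega>. Z z \<omega> * cnj (Z z' \<omega>) \<partial>M) \<le> \<bar>cov (g t) (g s) * cov (g t') (g s')\<bar> * (?C * ?S)"
        using mult_left_mono[OF *, of "\<bar>cov (g t) (g s) * cov (g t') (g s')\<bar>"] by (simp add: norm_mult abs_mult)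
      then show ?thesis by (simp add: ts abs_mult mult_ac)
    qed
    have C0: "0 \<le> ?C" using E(1) by simp
    have "(\<integral>\<^sup>+z. (\<integral>\<^sup>+z'. ennreal (norm (\<integral>\<omega>. Z z \<omega> * cnj (Z z' \<omega>) \<partial>M)) \<partial>(\<mu> \<Otimes>\<^sub>M \<mu>)) \<partial>(\<mu> \<Otimes>\<^sub>M \<mu>))
      \<le> (\<integral>\<^sup>+z. (\<integral>\<^sup>+z'. ennreal ?C * (?r (fst z) (snd z) * (?r (fst z') (snd z') *
         (?r (fst z) (fst z') + ?r (fst z) (snd z') + ?r (snd z) (fst z') + ?r (snd z) (snd z')))) \<partial>(\<mu> \<Otimes>\<^sub>M \<mu>)) \<partial>(\<mu> \<Otimes>\<^sub>M \<mu>))"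
    proof (intro nn_integral_mono)
      fix z z' assume z: "z \<in> space (\<mu> \<Otimes>\<^sub>M \<mu>)" "z' \<in> space (\<mu> \<Otimes>\<^sub>M \<mu>)"
      show "ennreal (norm (\<integral>\<omega>. Z z \<omega> * cnj (Z z' \<omega>) \<partial>M)) \<le> ennreal ?C * (?r (fst z) (snd z) * (?r (fst z') (snd z') *
         (?r (fst z) (fst z') + ?r (fst z) (snd z') + ?r (snd z) (fst z') + ?r (snd z) (snd z'))))"
        using ennreal_leI[OF cov_Y[OF z]] C0
        by (simp only: ennreal_mult' ennreal_plus abs_ge_zero add_nonneg_nonneg mult_nonneg_nonneg)
    qed
    also have "\<dots> = ennreal ?C * (\<integral>\<^sup>+z. (\<integral>\<^sup>+z'. ?r (fst z) (snd z) * (?r (fst z') (snd z') *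
         (?r (fst z) (fst z') + ?r (fst z) (snd z') + ?r (snd z) (fst z') + ?r (snd z) (snd z'))) \<partial>(\<mu> \<Otimes>\<^sub>M \<mu>)) \<partial>(\<mu> \<Otimes>\<^sub>M \<mu>))"
      by (subst nn_integral_cmult[symmetric]; (intro nn_integral_cong nn_integral_cmult)?) measurable
    also have "\<dots> \<le> ennreal ?C * (4 * ennreal R ^ 3 * emeasure \<mu> (space \<mu>))"
      by (intro mult_left_mono mu.nn_integral_kernel_product_le R) (auto simp: cov_commute)
    also have "\<dots> = ennreal (4 * E ^ 4 * A\<^sup>2 * measure \<mu> (space \<mu>) * R ^ 3)"
      using E(1) R(2) C0 by (simp add: mu.emeasure_eq_measure ennreal_power ennreal_mult[symmetric] mult_ac flip: ennreal_numeral)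
    finally show "(\<integral>\<omega>. (norm (U \<omega>))\<^sup>2 \<partial>M) \<le> 4 * E ^ 4 * A\<^sup>2 * measure \<mu> (space \<mu>) * R ^ 3"
      unfolding U_def using E(1) R(2)
      by (intro second_moment_integral_le[OF nu Z_meas Z_le]) auto
  qed
  finally show ?thesis unfolding eq E_def .
qed

text \<open>\<open>W\<close> interpolates between 0 at \<tau> = 0, thanks to the centring of
  \<open>c\<close>, and the expectation of \<open>F * B\<close> at \<tau> = 1. Integration by parts
  cancels the derivative of the weights, so what is left of the derivative is the quadratic
  functional tested against \<open>D\<close>, the situation of \<open>theta_bound\<close>.\<close>

lemma stein_bound:
  assumes ibp: "ibp B D" and centred: "(\<Sum>a\<in>I. c a * of_real (exp (- a\<^sup>2 / 2))) = 0"
    and R: "\<And>t. t \<in> space \<mu> \<Longrightarrow> (\<integral>\<^sup>+s. ennreal \<bar>cov (g t) (g s)\<bar> \<partial>\<mu>) \<le> ennreal R" "0 \<le> R"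
    and A: "\<And>a. a \<in> I \<Longrightarrow> \<bar>a\<bar> \<le> A" "0 \<le> A"
    and D: "\<And>\<omega>. \<omega> \<in> space M \<Longrightarrow> norm (D \<omega>) \<le> L" "0 \<le> L" "(\<integral>\<omega>. D \<omega> \<partial>M) = 0"
  shows "norm (\<integral>\<omega>. F \<omega> * B \<omega> \<partial>M)
     \<le> L * sqrt (4 * (\<Sum>a\<in>I. norm (dcoef c a)) ^ 4 * A\<^sup>2 * measure \<mu> (space \<mu>) * R ^ 3)"
    (is "_ \<le> ?bound")
proof -
  note b = ibp_bounded[OF ibp]
  have [measurable]: "B \<in> borel_measurable M" "D \<in> borel_measurable M" using b bounded_rv_measurable by auto
  obtain K where K: "0 \<le> K" "\<And>x. x \<in> space M \<Longrightarrow> norm (B x) \<le> K" using bounded_rvE[OF b(1)] by metis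
  interpret P: pair_sigma_finite \<mu> M ..
  have finP: "finite_measure (\<mu> \<Otimes>\<^sub>M M)"
    by (rule finite_measure_pair_measure[OF finite_measure_axioms mu.finite_measure_axioms])
  then interpret P: finite_measure "\<mu> \<Otimes>\<^sub>M M" .
  have sq: "integrable (\<mu> \<Otimes>\<^sub>M M) (\<lambda>z. (a * g (fst z) (snd z))\<^sup>2)" for a
  proof (rule P.Fubini_integrable)
    have "(\<integral>\<omega>. (a * g t \<omega>)\<^sup>2 \<partial>M) = a\<^sup>2" if "t \<in> space \<mu>" for t
      using g_unit[OF that] by (simp add: cov_def power_mult_distrib power2_eq_square[of "g t _"])
    then have "integrable \<mu> (\<lambda>t. \<integral>\<omega>. (a * g t \<omega>)\<^sup>2 \<partial>M) \<longleftrightarrow> integrable \<mu> (\<lambda>t. a\<^sup>2)"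
      by (intro Bochner_Integration.integrable_cong) auto
    then show "integrable \<mu> (\<lambda>t. \<integral>\<omega>. norm ((a * g (fst (t, \<omega>)) (snd (t, \<omega>)))\<^sup>2) \<partial>M)" by simp
    show "AE t in \<mu>. integrable M (\<lambda>\<omega>. (a * g (fst (t, \<omega>)) (snd (t, \<omega>)))\<^sup>2)"
      by (rule AE_I2) (simp add: power_mult_distrib H_square g_H)
  qed simp
  \<comment> \<open>The weight is the characteristic function at \<open>a\<close> of independent
    Gaussian noise of variance \<open>1 - \<tau>\<^sup>2\<close>. Multiplied by
    \<open>cis (\<tau> * a * g t)\<close> it averages \<open>cis (a * y)\<close> over
    \<open>y = \<tau> * g t\<close> plus noise, a standard normal variable for each \<tau> in the
    unit interval, and the probability space needs no enlargement.\<close>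
  define w where "w a \<tau> = exp (- (a\<^sup>2 * (1 - \<tau>\<^sup>2)) / 2)" for a \<tau> :: real
  define J where "J a \<tau> = (\<integral>z. cis (\<tau> * (a * g (fst z) (snd z))) * B (snd z) \<partial>(\<mu> \<Otimes>\<^sub>M M))" for a \<tau>
  define \<Gamma> where "\<Gamma> a \<tau> = (\<integral>t. (\<integral>s. of_real (cov (g t) (g s)) *
      (\<integral>\<omega>. trig I (dcoef c) (g s \<omega>) * (cis (\<tau> * (a * g t \<omega>)) * D \<omega>) \<partial>M) \<partial>\<mu>) \<partial>\<mu>)" for a \<tau>
  define p where "p a \<tau> t = (\<integral>\<omega>. cis (\<tau> * (a * g t \<omega>)) * B \<omega> \<partial>M)" for a \<tau> t
  define q where "q a \<tau> t = (\<integral>s. of_real (cov (g t) (g s)) *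
      (\<integral>\<omega>. trig I (dcoef c) (g s \<omega>) * (cis (\<tau> * (a * g t \<omega>)) * D \<omega>) \<partial>M) \<partial>\<mu>)" for a \<tau> t
  let ?e = "\<Sum>a\<in>I. norm (dcoef c a)"
  have inner_le: "norm (of_real (cov (g t) (g s)) *
      (\<integral>\<omega>. trig I (dcoef c) (g s \<omega>) * (cis (\<tau> * (a * g t \<omega>)) * D \<omega>) \<partial>M)) \<le> ?e * L"
    if "t \<in> space \<mu>" "s \<in> space \<mu>" for t s \<tau> a
  proof -
    have "norm (\<integral>\<omega>. trig I (dcoef c) (g s \<omega>) * (cis (\<tau> * (a * g t \<omega>)) * D \<omega>) \<partial>M) \<le> (\<integral>\<omega>. ?e * L \<partial>M)"
    proof (rule norm_integral_le)
      fix \<omega> assume "\<omega> \<in> space M"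
      then show "norm (trig I (dcoef c) (g s \<omega>) * (cis (\<tau> * (a * g t \<omega>)) * D \<omega>)) \<le> ?e * L"
        unfolding norm_mult[of "trig _ _ _"] norm_mult[of "cis _"] norm_cis mult_1_left
        by (intro mult_mono norm_trig_le D sum_nonneg norm_ge_zero)
    qed simp
    then have "norm (of_real (cov (g t) (g s)) *
      (\<integral>\<omega>. trig I (dcoef c) (g s \<omega>) * (cis (\<tau> * (a * g t \<omega>)) * D \<omega>) \<partial>M)) \<le> 1 * (?e * L)"
      unfolding norm_mult[of "of_real _"] using abs_rho_le[OF that] by (intro mult_mono) (auto simp: prob_space)
    then show ?thesis by simp
  qed
  have inner_int: "integrable \<mu> (\<lambda>s. of_real (cov (g t) (g s)) *
      (\<integral>\<omega>. trig I (dcoef c) (g s \<omega>) * (cis (\<tau> * (a * g t \<omega>)) * D \<omega>) \<partial>M))"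
    if "t \<in> space \<mu>" for t \<tau> a
    using that inner_le by (intro mu.integrable_const_bound[where B="?e * L"]) auto
  have p_int: "integrable \<mu> (p a \<tau>)" for a \<tau>
  proof (rule mu.integrable_const_bound[where B=K])
    have "norm (p a \<tau> t) \<le> (\<integral>\<omega>. K \<partial>M)" for t
      unfolding p_def by (rule norm_integral_le) (auto simp: norm_mult K)
    then show "AE t in \<mu>. norm (p a \<tau> t) \<le> K" by (auto simp: prob_space)
  qed (unfold p_def, measurable)
  have q_int: "integrable \<mu> (q a \<tau>)" for a \<tau>
  proof (rule mu.integrable_const_bound)
    have "norm (q a \<tau> t) \<le> (\<integral>s. ?e * L \<partial>\<mu>)" if "t \<in> space \<mu>" for t
      unfolding q_def by (rule norm_integral_le) (use that inner_le in auto)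
    then show "AE t in \<mu>. norm (q a \<tau> t) \<le> (\<integral>s. ?e * L \<partial>\<mu>)" by auto
  qed (unfold q_def, measurable)
  have J_eq: "J a \<tau> = (\<integral>t. p a \<tau> t \<partial>\<mu>)" for a \<tau>
    unfolding J_def p_def
    by (rule Fubini_bounded_pair[OF mu.finite_measure_axioms finite_measure_axioms, where k="\<lambda>_. K"])
       (simp_all add: norm_mult K)
  \<comment> \<open>Differentiation brings down \<open>a * g t\<close>; integration by parts with
    \<open>k = g t\<close> then gives the damping term, through \<open>cov (g t) (g t) = 1\<close>,
    and the quadratic functional \<open>\<Gamma>\<close>.\<close>
  have J': "(J a has_vector_derivative (- (of_real (a\<^sup>2 * \<tau>)) * J a \<tau> + \<i> * of_real a * \<Gamma> a \<tau>)) (at \<tau>)" for a \<tau>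
  proof -
    have "(J a has_vector_derivative (\<integral>z. \<i> * of_real (a * g (fst z) (snd z)) *
          (cis (\<tau> * (a * g (fst z) (snd z))) * B (snd z)) \<partial>(\<mu> \<Otimes>\<^sub>M M))) (at \<tau>)"
      unfolding J_def[abs_def]
      by (rule P.has_vector_derivative_integral_cis[where B=K]) (auto simp: sq space_pair_measure K)
    also have "(\<integral>z. \<i> * of_real (a * g (fst z) (snd z)) * (cis (\<tau> * (a * g (fst z) (snd z))) * B (snd z)) \<partial>(\<mu> \<Otimes>\<^sub>M M))
       = (\<integral>t. (\<integral>\<omega>. \<i> * of_real (a * g t \<omega>) * (cis (\<tau> * (a * g t \<omega>)) * B \<omega>) \<partial>M) \<partial>\<mu>)"
    proof (rule trans[OF P.integral_fst'[symmetric]])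
      have "integrable (\<mu> \<Otimes>\<^sub>M M) (\<lambda>z. \<i> * complex_of_real (a * g (fst z) (snd z)))"
        using P.integrable_of_square[OF _ sq[of a]] by (intro Bochner_Integration.integrable_mult_right integrable_of_real) simp
      then show "integrable (\<mu> \<Otimes>\<^sub>M M) (\<lambda>z. \<i> * complex_of_real (a * g (fst z) (snd z)) * (cis (\<tau> * (a * g (fst z) (snd z))) * B (snd z)))"
        by (rule integrable_mult_bounded[where B=K]) (auto simp: norm_mult space_pair_measure K)
    qed simp
    also have "\<dots> = (\<integral>t. - (of_real (a\<^sup>2 * \<tau>)) * p a \<tau> t + \<i> * of_real a * q a \<tau> t \<partial>\<mu>)"
    proof (intro Bochner_Integration.integral_cong refl)
      fix t assume t: "t \<in> space \<mu>"
      have h: "(\<lambda>\<omega>. \<tau> * (a * g t \<omega>)) \<in> H" using t by (intro H_scale g_H)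
      have ch: "cov (g t) (\<lambda>\<omega>. \<tau> * (a * g t \<omega>)) = \<tau> * a"
        using g_unit[OF t] by (simp add: cov_scale_right)
      have "(\<integral>\<omega>. \<i> * of_real (a * g t \<omega>) * (cis (\<tau> * (a * g t \<omega>)) * B \<omega>) \<partial>M)
        = (\<integral>\<omega>. \<i> * of_real a * (of_real (g t \<omega>) * (cis (\<tau> * (a * g t \<omega>)) * B \<omega>)) \<partial>M)"
        by (simp add: mult_ac)
      also have "\<dots> = \<i> * of_real a * (\<integral>\<omega>. of_real (g t \<omega>) * (cis (\<tau> * (a * g t \<omega>)) * B \<omega>) \<partial>M)"
        by (rule Bochner_Integration.integral_mult_right_zero)
      also have "\<dots> = \<i> * of_real a * (\<i> * of_real (\<tau> * a) * p a \<tau> t + q a \<tau> t)"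
        unfolding ibpD[OF ibp h g_H[OF t]] ch p_def q_def ..
      also have "\<dots> = - (of_real (a\<^sup>2 * \<tau>)) * p a \<tau> t + \<i> * of_real a * q a \<tau> t"
        by (simp add: algebra_simps power2_eq_square)
      finally show "(\<integral>\<omega>. \<i> * of_real (a * g t \<omega>) * (cis (\<tau> * (a * g t \<omega>)) * B \<omega>) \<partial>M) = \<dots>" .
    qed
    also have "\<dots> = - (of_real (a\<^sup>2 * \<tau>)) * (\<integral>t. p a \<tau> t \<partial>\<mu>) + \<i> * of_real a * (\<integral>t. q a \<tau> t \<partial>\<mu>)"
      using p_int q_int by simp
    also have "\<dots> = - (of_real (a\<^sup>2 * \<tau>)) * J a \<tau> + \<i> * of_real a * \<Gamma> a \<tau>"
      by (simp add: J_eq \<Gamma>_def q_def)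
    finally show ?thesis .
  qed
  define W where "W \<tau> = (\<Sum>a\<in>I. c a * (of_real (w a \<tau>) * J a \<tau>))" for \<tau>
  have W': "(W has_vector_derivative (\<Sum>a\<in>I. dcoef c a * of_real (w a \<tau>) * \<Gamma> a \<tau>)) (at \<tau>)" for \<tau>
  proof -
    have "((\<lambda>\<tau>. c a * (of_real (w a \<tau>) * J a \<tau>)) has_vector_derivative
       c a * (of_real (w a \<tau>) * (- (of_real (a\<^sup>2 * \<tau>)) * J a \<tau> + \<i> * of_real a * \<Gamma> a \<tau>) + of_real (w a \<tau> * (a\<^sup>2 * \<tau>)) * J a \<tau>)) (at \<tau>)" for a
    proof (intro has_vector_derivative_mult_right has_vector_derivative_mult J')
      show "((\<lambda>\<tau>. complex_of_real (w a \<tau>)) has_vector_derivative complex_of_real (w a \<tau> * (a\<^sup>2 * \<tau>))) (at \<tau>)"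
        unfolding w_def by (rule has_vector_derivative_of_real) (auto intro!: derivative_eq_intros)
    qed
    \<comment> \<open>The logarithmic derivative of \<open>w a\<close> is
      \<open>a\<^sup>2 * \<tau>\<close>, exactly the rate at which \<open>J a\<close> is damped, so
      these two contributions cancel.\<close>
    moreover have "c a * (of_real (w a \<tau>) * (- (of_real (a\<^sup>2 * \<tau>)) * J a \<tau> + \<i> * of_real a * \<Gamma> a \<tau>) + of_real (w a \<tau> * (a\<^sup>2 * \<tau>)) * J a \<tau>)
      = dcoef c a * of_real (w a \<tau>) * \<Gamma> a \<tau>" for a
      by (simp add: algebra_simps)
    ultimately show ?thesis unfolding W_def[abs_def] by (intro has_vector_derivative_sum) (simp only:)
  qed
  have "norm (W 1 - W 0) \<le> ?bound * \<bar>1 - 0\<bar>"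
  proof (rule norm_diff_le_vector_derivative[OF W'])
    fix \<tau> :: real assume "\<tau> \<in> closed_segment 0 1"
    then have \<tau>: "0 \<le> \<tau>" "\<tau> \<le> 1" by (auto simp: closed_segment_eq_real_ivl)
    define d where "d a = dcoef c a * of_real (w a \<tau>)" for a
    have d: "norm (d a) \<le> norm (dcoef c a)" for a
    proof -
      have "w a \<tau> \<le> 1" using \<tau> power_le_one[of \<tau> 2] by (simp add: w_def)
      moreover have "0 \<le> w a \<tau>" by (simp add: w_def)
      ultimately show ?thesis unfolding d_def norm_mult[of "dcoef c a"] by (intro mult_left_le) auto
    qed
    have "(\<integral>t. (\<integral>s. of_real (cov (g t) (g s)) *
             (\<integral>\<omega>. trig I (dcoef c) (g s \<omega>) * (trig I d (\<tau> * g t \<omega>) * D \<omega>) \<partial>M) \<partial>\<mu>) \<partial>\<mu>)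
       = (\<integral>t. (\<Sum>a\<in>I. d a * q a \<tau> t) \<partial>\<mu>)"
    proof (intro Bochner_Integration.integral_cong refl)
      fix t assume t: "t \<in> space \<mu>"
      have h: "(\<lambda>\<omega>. \<tau> * (a * g t \<omega>)) \<in> H" for a using t by (intro H_scale g_H)
      have "(\<integral>s. of_real (cov (g t) (g s)) *
             (\<integral>\<omega>. trig I (dcoef c) (g s \<omega>) * (trig I d (\<tau> * g t \<omega>) * D \<omega>) \<partial>M) \<partial>\<mu>)
        = (\<integral>s. (\<Sum>a\<in>I. d a * (of_real (cov (g t) (g s)) *
             (\<integral>\<omega>. trig I (dcoef c) (g s \<omega>) * (cis (\<tau> * (a * g t \<omega>)) * D \<omega>) \<partial>M))) \<partial>\<mu>)"
      proof (intro Bochner_Integration.integral_cong refl)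
        fix s assume s: "s \<in> space \<mu>"
        have int: "integrable M (\<lambda>\<omega>. trig I (dcoef c) (g s \<omega>) * (cis (\<tau> * (a * g t \<omega>)) * D \<omega>))" for a
          using s by (intro integrable_bounded_rv bounded_rv_mult bounded_rv_trig bounded_rv_cis[OF h] b)
        have "(\<integral>\<omega>. trig I (dcoef c) (g s \<omega>) * (trig I d (\<tau> * g t \<omega>) * D \<omega>) \<partial>M)
            = (\<integral>\<omega>. (\<Sum>a\<in>I. d a * (trig I (dcoef c) (g s \<omega>) * (cis (\<tau> * (a * g t \<omega>)) * D \<omega>))) \<partial>M)"
          unfolding trig_def[of I d] sum_distrib_left sum_distrib_right
          by (intro Bochner_Integration.integral_cong refl sum.cong) (simp add: mult_ac)
        also have "\<dots> = (\<Sum>a\<in>I. d a * (\<integral>\<omega>. trig I (dcoef c) (g s \<omega>) * (cis (\<tau> * (a * g t \<omega>)) * D \<omega>) \<partial>M))"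
          using int by (subst Bochner_Integration.integral_sum) auto
        finally show "of_real (cov (g t) (g s)) * (\<integral>\<omega>. trig I (dcoef c) (g s \<omega>) * (trig I d (\<tau> * g t \<omega>) * D \<omega>) \<partial>M)
           = (\<Sum>a\<in>I. d a * (of_real (cov (g t) (g s)) * (\<integral>\<omega>. trig I (dcoef c) (g s \<omega>) * (cis (\<tau> * (a * g t \<omega>)) * D \<omega>) \<partial>M)))"
          by (simp only: sum_distrib_left mult.left_commute)
      qed
      also have "\<dots> = (\<Sum>a\<in>I. d a * q a \<tau> t)"
        unfolding q_def using inner_int[OF t] by (subst Bochner_Integration.integral_sum) auto
      finally show "(\<integral>s. of_real (cov (g t) (g s)) *
             (\<integral>\<omega>. trig I (dcoef c) (g s \<omega>) * (trig I d (\<tau> * g t \<omega>) * D \<omega>) \<partial>M) \<partial>\<mu>) = (\<Sum>a\<in>I. d a * q a \<tau> t)" .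
    qed
    also have "\<dots> = (\<Sum>a\<in>I. d a * \<Gamma> a \<tau>)"
      using q_int by (subst Bochner_Integration.integral_sum) (auto simp: \<Gamma>_def q_def[abs_def])
    finally have eq: "(\<integral>t. (\<integral>s. of_real (cov (g t) (g s)) *
             (\<integral>\<omega>. trig I (dcoef c) (g s \<omega>) * (trig I d (\<tau> * g t \<omega>) * D \<omega>) \<partial>M) \<partial>\<mu>) \<partial>\<mu>) = (\<Sum>a\<in>I. d a * \<Gamma> a \<tau>)" .
    show "norm (\<Sum>a\<in>I. dcoef c a * of_real (w a \<tau>) * \<Gamma> a \<tau>) \<le> ?bound"
      using theta_bound[where e="dcoef c" and d=d and \<tau>=\<tau>, OF R A d _ b(2) D] \<tau>
      unfolding eq unfolding d_def by simp
  qed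
  moreover have "W 1 = (\<integral>\<omega>. F \<omega> * B \<omega> \<partial>M)"
  proof -
    have "(\<integral>\<omega>. F \<omega> * B \<omega> \<partial>M) = (\<integral>t. (\<integral>\<omega>. 1 * (trig I c (g t \<omega>) * B \<omega>) \<partial>M) \<partial>\<mu>)"
      unfolding F_def using bounded_rv_Fubini[OF integrable_const[of 1] b(1), of c] by simp
    also have "\<dots> = (\<integral>t. (\<Sum>a\<in>I. c a * p a 1 t) \<partial>\<mu>)"
      by (intro Bochner_Integration.integral_cong refl, subst integral_trig_expand[OF _ b(1)]) (auto simp: p_def)
    also have "\<dots> = W 1"
      using p_int by (subst Bochner_Integration.integral_sum) (auto simp: W_def J_eq w_def)
    finally show ?thesis by simp
  qed
  moreover have "W 0 = 0"
  proof -
    \<comment> \<open>At \<tau> = 0 the exponential is 1 for every frequency, and the common factor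
      multiplies the centring sum.\<close>
    have "J a 0 = J 0 0" for a by (simp add: J_def)
    then have "W 0 = (\<Sum>a\<in>I. c a * of_real (exp (- a\<^sup>2 / 2))) * J 0 0"
      unfolding W_def w_def sum_distrib_right by (intro sum.cong refl) simp
    then show ?thesis unfolding centred by simp
  qed
  ultimately show ?thesis by simp
qed

text \<open>Stein's bound says that the characteristic function \<open>\<psi>\<close> of
  \<open>Re F\<close> solves \<open>\<psi>' = - s * V * \<psi>\<close> up to
  \<open>2 * \<bar>s\<bar> * K\<close>. The factor \<open>exp (V * s\<^sup>2 / 2)\<close> integrates
  this equation, and its growth is cancelled at the end, so the final error does not involve
  \<open>V\<close>.\<close>

lemma char_estimate:
  fixes s :: real
  assumes real: "\<And>x. Im (trig I c x) = 0"
    and centred: "(\<Sum>a\<in>I. c a * of_real (exp (- a\<^sup>2 / 2))) = 0"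
    and R: "\<And>t. t \<in> space \<mu> \<Longrightarrow> (\<integral>\<^sup>+s. ennreal \<bar>cov (g t) (g s)\<bar> \<partial>\<mu>) \<le> ennreal R" "0 \<le> R"
    and A: "\<And>a. a \<in> I \<Longrightarrow> \<bar>a\<bar> \<le> A" "0 \<le> A"
  shows "norm ((\<integral>\<omega>. cis (s * Re (F \<omega>)) \<partial>M) - of_real (exp (- (s\<^sup>2 * (\<integral>\<omega>. (Re (F \<omega>))\<^sup>2 \<partial>M) / 2))))
     \<le> s\<^sup>2 * (2 * sqrt (4 * (\<Sum>a\<in>I. norm (dcoef c a)) ^ 4 * A\<^sup>2 * measure \<mu> (space \<mu>) * R ^ 3))"
proof -
  define K where "K = sqrt (4 * (\<Sum>a\<in>I. norm (dcoef c a)) ^ 4 * A\<^sup>2 * measure \<mu> (space \<mu>) * R ^ 3)"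
  have K0: "0 \<le> K" unfolding K_def using R(2) by (auto intro!: mult_nonneg_nonneg simp: sum_nonneg)
  define X where "X \<omega> = Re (F \<omega>)" for \<omega>
  have trig_real: "trig I c x = of_real (Re (trig I c x))" for x
    by (simp add: complex_eq_iff real)
  have FX: "F \<omega> = of_real (X \<omega>)" for \<omega>
  proof -
    have "F \<omega> = (\<integral>t. of_real (Re (trig I c (g t \<omega>))) \<partial>\<mu>)" unfolding F_def using trig_real by simp
    then show ?thesis unfolding X_def by (simp only: integral_complex_of_real Re_complex_of_real)
  qed
  note [measurable] = bounded_rv_measurable[OF bounded_rv_F]
  have [measurable]: "X \<in> borel_measurable M" unfolding X_def by measurable
  obtain L where L: "0 \<le> L" "\<And>\<omega>. \<omega> \<in> space M \<Longrightarrow> norm (F \<omega>) \<le> L" using bounded_rvE[OF bounded_rv_F] by metis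
  have X_le: "\<bar>X \<omega>\<bar> \<le> L" if "\<omega> \<in> space M" for \<omega> using L(2)[OF that] by (simp add: FX)
  have X2: "integrable M (\<lambda>\<omega>. (X \<omega>)\<^sup>2)"
    using X_le by (intro integrable_const_bound[where B="L\<^sup>2"]) (auto intro!: AE_I2 abs_le_square_iff[THEN iffD1] simp: L(1))
  define V where "V = (\<integral>\<omega>. (X \<omega>)\<^sup>2 \<partial>M)"
  define \<psi> where "\<psi> s = (\<integral>\<omega>. cis (s * X \<omega>) \<partial>M)" for s
  define P where "P s = (\<integral>\<omega>. of_real (X \<omega>) * cis (s * X \<omega>) \<partial>M)" for s
  have \<psi>_le: "norm (\<psi> s) \<le> 1" for s
  proof -
    have "norm (\<psi> s) \<le> (\<integral>\<omega>. 1 \<partial>M)" unfolding \<psi>_def by (rule norm_integral_le) auto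
    then show ?thesis by (simp add: prob_space)
  qed
  have cis_int: "integrable M (\<lambda>\<omega>. cis (s * X \<omega>))" for s by (rule integrable_const_bound[where B=1]) auto
  have Xcis_int: "integrable M (\<lambda>\<omega>. of_real (X \<omega>) * cis (s * X \<omega>))" for s
    by (rule integrable_const_bound[where B=L]) (auto intro!: AE_I2 X_le simp: norm_mult)
  have FXs: "exp (\<i> * of_real s * F \<omega>) = cis (s * X \<omega>)" for s \<omega>
    by (simp add: FX cis_conv_exp mult.assoc)
  have stein: "norm (P s - \<i> * of_real s * \<psi> s * of_real V) \<le> 2 * \<bar>s\<bar> * K" for s
  proof -
    \<comment> \<open>The coefficient is chosen so that subtracting \<open>z * F\<close> from
      \<open>cis (s * X)\<close> makes the derivative \<open>D\<close> centred; the subtracted term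
      then produces the variance \<open>V\<close>.\<close>
    define z where "z = \<i> * of_real s * \<psi> s"
    define D where "D \<omega> = \<i> * of_real s * cis (s * X \<omega>) + - z * 1" for \<omega>
    have "ibp (\<lambda>\<omega>. F \<omega> * 1) (\<lambda>\<omega>. 1 + F \<omega> * 0)" by (rule ibp_mult[OF ibp_one])
    then have "ibp F (\<lambda>\<omega>. 1)" by simp
    from ibp_lincomb[OF ibp_exp this]
    have ibp: "ibp (\<lambda>\<omega>. cis (s * X \<omega>) + - z * F \<omega>) D" unfolding D_def FXs[symmetric] .
    have "norm (\<integral>\<omega>. F \<omega> * (cis (s * X \<omega>) + - z * F \<omega>) \<partial>M) \<le> 2 * \<bar>s\<bar> * K"
      unfolding K_def
    proof (rule stein_bound[OF ibp centred R A])
      show "norm (D \<omega>) \<le> 2 * \<bar>s\<bar>" for \<omega>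
      proof -
        have "norm (D \<omega>) \<le> \<bar>s\<bar> * 1 + \<bar>s\<bar> * norm (\<psi> s)"
          unfolding D_def by (rule order_trans[OF norm_triangle_ineq]) (simp add: norm_mult z_def)
        also have "\<dots> \<le> \<bar>s\<bar> * 1 + \<bar>s\<bar> * 1" by (intro add_mono mult_left_mono \<psi>_le) auto
        finally show ?thesis by simp
      qed
      show "(\<integral>\<omega>. D \<omega> \<partial>M) = 0"
        unfolding D_def using cis_int by (simp add: prob_space \<psi>_def z_def)
    qed auto
    also have "(\<integral>\<omega>. F \<omega> * (cis (s * X \<omega>) + - z * F \<omega>) \<partial>M) = (\<integral>\<omega>. of_real (X \<omega>) * cis (s * X \<omega>) - z * of_real ((X \<omega>)\<^sup>2) \<partial>M)"
      by (intro Bochner_Integration.integral_cong refl) (simp add: FX algebra_simps power2_eq_square)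
    also have "\<dots> = P s - z * of_real V"
      using Xcis_int integrable_of_real[OF X2, where 'a=complex]
      by (simp add: P_def V_def del: of_real_power flip: integral_complex_of_real)
    finally show ?thesis by (simp add: z_def)
  qed
  have \<psi>': "(\<psi> has_vector_derivative \<i> * P s) (at s)" for s
  proof -
    have "((\<lambda>s. \<integral>\<omega>. cis (s * X \<omega>) * 1 \<partial>M) has_vector_derivative
            (\<integral>\<omega>. \<i> * of_real (X \<omega>) * (cis (s * X \<omega>) * 1) \<partial>M)) (at s)"
      by (rule has_vector_derivative_integral_cis[OF _ _ X2, where B=1]) auto
    then show ?thesis unfolding \<psi>_def[abs_def] P_def
      by (simp add: mult.assoc)
  qed
  \<comment> \<open>\<open>y\<close> would be constantly 1 if the law were exactly normal with
    variance \<open>V\<close>.\<close>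
  define y where "y s = \<psi> s * of_real (exp (V * s\<^sup>2 / 2))" for s
  have y': "(y has_vector_derivative of_real (exp (V * s\<^sup>2 / 2)) * (\<i> * (P s - \<i> * of_real s * \<psi> s * of_real V))) (at s)" for s
  proof -
    have "(y has_vector_derivative \<psi> s * of_real (exp (V * s\<^sup>2 / 2) * (V * s)) + \<i> * P s * of_real (exp (V * s\<^sup>2 / 2))) (at s)"
      unfolding y_def[abs_def]
    proof (intro has_vector_derivative_mult \<psi>')
      show "((\<lambda>s. complex_of_real (exp (V * s\<^sup>2 / 2))) has_vector_derivative of_real (exp (V * s\<^sup>2 / 2) * (V * s))) (at s)"
        by (rule has_vector_derivative_of_real) (auto intro!: derivative_eq_intros)
    qed
    also have "\<psi> s * of_real (exp (V * s\<^sup>2 / 2) * (V * s)) + \<i> * P s * of_real (exp (V * s\<^sup>2 / 2))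
        = of_real (exp (V * s\<^sup>2 / 2)) * (\<i> * (P s - \<i> * of_real s * \<psi> s * of_real V))"
      by (simp add: algebra_simps)
    finally show ?thesis .
  qed
  have V0: "0 \<le> V" unfolding V_def by simp
  have "norm (y s - y 0) \<le> (exp (V * s\<^sup>2 / 2) * (2 * \<bar>s\<bar> * K)) * \<bar>s - 0\<bar>"
  proof (rule norm_diff_le_vector_derivative[OF y'])
    fix r assume "r \<in> closed_segment 0 s"
    then have r: "\<bar>r\<bar> \<le> \<bar>s\<bar>" by (auto simp: closed_segment_eq_real_ivl split: if_splits)
    have "norm (of_real (exp (V * r\<^sup>2 / 2)) * (\<i> * (P r - \<i> * of_real r * \<psi> r * of_real V)))
        = exp (V * r\<^sup>2 / 2) * norm (P r - \<i> * of_real r * \<psi> r * of_real V)"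
      unfolding norm_mult[of "of_real _"] norm_mult[of "\<i>"] by simp
    also have "\<dots> \<le> exp (V * r\<^sup>2 / 2) * (2 * \<bar>r\<bar> * K)" by (intro mult_left_mono stein) auto
    also have "\<dots> \<le> exp (V * s\<^sup>2 / 2) * (2 * \<bar>s\<bar> * K)"
      using r V0 K0 by (intro mult_mono) (auto intro!: mult_left_mono mult_right_mono simp: abs_le_square_iff)
    finally show "norm (of_real (exp (V * r\<^sup>2 / 2)) * (\<i> * (P r - \<i> * of_real r * \<psi> r * of_real V)))
        \<le> exp (V * s\<^sup>2 / 2) * (2 * \<bar>s\<bar> * K)" .
  qed
  also have "\<dots> = exp (V * s\<^sup>2 / 2) * (s\<^sup>2 * (2 * K))"
    by (simp add: power2_eq_square)
  finally have *: "norm (y s - 1) \<le> exp (V * s\<^sup>2 / 2) * (s\<^sup>2 * (2 * K))"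
    by (simp add: y_def \<psi>_def prob_space)
  have "\<psi> s - of_real (exp (- (s\<^sup>2 * V / 2))) = of_real (exp (- (V * s\<^sup>2 / 2))) * (y s - 1)"
    by (simp add: y_def algebra_simps exp_minus)
  then have "norm (\<psi> s - of_real (exp (- (s\<^sup>2 * V / 2)))) = exp (- (V * s\<^sup>2 / 2)) * norm (y s - 1)"
    by (simp only: norm_mult norm_of_real abs_exp_cancel)
  also have "\<dots> \<le> exp (- (V * s\<^sup>2 / 2)) * (exp (V * s\<^sup>2 / 2) * (s\<^sup>2 * (2 * K)))"
    by (intro mult_left_mono *) auto
  also have "\<dots> = s\<^sup>2 * (2 * K)" by (simp add: exp_minus field_simps)
  finally show ?thesis unfolding \<psi>_def V_def X_def K_def .
qed

end

subsection \<open>Approximation by trigonometric polynomials\<close>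

definition trig_poly :: "(real \<Rightarrow> complex) \<Rightarrow> bool" where
  "trig_poly f \<longleftrightarrow> (\<exists>I c. finite I \<and> f = trig I c)"

lemma trig_poly_cis: "trig_poly (\<lambda>x. z * cis (b * x))"
  unfolding trig_poly_def by (intro exI[of _ "{b}"] exI[of _ "\<lambda>_. z"]) (auto simp: trig_def)

lemma trig_poly_const: "trig_poly (\<lambda>x. z)"
  using trig_poly_cis[of z 0] by simp

text \<open>Two frequency sets are merged by padding coefficients with 0. The free weight
  \<open>k\<close> serves both the values, with \<open>cis (a * x)\<close>, and the Gaussian means,
  with \<open>exp (- a\<^sup>2 / 2)\<close>.\<close>

lemma trig_union:
  fixes c d k :: "real \<Rightarrow> complex"
  assumes "finite I" "finite J"
  shows "(\<Sum>a\<in>I \<union> J. ((if a \<in> I then c a else 0) + z * (if a \<in> J then d a else 0)) * k a)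
     = (\<Sum>a\<in>I. c a * k a) + z * (\<Sum>a\<in>J. d a * k a)"
proof -
  have "(\<Sum>a\<in>I \<union> J. (if a \<in> I then c a else 0) * k a) = (\<Sum>a\<in>I. c a * k a)"
    using assms by (intro sum.mono_neutral_cong_right) auto
  moreover have "(\<Sum>a\<in>I \<union> J. (if a \<in> J then d a else 0) * k a) = (\<Sum>a\<in>J. d a * k a)"
    using assms by (intro sum.mono_neutral_cong_right) auto
  ultimately show ?thesis
    by (simp only: distrib_right sum.distrib mult.assoc sum_distrib_left[symmetric])
qed

lemma trig_poly_add: "trig_poly f \<Longrightarrow> trig_poly g \<Longrightarrow> trig_poly (\<lambda>x. f x + g x)"
  unfolding trig_poly_def
proof (elim exE conjE)
  fix I c J d assume "finite I" "f = trig I c" "finite J" "g = trig J d"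
  then show "\<exists>I c. finite I \<and> (\<lambda>x. f x + g x) = trig I c"
    using trig_union[of I J c 1 d]
    by (intro exI[of _ "I \<union> J"] exI[of _ "\<lambda>a. (if a \<in> I then c a else 0) + 1 * (if a \<in> J then d a else 0)"])
       (simp add: trig_def fun_eq_iff)
qed

lemma trig_poly_sum: "finite J \<Longrightarrow> (\<And>j. j \<in> J \<Longrightarrow> trig_poly (f j)) \<Longrightarrow> trig_poly (\<lambda>x. \<Sum>j\<in>J. f j x)"
  by (induction J rule: finite_induct) (auto intro: trig_poly_const trig_poly_add)

text \<open>Different pairs of frequencies may have the same sum; writing the product as a sum of
  single exponentials leaves the collection of equal ones to \<open>trig_poly_add\<close>.\<close>

lemma trig_poly_mult: "trig_poly f \<Longrightarrow> trig_poly g \<Longrightarrow> trig_poly (\<lambda>x. f x * g x)"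
proof -
  assume "trig_poly f" "trig_poly g"
  then obtain I c J d where *: "finite I" "f = trig I c" "finite J" "g = trig J d" by (auto simp: trig_poly_def)
  have "(\<lambda>x. f x * g x) = (\<lambda>x. \<Sum>a\<in>I. \<Sum>b\<in>J. (c a * d b) * cis ((a + b) * x))"
    unfolding * trig_def sum_product
    by (intro ext sum.cong refl) (simp only: distrib_right cis_mult[symmetric] mult_ac[where 'a=complex])
  then show ?thesis using * by (simp only:) (intro trig_poly_sum trig_poly_cis; assumption)
qed

lemma trig_poly_sin: "trig_poly (\<lambda>x. of_real (sin (b * x - v)))"
proof -
  have "complex_of_real (sin (b * x - v)) = (- \<i> / 2 * cis (- v)) * cis (b * x) + (\<i> / 2 * cis v) * cis ((- b) * x)" for x
  proof -
    have "(- \<i> / 2 * cis (- v)) * cis (b * x) + (\<i> / 2 * cis v) * cis ((- b) * x)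
       = - \<i> / 2 * (cis (b * x - v) - cis (- (b * x - v)))"
      by (simp add: cis_mult algebra_simps)
    also have "\<dots> = of_real (sin (b * x - v))" by (simp add: complex_eq_iff del: minus_diff_eq)
    finally show ?thesis by simp
  qed
  then show ?thesis by (simp only:) (intro trig_poly_add trig_poly_cis)
qed

lemma trig_poly_polynomial_sin:
  assumes "real_polynomial_function p"
  shows "trig_poly (\<lambda>x. of_real (p (sin (b * x - v))))"
  using assms
proof (induction p rule: real_polynomial_function.induct)
  case (linear f)
  then interpret bounded_linear f .
  have "f y = f 1 * y" for y using scaleR[of y 1] by simp
  then have "(\<lambda>x. complex_of_real (f (sin (b * x - v)))) = (\<lambda>x. of_real (f 1) * of_real (sin (b * x - v)))"
    by (metis of_real_mult)
  then show ?case by (simp only:) (intro trig_poly_mult trig_poly_const trig_poly_sin)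
qed (auto intro: trig_poly_const trig_poly_add trig_poly_mult)

text \<open>The last conjunct says that \<open>f\<close> has mean zero under the standard normal law.\<close>

definition ctrig :: "(real \<Rightarrow> real) \<Rightarrow> bool" where
  "ctrig f \<longleftrightarrow> (\<exists>I c. finite I \<and> (\<forall>x. trig I c x = of_real (f x)) \<and>
     (\<Sum>a\<in>I. c a * of_real (exp (- a\<^sup>2 / 2))) = 0)"

lemma ctrig_diff: "ctrig f \<Longrightarrow> ctrig g \<Longrightarrow> ctrig (\<lambda>x. f x - g x)"
  unfolding ctrig_def
proof (elim exE conjE)
  fix I c J d
  assume *: "finite I" "\<forall>x. trig I c x = of_real (f x)" "(\<Sum>a\<in>I. c a * of_real (exp (- a\<^sup>2 / 2))) = 0"
    "finite J" "\<forall>x. trig J d x = of_real (g x)" "(\<Sum>a\<in>J. d a * of_real (exp (- a\<^sup>2 / 2))) = 0"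
  let ?c = "\<lambda>a. (if a \<in> I then c a else 0) + (-1) * (if a \<in> J then d a else 0)"
  show "\<exists>I c. finite I \<and> (\<forall>x. trig I c x = of_real (f x - g x)) \<and> (\<Sum>a\<in>I. c a * of_real (exp (- a\<^sup>2 / 2))) = 0"
  proof (intro exI[of _ "I \<union> J"] exI[of _ ?c] conjI allI)
    show "trig (I \<union> J) ?c x = of_real (f x - g x)" for x
      using trig_union[OF *(1,4), of c "-1" d "\<lambda>a. cis (a * x)"] *(2,5) by (simp only: trig_def) simp
    show "(\<Sum>a\<in>I \<union> J. ?c a * of_real (exp (- a\<^sup>2 / 2))) = 0"
      unfolding trig_union[OF *(1,4)] *(3,6) by simp
  qed (use * in auto)
qed

lemma ctrig_measurable: "ctrig f \<Longrightarrow> f \<in> borel_measurable borel"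
proof -
  assume "ctrig f"
  then obtain I c where "\<And>x. trig I c x = of_real (f x)" by (auto simp: ctrig_def)
  then have "f = (\<lambda>x. Re (trig I c x))" by simp
  then show ?thesis by (simp only:) measurable
qed

text \<open>Convergence is left open at the one point \<open>u\<close>, where an indicator jumps.
  The normal law does not charge it, so bounded moments still pass to the limit.\<close>

definition ctrig_limit :: "real \<Rightarrow> (real \<Rightarrow> real) \<Rightarrow> bool" where
  "ctrig_limit u \<psi> \<longleftrightarrow> \<psi> \<in> borel_measurable borel \<and>
     (\<exists>f K. (\<forall>m. ctrig (f m) \<and> (\<forall>x. \<bar>f m x\<bar> \<le> K)) \<and> (\<forall>x. x \<noteq> u \<longrightarrow> (\<lambda>m. f m x) \<longlonglongrightarrow> \<psi> x))"

text \<open>This allows Gebelein's inequality to be applied to an approximation error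
  \<open>\<psi> - f\<close>.\<close>

lemma ctrig_limit_diff:
  assumes "ctrig_limit u \<psi>" "ctrig h" "\<And>x. \<bar>h x\<bar> \<le> L"
  shows "ctrig_limit u (\<lambda>x. \<psi> x - h x)"
proof -
  obtain f K where f: "\<And>m. ctrig (f m)" "\<And>m x. \<bar>f m x\<bar> \<le> K" "\<And>x. x \<noteq> u \<Longrightarrow> (\<lambda>m. f m x) \<longlonglongrightarrow> \<psi> x"
    and [measurable]: "\<psi> \<in> borel_measurable borel"
    using assms(1) unfolding ctrig_limit_def by blast
  have [measurable]: "h \<in> borel_measurable borel" by (rule ctrig_measurable) fact
  have "\<bar>f m x - h x\<bar> \<le> K + L" for m x using f(2)[of m x] assms(3)[of x] by linarith
  then show ?thesis unfolding ctrig_limit_def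
    using f assms(2) by (intro conjI exI[of _ "\<lambda>m x. f m x - h x"] exI[of _ "K + L"])
      (auto intro: ctrig_diff tendsto_intros)
qed

text \<open>\<open>sin ((x - u) / n)\<close> has the sign of \<open>x - u\<close> on an interval of length of order \<open>n\<close>, so a steep
  clamp of it, replaced by a polynomial, approximates the indicator of \<open>{u..}\<close>.\<close>

lemma trig_poly_approx_indicator:
  obtains f :: "nat \<Rightarrow> real \<Rightarrow> real" where "\<And>m. trig_poly (\<lambda>x. of_real (f m x))" "\<And>m x. \<bar>f m x\<bar> \<le> 2"
    "\<And>x. x \<noteq> u \<Longrightarrow> (\<lambda>m. f m x) \<longlonglongrightarrow> indicator {u..} x"
proof -
  \<comment> \<open>The slope is the square of the period scale: for fixed \<open>x\<close> the sine
    is of order \<open>1 / m\<close>, and after multiplication by a number of order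
    \<open>m ^ 2\<close> it still tends to infinity, so the clamp saturates.\<close>
  define h where "h m y = min 1 (max 0 ((real m + 1)\<^sup>2 * y))" for m :: nat and y :: real
  have "\<exists>p. real_polynomial_function p \<and> (\<forall>y\<in>{-1..1}. \<bar>h m y - p y\<bar> < 1 / (real m + 1))" for m
  proof (rule Stone_Weierstrass_real_polynomial_function[of "{-1..1::real}" "h m" "1 / (real m + 1)"])
    show "continuous_on {-1..1} (h m)" unfolding h_def by (intro continuous_intros)
  qed auto
  then obtain p where p: "\<And>m. real_polynomial_function (p m)" "\<And>m y. y \<in> {-1..1} \<Longrightarrow> \<bar>h m y - p m y\<bar> < 1 / (real m + 1)"
    by metis
  define S where "S m x = sin (1 / (real m + 1) * x - u / (real m + 1))" for m :: nat and x
  have S: "S m x \<in> {-1..1}" for m x by (simp add: S_def)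
  define f where "f m x = p m (S m x)" for m x
  have fh: "\<bar>h m (S m x) - f m x\<bar> < 1 / (real m + 1)" for m x
    unfolding f_def by (rule p(2)[OF S])
  show thesis
  proof (rule that[of f])
    show "trig_poly (\<lambda>x. of_real (f m x))" for m
      unfolding f_def S_def by (rule trig_poly_polynomial_sin[OF p(1)])
    show "\<bar>f m x\<bar> \<le> 2" for m x
    proof -
      have "1 / (real m + 1) \<le> 1" by simp
      moreover have "0 \<le> h m y" "h m y \<le> 1" for y by (auto simp: h_def)
      ultimately show ?thesis using fh[of m x] by (smt (verit))
    qed
    fix x assume "x \<noteq> u"
    have "\<forall>\<^sub>F m in sequentially. h m (S m x) = indicator {u..} x"
    proof (cases "u < x")
      case True
      define d where "d = x - u"
      have d: "d > 0" using True by (simp add: d_def)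
      have "filterlim (\<lambda>m::nat. (real m + 1)\<^sup>2 * sin (d / (real m + 1))) at_top at_top"
        using d by real_asymp
      then have "\<forall>\<^sub>F m in sequentially. (real m + 1)\<^sup>2 * sin (d / (real m + 1)) \<ge> 1"
        by (simp add: filterlim_at_top)
      then show ?thesis
      proof eventually_elim
        case (elim m)
        then show ?case using True by (simp add: h_def S_def d_def diff_divide_distrib)
      qed
    next
      case False
      define d where "d = u - x"
      have d: "d > 0" using False \<open>x \<noteq> u\<close> by (simp add: d_def)
      have "filterlim (\<lambda>m::nat. (real m + 1)\<^sup>2 * sin (d / (real m + 1))) at_top at_top"
        using d by real_asymp
      then have "\<forall>\<^sub>F m in sequentially. (real m + 1)\<^sup>2 * sin (d / (real m + 1)) \<ge> 0"
        by (simp add: filterlim_at_top)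
      then show ?thesis
      proof eventually_elim
        case (elim m)
        have "S m x = - sin (d / (real m + 1))"
          unfolding S_def d_def by (subst sin_minus[symmetric]) (simp add: diff_divide_distrib)
        then show ?case using elim False \<open>x \<noteq> u\<close> by (simp add: h_def max_def min_def)
      qed
    qed
    then have 1: "(\<lambda>m. h m (S m x)) \<longlonglongrightarrow> indicator {u..} x" by (rule tendsto_eventually)
    have "(\<lambda>m. h m (S m x) - f m x) \<longlonglongrightarrow> 0"
    proof (rule Lim_null_comparison)
      show "\<forall>\<^sub>F m in sequentially. norm (h m (S m x) - f m x) \<le> 1 / (real m + 1)"
        using fh by (intro always_eventually allI) (simp add: less_imp_le)
      show "(\<lambda>m. 1 / (real m + 1)) \<longlonglongrightarrow> 0" by real_asymp
    qed
    from tendsto_diff[OF 1 this] show "(\<lambda>m. f m x) \<longlonglongrightarrow> indicator {u..} x" by simp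
  qed
qed

section \<open>The indicator as a limit of centred polynomials\<close>

lemma AE_std_normal_neq: "AE x in std_normal_distribution. x \<noteq> u"
proof (subst AE_density)
  show "AE x in lborel. 0 < ennreal (std_normal_density x) \<longrightarrow> x \<noteq> u"
    using AE_lborel_singleton[of u] by (auto elim!: eventually_mono)
qed simp

lemma std_normal_cis: "(\<integral>x. cis (a * x) \<partial>std_normal_distribution) = of_real (exp (- a\<^sup>2 / 2))"
  using char_std_normal_distribution by (simp add: char_def cis_conv_exp fun_eq_iff)

lemma prob_space_std_normal: "prob_space std_normal_distribution"
  using real_dist_normal_dist by (simp add: real_distribution_def)

text \<open>Each approximant is centred by its own normal mean \<open>e m\<close>, not by the
  limiting probability: \<open>ctrig\<close> asks for exact centring. The normal mean of
  \<open>cis (a * x)\<close> is \<open>exp (- a\<^sup>2 / 2)\<close>, which identifies it with the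
  coefficient sum in \<open>ctrig\<close>. The bound 4 adds the bounds 2 for \<open>f m\<close> and
  for \<open>e m\<close>.\<close>

lemma ctrig_limit_indicator:
  "ctrig_limit u (\<lambda>x. indicator {u..} x - measure std_normal_distribution {u..})"
proof -
  interpret prob_space std_normal_distribution by (rule prob_space_std_normal)
  obtain f where f: "\<And>m. trig_poly (\<lambda>x. of_real (f m x))" "\<And>m x. \<bar>f m x\<bar> \<le> 2"
    "\<And>x. x \<noteq> u \<Longrightarrow> (\<lambda>m. f m x) \<longlonglongrightarrow> indicator {u..} x"
    using trig_poly_approx_indicator by metis
  have f_meas [measurable]: "f m \<in> borel_measurable borel" for m
  proof -
    obtain I c where "(\<lambda>x. complex_of_real (f m x)) = trig I c" using f(1) unfolding trig_poly_def by blast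
    then have "f m = (\<lambda>x. Re (trig I c x))" by (metis Re_complex_of_real)
    then show ?thesis by (simp only:) measurable
  qed
  define e where "e m = (\<integral>x. f m x \<partial>std_normal_distribution)" for m
  have f_int: "integrable std_normal_distribution (f m)" for m
    by (rule integrable_const_bound[where B=2]) (auto simp: f)
  have e_le: "\<bar>e m\<bar> \<le> 2" for m
  proof -
    have "norm (e m) \<le> (\<integral>x. 2 \<partial>std_normal_distribution)" unfolding e_def by (rule norm_integral_le) (auto simp: f)
    then show ?thesis using prob_space by simp
  qed
  have "e \<longlonglongrightarrow> (\<integral>x. indicator {u..} x \<partial>std_normal_distribution)"
    unfolding e_def[abs_def]
    by (rule integral_dominated_convergence[where w="\<lambda>_. 2"])
       (use AE_std_normal_neq[of u] f in \<open>auto elim!: eventually_mono\<close>)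
  then have e: "e \<longlonglongrightarrow> measure std_normal_distribution {u..}" by simp
  show ?thesis unfolding ctrig_limit_def
  proof (intro conjI exI[of _ "\<lambda>m x. f m x - e m"] exI[of _ 4] allI impI)
    fix m
    have "trig_poly (\<lambda>x. of_real (f m x) + - of_real (e m))" by (intro trig_poly_add f trig_poly_const)
    then obtain I c where I: "finite I" "\<And>x. trig I c x = of_real (f m x - e m)" by (auto simp: trig_poly_def fun_eq_iff)
    have "(\<Sum>a\<in>I. c a * of_real (exp (- a\<^sup>2 / 2))) = (\<Sum>a\<in>I. c a * (\<integral>x. cis (a * x) \<partial>std_normal_distribution))"
      unfolding std_normal_cis ..
    also have "\<dots> = (\<integral>x. trig I c x \<partial>std_normal_distribution)"
      unfolding trig_def
      by (subst Bochner_Integration.integral_sum)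
         (auto intro!: Bochner_Integration.integrable_mult_right integrable_const_bound[where B=1])
    also have "\<dots> = of_real (\<integral>x. f m x - e m \<partial>std_normal_distribution)"
      by (simp only: I integral_complex_of_real)
    also have "\<dots> = 0" using f_int prob_space by (simp add: e_def)
    finally show "ctrig (\<lambda>x. f m x - e m)" unfolding ctrig_def using I by blast
    show "\<bar>f m x - e m\<bar> \<le> 4" for x using f(2)[of m x] e_le[of m] by linarith
  qed (auto intro!: tendsto_diff f e)
qed

subsection \<open>Gebelein's inequality\<close>

locale std_gaussian_pair = prob_space M for M :: "'w measure" +
  fixes X Y :: "'w \<Rightarrow> real" and \<rho> :: real
  assumes X_measurable [measurable]: "X \<in> borel_measurable M"
    and Y_measurable [measurable]: "Y \<in> borel_measurable M"
    and char_pair: "(\<integral>\<omega>. cis (a * X \<omega> + b * Y \<omega>) \<partial>M) = of_real (exp (- (a\<^sup>2 + b\<^sup>2 + 2 * (a * b * \<rho>)) / 2))"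
    and rho_le: "\<bar>\<rho>\<bar> \<le> 1"
begin

lemma distr_X: "distr M borel X = std_normal_distribution"
proof (rule Levy_uniqueness)
  show "real_distribution (distr M borel X)" by (rule real_distribution_distr) simp
  show "char (distr M borel X) = char std_normal_distribution"
  proof
    fix t
    have "char (distr M borel X) t = (\<integral>\<omega>. cis (t * X \<omega> + 0 * Y \<omega>) \<partial>M)"
      by (simp add: char_def integral_distr cis_conv_exp)
    also have "\<dots> = char std_normal_distribution t"
      unfolding char_pair char_std_normal_distribution by simp
    finally show "char (distr M borel X) t = char std_normal_distribution t" .
  qed
qed (rule real_dist_normal_dist)

lemma swap: "std_gaussian_pair M Y X \<rho>"
proof
  fix a b :: real
  have "(\<integral>\<omega>. cis (a * Y \<omega> + b * X \<omega>) \<partial>M) = (\<integral>\<omega>. cis (b * X \<omega> + a * Y \<omega>) \<partial>M)"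
    by (simp add: add.commute)
  also have "\<dots> = of_real (exp (- (b\<^sup>2 + a\<^sup>2 + 2 * (b * a * \<rho>)) / 2))" by (rule char_pair)
  also have "b\<^sup>2 + a\<^sup>2 + 2 * (b * a * \<rho>) = a\<^sup>2 + b\<^sup>2 + 2 * (a * b * \<rho>)" by simp
  finally show "(\<integral>\<omega>. cis (a * Y \<omega> + b * X \<omega>) \<partial>M) = of_real (exp (- (a\<^sup>2 + b\<^sup>2 + 2 * (a * b * \<rho>)) / 2))" .
qed (auto simp: rho_le)

lemma distr_Y: "distr M borel Y = std_normal_distribution"
  using std_gaussian_pair.distr_X[OF swap] .

lemma AE_X_neq: "AE \<omega> in M. X \<omega> \<noteq> u"
  using AE_std_normal_neq[of u] unfolding distr_X[symmetric] by (subst (asm) AE_distr_iff) auto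

lemma AE_Y_neq: "AE \<omega> in M. Y \<omega> \<noteq> u"
  using std_gaussian_pair.AE_X_neq[OF swap] .

text \<open>As \<open>f\<close> is real, the second factor may be conjugated. This reverses the sign
  of \<open>b\<close> and yields the Hermitian form with kernel \<open>exp (a * b * \<rho>)\<close>,
  whose power series has nonnegative coefficients in \<open>a * b\<close> for \<rho> = 1.\<close>

lemma integral_ctrig_mult:
  assumes "finite I" "\<And>x. trig I c x = of_real (f x)"
  shows "complex_of_real (\<integral>\<omega>. f (X \<omega>) * f (Y \<omega>) \<partial>M)
      = (\<Sum>a\<in>I. \<Sum>b\<in>I. c a * cnj (c b) * of_real (exp (- (a\<^sup>2 + b\<^sup>2) / 2) * exp (a * b * \<rho>)))"
proof -
  have e: "complex_of_real (f (X \<omega>) * f (Y \<omega>)) = (\<Sum>a\<in>I. \<Sum>b\<in>I. c a * cnj (c b) * cis (a * X \<omega> + (- b) * Y \<omega>))" for \<omega>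
  proof -
    have "complex_of_real (f (X \<omega>) * f (Y \<omega>)) = trig I c (X \<omega>) * cnj (trig I c (Y \<omega>))" by (simp add: assms)
    also have "\<dots> = (\<Sum>a\<in>I. \<Sum>b\<in>I. c a * cis (a * X \<omega>) * (cnj (c b) * cis ((- b) * Y \<omega>)))"
      unfolding trig_def cnj_sum sum_product by (simp add: cis_cnj)
    finally show ?thesis by (simp only: cis_mult[symmetric] mult_ac)
  qed
  have int: "integrable M (\<lambda>\<omega>. cis (a * X \<omega> + (- b) * Y \<omega>))" for a b
    by (rule integrable_const_bound[where B=1]) auto
  have "complex_of_real (\<integral>\<omega>. f (X \<omega>) * f (Y \<omega>) \<partial>M) = (\<integral>\<omega>. complex_of_real (f (X \<omega>) * f (Y \<omega>)) \<partial>M)"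
    by (rule integral_complex_of_real[symmetric])
  also have "\<dots> = (\<Sum>a\<in>I. \<Sum>b\<in>I. c a * cnj (c b) * (\<integral>\<omega>. cis (a * X \<omega> + (- b) * Y \<omega>) \<partial>M))"
    unfolding e using int
    by (subst Bochner_Integration.integral_sum; (intro sum.cong refl)?)
       (auto intro!: Bochner_Integration.integrable_sum Bochner_Integration.integrable_mult_right)
  also have "\<dots> = (\<Sum>a\<in>I. \<Sum>b\<in>I. c a * cnj (c b) * of_real (exp (- (a\<^sup>2 + b\<^sup>2) / 2) * exp (a * b * \<rho>)))"
  proof (intro sum.cong refl arg_cong2[where f="(*)"])
    fix a b
    have "- (a\<^sup>2 + (- b)\<^sup>2 + 2 * (a * (- b) * \<rho>)) / 2 = - (a\<^sup>2 + b\<^sup>2) / 2 + a * b * \<rho>"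
      by (simp add: field_simps)
    then show "(\<integral>\<omega>. cis (a * X \<omega> + (- b) * Y \<omega>) \<partial>M) = complex_of_real (exp (- (a\<^sup>2 + b\<^sup>2) / 2) * exp (a * b * \<rho>))"
      unfolding char_pair by (simp only: exp_add)
  qed
  finally show ?thesis .
qed

end

text \<open>In the exponential series each term \<open>(a * b) ^ n\<close> has rank one, so the
  double sum becomes a squared modulus. The sum inside the norm is, up to a power of
  \<open>\<i>\<close>, the normal mean of the \<open>n\<close>-th derivative of
  \<open>trig I c\<close>, that is its Hermite coefficient.\<close>

lemma mehler_sums:
  fixes c :: "real \<Rightarrow> complex"
  assumes "finite I"
  shows "(\<lambda>n. complex_of_real (\<rho> ^ n / fact n * (norm (\<Sum>a\<in>I. c a * of_real (a ^ n * exp (- a\<^sup>2 / 2))))\<^sup>2)) sums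
    (\<Sum>a\<in>I. \<Sum>b\<in>I. c a * cnj (c b) * of_real (exp (- (a\<^sup>2 + b\<^sup>2) / 2) * exp (a * b * \<rho>)))"
proof -
  have "(\<lambda>n. \<Sum>a\<in>I. \<Sum>b\<in>I. c a * cnj (c b) * of_real (exp (- (a\<^sup>2 + b\<^sup>2) / 2) * ((a * b * \<rho>) ^ n / fact n))) sums
    (\<Sum>a\<in>I. \<Sum>b\<in>I. c a * cnj (c b) * of_real (exp (- (a\<^sup>2 + b\<^sup>2) / 2) * exp (a * b * \<rho>)))"
  proof (intro sums_sum sums_mult sums_of_real)
    fix a b
    show "(\<lambda>n. (a * b * \<rho>) ^ n / fact n) sums exp (a * b * \<rho>)"
      using exp_converges[of "a * b * \<rho>"] by (simp add: divide_inverse mult_ac)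
  qed
  moreover have "complex_of_real (\<rho> ^ n / fact n * (norm (\<Sum>a\<in>I. c a * of_real (a ^ n * exp (- a\<^sup>2 / 2))))\<^sup>2)
     = (\<Sum>a\<in>I. \<Sum>b\<in>I. c a * cnj (c b) * of_real (exp (- (a\<^sup>2 + b\<^sup>2) / 2) * ((a * b * \<rho>) ^ n / fact n)))" for n
  proof -
    have "complex_of_real (\<rho> ^ n / fact n * (norm (\<Sum>a\<in>I. c a * of_real (a ^ n * exp (- a\<^sup>2 / 2))))\<^sup>2)
      = of_real (\<rho> ^ n / fact n) * ((\<Sum>a\<in>I. c a * of_real (a ^ n * exp (- a\<^sup>2 / 2))) * cnj (\<Sum>b\<in>I. c b * of_real (b ^ n * exp (- b\<^sup>2 / 2))))"
      by (simp only: of_real_mult complex_norm_square)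
    also have "\<dots> = (\<Sum>a\<in>I. \<Sum>b\<in>I. of_real (\<rho> ^ n / fact n) * (c a * of_real (a ^ n * exp (- a\<^sup>2 / 2)) * (cnj (c b) * of_real (b ^ n * exp (- b\<^sup>2 / 2)))))"
      unfolding cnj_sum complex_cnj_mult complex_cnj_complex_of_real sum_product by (simp only: sum_distrib_left)
    also have "\<dots> = (\<Sum>a\<in>I. \<Sum>b\<in>I. c a * cnj (c b) * of_real (exp (- (a\<^sup>2 + b\<^sup>2) / 2) * ((a * b * \<rho>) ^ n / fact n)))"
    proof (intro sum.cong refl)
      fix a b :: real
      have "exp (- (a\<^sup>2 + b\<^sup>2) / 2) = exp (- a\<^sup>2 / 2) * exp (- b\<^sup>2 / 2)"
        unfolding mult_exp_exp by (rule arg_cong[where f=exp]) (simp add: field_simps)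
      then have real: "exp (- (a\<^sup>2 + b\<^sup>2) / 2) * ((a * b * \<rho>) ^ n / fact n)
          = (\<rho> ^ n / fact n) * (a ^ n * exp (- a\<^sup>2 / 2)) * (b ^ n * exp (- b\<^sup>2 / 2))"
        by (simp only: power_mult_distrib times_divide_eq_right times_divide_eq_left mult_ac)
      show "of_real (\<rho> ^ n / fact n) * (c a * of_real (a ^ n * exp (- a\<^sup>2 / 2)) * (cnj (c b) * of_real (b ^ n * exp (- b\<^sup>2 / 2))))
         = c a * cnj (c b) * of_real (exp (- (a\<^sup>2 + b\<^sup>2) / 2) * ((a * b * \<rho>) ^ n / fact n))"
        unfolding real by (simp only: of_real_mult mult_ac)
    qed
    finally show ?thesis .
  qed
  ultimately show ?thesis by (simp only:)
qed

lemma std_gaussian_pair_diag: "std_gaussian_pair std_normal_distribution (\<lambda>x. x) (\<lambda>x. x) 1"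
proof -
  interpret prob_space std_normal_distribution by (rule prob_space_std_normal)
  show ?thesis
  proof
    fix a b :: real
    have "(\<integral>x. cis (a * x + b * x) \<partial>std_normal_distribution) = (\<integral>x. cis ((a + b) * x) \<partial>std_normal_distribution)"
      by (simp add: distrib_right)
    also have "\<dots> = of_real (exp (- (a + b)\<^sup>2 / 2))" by (rule std_normal_cis)
    also have "(a + b)\<^sup>2 = a\<^sup>2 + b\<^sup>2 + 2 * (a * b * 1)" by (simp add: power2_sum)
    finally show "(\<integral>x. cis (a * x + b * x) \<partial>std_normal_distribution) = of_real (exp (- (a\<^sup>2 + b\<^sup>2 + 2 * (a * b * 1)) / 2))" .
  qed auto
qed

context std_gaussian_pair begin

text \<open>Gebelein's inequality: expand both moments by \<open>mehler_sums\<close>; since the term \<open>n = 0\<close> vanishes,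
  the series for correlation \<open>\<rho>\<close> is at most \<open>\<bar>\<rho>\<bar>\<close> times the one for correlation 1.\<close>

lemma gebelein_ctrig:
  assumes "ctrig f"
  shows "\<bar>\<integral>\<omega>. f (X \<omega>) * f (Y \<omega>) \<partial>M\<bar> \<le> \<bar>\<rho>\<bar> * (\<integral>x. (f x)\<^sup>2 \<partial>std_normal_distribution)"
proof -
  obtain I c where Ic: "finite I" "\<And>x. trig I c x = of_real (f x)"
    and cent: "(\<Sum>a\<in>I. c a * of_real (exp (- a\<^sup>2 / 2))) = 0"
    using assms unfolding ctrig_def by blast
  define d where "d n = (norm (\<Sum>a\<in>I. c a * of_real (a ^ n * exp (- a\<^sup>2 / 2))))\<^sup>2 / fact n" for n
  have d0: "d 0 = 0" using cent by (simp add: d_def)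
  have dn: "0 \<le> d n" for n by (simp add: d_def)
  interpret D: std_gaussian_pair std_normal_distribution "\<lambda>x. x" "\<lambda>x. x" 1 by (rule std_gaussian_pair_diag)
  have 1: "(\<lambda>n. \<rho> ^ n * d n) sums (\<integral>\<omega>. f (X \<omega>) * f (Y \<omega>) \<partial>M)"
    using mehler_sums[OF Ic(1), of \<rho> c] unfolding integral_ctrig_mult[OF Ic, symmetric] sums_of_real_iff
    by (simp add: d_def)
  have 2: "d sums (\<integral>x. (f x)\<^sup>2 \<partial>std_normal_distribution)"
    using mehler_sums[OF Ic(1), of 1 c] unfolding D.integral_ctrig_mult[OF Ic, symmetric] sums_of_real_iff
    by (simp add: d_def[abs_def] power2_eq_square[symmetric])
  have le: "norm (\<rho> ^ n * d n) \<le> \<bar>\<rho>\<bar> * d n" for n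
  proof (cases n)
    case (Suc k)
    have "\<bar>\<rho>\<bar> * \<bar>\<rho>\<bar> ^ k \<le> \<bar>\<rho>\<bar> * 1" using rho_le by (intro mult_left_mono power_le_one) auto
    then show ?thesis using dn[of n] by (simp add: Suc abs_mult power_abs mult_right_mono)
  qed (simp add: d0)
  have s: "summable (\<lambda>n. \<bar>\<rho>\<bar> * d n)" using 2 by (intro summable_mult) (auto simp: sums_iff)
  have "\<bar>\<Sum>n. \<rho> ^ n * d n\<bar> \<le> (\<Sum>n. \<bar>\<rho>\<bar> * d n)"
    using norm_suminf_le[OF le s] by simp
  also have "\<dots> = \<bar>\<rho>\<bar> * (\<Sum>n. d n)" using 2 by (intro suminf_mult) (auto simp: sums_iff)
  finally show ?thesis using 1 2 by (simp add: sums_iff)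
qed

lemma ctrig_limit_tendsto:
  assumes f: "\<And>m. ctrig (f m)" "\<And>m x. \<bar>f m x\<bar> \<le> K" "\<And>x. x \<noteq> u \<Longrightarrow> (\<lambda>m. f m x) \<longlonglongrightarrow> \<psi> x"
    and [measurable]: "\<psi> \<in> borel_measurable borel"
  shows "(\<lambda>m. \<integral>\<omega>. f m (X \<omega>) * f m (Y \<omega>) \<partial>M) \<longlonglongrightarrow> (\<integral>\<omega>. \<psi> (X \<omega>) * \<psi> (Y \<omega>) \<partial>M)"
proof (rule integral_dominated_convergence[where w="\<lambda>_. K * K"])
  have [measurable]: "f m \<in> borel_measurable borel" for m using f(1) by (rule ctrig_measurable)
  show "(\<lambda>\<omega>. f m (X \<omega>) * f m (Y \<omega>)) \<in> borel_measurable M" for m by measurable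
  show "(\<lambda>\<omega>. \<psi> (X \<omega>) * \<psi> (Y \<omega>)) \<in> borel_measurable M" by measurable
  show "AE \<omega> in M. (\<lambda>m. f m (X \<omega>) * f m (Y \<omega>)) \<longlonglongrightarrow> \<psi> (X \<omega>) * \<psi> (Y \<omega>)"
    using AE_X_neq[of u] AE_Y_neq[of u] by eventually_elim (intro tendsto_mult f)
  show "AE \<omega> in M. norm (f m (X \<omega>) * f m (Y \<omega>)) \<le> K * K" for m
    using f(2)[of m] order_trans[OF abs_ge_zero f(2)[of m]]
    by (intro AE_I2) (auto simp: abs_mult intro!: mult_mono)
qed simp

text \<open>Both sides are limits of the polynomial case, the right one because it is itself a joint
  moment, that of the diagonal pair.\<close>

lemma gebelein_limit:
  assumes "ctrig_limit u \<psi>"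
  shows "\<bar>\<integral>\<omega>. \<psi> (X \<omega>) * \<psi> (Y \<omega>) \<partial>M\<bar> \<le> \<bar>\<rho>\<bar> * (\<integral>x. (\<psi> x)\<^sup>2 \<partial>std_normal_distribution)"
proof -
  obtain f K where f: "\<And>m. ctrig (f m)" "\<And>m x. \<bar>f m x\<bar> \<le> K" "\<And>x. x \<noteq> u \<Longrightarrow> (\<lambda>m. f m x) \<longlonglongrightarrow> \<psi> x"
    and psi: "\<psi> \<in> borel_measurable borel"
    using assms unfolding ctrig_limit_def by blast
  interpret D: std_gaussian_pair std_normal_distribution "\<lambda>x. x" "\<lambda>x. x" 1 by (rule std_gaussian_pair_diag)
  show ?thesis
  proof (rule LIMSEQ_le)
    show "(\<lambda>m. \<bar>\<integral>\<omega>. f m (X \<omega>) * f m (Y \<omega>) \<partial>M\<bar>) \<longlonglongrightarrow> \<bar>\<integral>\<omega>. \<psi> (X \<omega>) * \<psi> (Y \<omega>) \<partial>M\<bar>"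
      by (intro tendsto_rabs ctrig_limit_tendsto[OF f psi])
    show "(\<lambda>m. \<bar>\<rho>\<bar> * (\<integral>x. (f m x)\<^sup>2 \<partial>std_normal_distribution)) \<longlonglongrightarrow> \<bar>\<rho>\<bar> * (\<integral>x. (\<psi> x)\<^sup>2 \<partial>std_normal_distribution)"
      unfolding power2_eq_square by (intro tendsto_mult tendsto_const D.ctrig_limit_tendsto[OF f psi])
    show "\<exists>N. \<forall>n\<ge>N. \<bar>\<integral>\<omega>. f n (X \<omega>) * f n (Y \<omega>) \<partial>M\<bar> \<le> \<bar>\<rho>\<bar> * (\<integral>x. (f n x)\<^sup>2 \<partial>std_normal_distribution)"
      using gebelein_ctrig[OF f(1)] by blast
  qed
qed

text \<open>A pair may be replaced by any other one with the same correlation. This serves to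
  translate the field and to pass to an explicit model with conditional laws.\<close>

lemma ctrig_limit_moment_unique:
  assumes "ctrig_limit u \<psi>" and N: "std_gaussian_pair N X' Y' \<rho>"
  shows "(\<integral>\<omega>. \<psi> (X \<omega>) * \<psi> (Y \<omega>) \<partial>M) = (\<integral>\<omega>. \<psi> (X' \<omega>) * \<psi> (Y' \<omega>) \<partial>N)"
proof -
  interpret N: std_gaussian_pair N X' Y' \<rho> by (rule N)
  obtain f K where f: "\<And>m. ctrig (f m)" "\<And>m x. \<bar>f m x\<bar> \<le> K" "\<And>x. x \<noteq> u \<Longrightarrow> (\<lambda>m. f m x) \<longlonglongrightarrow> \<psi> x"
    and psi: "\<psi> \<in> borel_measurable borel"
    using assms unfolding ctrig_limit_def by blast
  have "(\<integral>\<omega>. f m (X \<omega>) * f m (Y \<omega>) \<partial>M) = (\<integral>\<omega>. f m (X' \<omega>) * f m (Y' \<omega>) \<partial>N)" for m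
  proof -
    obtain I c where Ic: "finite I" "\<And>x. trig I c x = of_real (f m x)"
      using f(1)[of m] unfolding ctrig_def by blast
    show ?thesis
      using integral_ctrig_mult[OF Ic] unfolding N.integral_ctrig_mult[OF Ic, symmetric] of_real_eq_iff .
  qed
  with ctrig_limit_tendsto[OF f psi] N.ctrig_limit_tendsto[OF f psi] show ?thesis
    by (auto intro: LIMSEQ_unique)
qed

end

subsection \<open>Plackett's identity\<close>

lemma integral_std_normal:
  fixes f :: "real \<Rightarrow> real"
  assumes "f \<in> borel_measurable borel"
  shows "(\<integral>x. f x \<partial>std_normal_distribution) = (\<integral>x. std_normal_density x * f x \<partial>lborel)"
  using assms by (subst integral_density) auto

lemma DERIV_std_normal_tail:
  "((\<lambda>y. measure std_normal_distribution {y..}) has_real_derivative - std_normal_density y0) (at y0)"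
proof -
  interpret prob_space std_normal_distribution by (rule prob_space_std_normal)
  define Q where "Q y = measure std_normal_distribution {y..}" for y
  have cont: "continuous_on S std_normal_density" for S
    unfolding std_normal_density_def by (intro continuous_intros) auto
  \<comment> \<open>Any bounded neighbourhood of \<open>y0\<close> would do: on it \<open>G\<close>
    is an antiderivative of the density and differs from \<open>- Q\<close> by a constant.\<close>
  let ?a = "y0 - 1" and ?b = "y0 + 1"
  obtain G where G: "\<And>y. y \<in> {?a..?b} \<Longrightarrow> (G has_vector_derivative std_normal_density y) (at y within {?a..?b})"
    using antiderivative_continuous[OF cont[of "{?a..?b}"]] by blast
  have QG: "Q y = Q ?a + G ?a - G y" if y: "y \<in> {?a..?b}" for y
  proof -
    have "Q ?a - Q y = measure std_normal_distribution ({?a..} - {y..})"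
      unfolding Q_def using y by (intro finite_measure_Diff[symmetric]) auto
    also have "{?a..} - {y..} = {?a..<y}" by auto
    also have "measure std_normal_distribution {?a..<y} = (\<integral>x. indicator {?a..<y} x \<partial>std_normal_distribution)"
      by simp
    also have "\<dots> = (\<integral>x. std_normal_density x * indicator {?a..<y} x \<partial>lborel)"
      by (rule integral_std_normal) simp
    also have "\<dots> = (\<integral>x. indicator {?a..y} x *\<^sub>R std_normal_density x \<partial>lborel)"
      using AE_lborel_singleton[of y]
      by (intro integral_cong_AE) (auto elim!: eventually_mono split: split_indicator)
    also have "\<dots> = G y - G ?a"
    proof (rule integral_FTC_atLeastAtMost)
      show "(G has_vector_derivative std_normal_density x) (at x within {?a..y})" if "?a \<le> x" "x \<le> y" for x
        using y that by (intro has_vector_derivative_within_subset[OF G]) auto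
    qed (use y cont in auto)
    finally show ?thesis by simp
  qed
  have "((\<lambda>y. Q ?a + G ?a - G y) has_real_derivative - std_normal_density y0) (at y0)"
  proof -
    have "(G has_vector_derivative std_normal_density y0) (at y0 within {?a..?b})" by (rule G) auto
    then have "(G has_real_derivative std_normal_density y0) (at y0)"
      by (simp add: has_real_derivative_iff_has_vector_derivative at_within_Icc_at)
    then show ?thesis by (auto intro!: derivative_eq_intros)
  qed
  then have "(Q has_real_derivative - std_normal_density y0) (at y0)"
  proof (rule has_field_derivative_transform_within_open[where S="{?a<..<?b}"])
    show "Q ?a + G ?a - G y = Q y" if "y \<in> {?a<..<?b}" for y using QG[of y] that by simp
  qed auto
  then show ?thesis by (simp add: Q_def[abs_def])
qed

text \<open>This is the derivative in \<open>r\<close> of the conditional probability that the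
  second coordinate is at least \<open>u\<close> when the first equals \<open>x\<close>.\<close>

definition plackett_integrand :: "real \<Rightarrow> real \<Rightarrow> real \<Rightarrow> real" where
  "plackett_integrand u r x = std_normal_density ((u - r * x) / sqrt (1 - r\<^sup>2)) * (x - u * r) / sqrt (1 - r\<^sup>2) ^ 3"

lemma DERIV_conditional_tail:
  assumes "\<bar>r\<bar> < 1"
  shows "((\<lambda>r. measure std_normal_distribution {(u - r * x) / sqrt (1 - r\<^sup>2)..}) has_real_derivative
     plackett_integrand u r x) (at r)"
proof -
  define s where "s = sqrt (1 - r\<^sup>2)"
  have r2: "1 - r\<^sup>2 > 0" using assms by (simp add: abs_square_less_1)
  then have s: "s > 0" "s\<^sup>2 = 1 - r\<^sup>2" by (auto simp: s_def)
  have "((\<lambda>r. 1 - r\<^sup>2) has_real_derivative - (2 * r)) (at r)"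
    by (auto intro!: derivative_eq_intros)
  from DERIV_chain2[where f=sqrt and g="\<lambda>r. 1 - r\<^sup>2" and x=r, OF DERIV_real_sqrt[OF r2] this]
  have "((\<lambda>r. sqrt (1 - r\<^sup>2)) has_real_derivative inverse s / 2 * - (2 * r)) (at r)"
    unfolding s_def .
  moreover have "inverse s / 2 * - (2 * r) = - r / s" using s(1) by (simp add: field_simps)
  ultimately have "((\<lambda>r. sqrt (1 - r\<^sup>2)) has_real_derivative - r / s) (at r)"
    by (simp only:)
  moreover have "((\<lambda>r. u - r * x) has_real_derivative - x) (at r)"
    by (auto intro!: derivative_eq_intros)
  ultimately have quot: "((\<lambda>r. (u - r * x) / sqrt (1 - r\<^sup>2)) has_real_derivative (- x * s - (u - r * x) * (- r / s)) / (s * s)) (at r)"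
    using s(1) unfolding s_def by (intro DERIV_divide) auto
  have "(- x * s - (u - r * x) * (- r / s)) / (s * s) = (u * r - x) / s ^ 3"
  proof -
    \<comment> \<open>With \<open>q\<close> the computation avoids nested fractions; replacing
      \<open>s\<^sup>2\<close> by \<open>1 - r\<^sup>2\<close> then cancels the terms
      \<open>r\<^sup>2 * x\<close>.\<close>
    define q where "q = r / s"
    have q: "q * s = r" "- r / s = - q" using s(1) by (auto simp: q_def)
    have "(- x * s - (u - r * x) * (- q)) * s = - x * s\<^sup>2 + (u - r * x) * (q * s)"
      by (simp add: algebra_simps power2_eq_square)
    also have "\<dots> = u * r - x" unfolding q(1) s(2) by (simp add: algebra_simps power2_eq_square)
    finally have *: "(- x * s - (u - r * x) * (- q)) * s = u * r - x" .
    have "z / (s * s) = (z * s) / s ^ 3" for z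
      using s(1) by (simp add: power3_eq_cube)
    then have "(- x * s - (u - r * x) * (- q)) / (s * s) = ((- x * s - (u - r * x) * (- q)) * s) / s ^ 3" .
    then show ?thesis unfolding q(2) * .
  qed
  from DERIV_cong[OF quot this]
  have "((\<lambda>r. (u - r * x) / sqrt (1 - r\<^sup>2)) has_real_derivative (u * r - x) / s ^ 3) (at r)" .
  from DERIV_chain2[where g="\<lambda>r. (u - r * x) / sqrt (1 - r\<^sup>2)", OF DERIV_std_normal_tail this] show ?thesis
  proof (rule DERIV_cong)
    have "- f * ((a - b) / c) = f * (b - a) / c" for f a b c :: real
      by (simp add: algebra_simps diff_divide_distrib)
    then show "- std_normal_density ((u - r * x) / sqrt (1 - r\<^sup>2)) * ((u * r - x) / s ^ 3) = plackett_integrand u r x"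
      unfolding plackett_integrand_def s_def .
  qed
qed

lemma std_normal_density_le: "std_normal_density x \<le> 1"
proof -
  have "1 / sqrt (2 * pi) \<le> 1" using pi_ge_two by simp
  moreover have "exp (- x\<^sup>2 / 2) \<le> 1" by simp
  ultimately show ?thesis unfolding std_normal_density_def by (intro mult_le_one) auto
qed

text \<open>Linear growth in \<open>x\<close>, uniform for \<open>r\<close> in a compact part of the
  open unit interval, provides the dominating function for exchanging the integrals over
  \<open>r\<close> and \<open>x\<close>.\<close>

lemma plackett_integrand_bound:
  assumes "\<bar>r\<bar> \<le> m" "m < 1"
  shows "\<bar>plackett_integrand u r x\<bar> \<le> (\<bar>x\<bar> + \<bar>u\<bar>) / sqrt (1 - m\<^sup>2) ^ 3"
proof -
  have m: "0 \<le> m" using assms by linarith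
  have "m\<^sup>2 < 1" using assms m by (simp add: abs_square_less_1)
  moreover have "r\<^sup>2 \<le> m\<^sup>2" using assms m by (simp add: abs_le_square_iff[symmetric])
  ultimately have s: "0 < sqrt (1 - m\<^sup>2)" "sqrt (1 - m\<^sup>2) \<le> sqrt (1 - r\<^sup>2)" by auto
  have "\<bar>x - u * r\<bar> \<le> \<bar>x\<bar> + \<bar>u\<bar> * 1"
    using mult_left_mono[of "\<bar>r\<bar>" 1 "\<bar>u\<bar>"] assms by (intro order_trans[OF abs_triangle_ineq4] add_mono) (auto simp: abs_mult)
  then have "std_normal_density ((u - r * x) / sqrt (1 - r\<^sup>2)) * \<bar>x - u * r\<bar> \<le> 1 * (\<bar>x\<bar> + \<bar>u\<bar>)"
    by (intro mult_mono std_normal_density_le) auto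
  then have "std_normal_density ((u - r * x) / sqrt (1 - r\<^sup>2)) * \<bar>x - u * r\<bar> / sqrt (1 - r\<^sup>2) ^ 3 \<le> (\<bar>x\<bar> + \<bar>u\<bar>) / sqrt (1 - m\<^sup>2) ^ 3"
    using s by (intro frac_le) (auto intro: power_mono)
  then show ?thesis using s by (simp add: plackett_integrand_def abs_mult)
qed

text \<open>After completing the square in \<open>x\<close>, the factor \<open>x - u * r\<close> is
  a multiple of the derivative of the exponent. The integrand thus has the elementary antiderivative
  \<open>G\<close>, and the value is the boundary term at \<open>u\<close>.\<close>

lemma plackett_inner_integral:
  assumes "\<bar>r\<bar> < 1"
  shows "(\<integral>x. indicator {u..} x * plackett_integrand u r x \<partial>std_normal_distribution)
     = 1 / (2 * pi) * (1 / sqrt (1 - r\<^sup>2) * exp (- (u\<^sup>2 / (1 + r))))"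
proof -
  define s where "s = sqrt (1 - r\<^sup>2)"
  have r2: "1 - r\<^sup>2 > 0" using assms by (simp add: abs_square_less_1)
  then have s: "s > 0" "s\<^sup>2 = 1 - r\<^sup>2" by (auto simp: s_def)
  interpret prob_space std_normal_distribution by (rule prob_space_std_normal)
  define G where "G x = - (1 / (2 * pi * s)) * exp (- (u\<^sup>2 + (x - r * u)\<^sup>2 / s\<^sup>2) / 2)" for x
  define h where "h x = std_normal_density x * plackett_integrand u r x" for x
  have meas [measurable]: "plackett_integrand u r \<in> borel_measurable borel"
    unfolding plackett_integrand_def by measurable
  have G': "(G has_real_derivative h x) (at x)" for x
  proof -
    define k where "k = 1 / s\<^sup>2"
    have "((\<lambda>x. - (1 / (2 * pi * s)) * exp (- (u\<^sup>2 + (x - r * u)\<^sup>2 * k) / 2)) has_real_derivative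
        - (1 / (2 * pi * s)) * (exp (- (u\<^sup>2 + (x - r * u)\<^sup>2 * k) / 2) * (- (2 * (x - r * u) * k) / 2))) (at x)"
      using s(1) by (auto intro!: derivative_eq_intros)
    then have G1: "(G has_real_derivative - (1 / (2 * pi * s)) * (exp (- (u\<^sup>2 + (x - r * u)\<^sup>2 / s\<^sup>2) / 2) * (- (2 * (x - r * u) / s\<^sup>2) / 2))) (at x)"
      unfolding G_def[abs_def] k_def times_divide_eq_right mult_1_right .
    have "- (1 / (2 * pi * s)) * (exp (- (u\<^sup>2 + (x - r * u)\<^sup>2 / s\<^sup>2) / 2) * (- (2 * (x - r * u) / s\<^sup>2) / 2))
       = 1 / (2 * pi) * exp (- (u\<^sup>2 + (x - r * u)\<^sup>2 / s\<^sup>2) / 2) * (x - u * r) / s ^ 3"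
    proof -
      have alg: "- (1 / (2 * pi * s)) * (E * (- (2 * w / s\<^sup>2) / 2)) = 1 / (2 * pi) * E * w / s ^ 3" for E w
        using s(1) by (simp add: power2_eq_square power3_eq_cube)
      show ?thesis unfolding alg by (simp only: mult.commute[of r u])
    qed
    also have "\<dots> = h x"
    proof -
      \<comment> \<open>Both sides write the bivariate quadratic form at the point
        \<open>(x, u)\<close>, once conditioning on the first coordinate and once on the
        second.\<close>
      have "x\<^sup>2 + ((u - r * x) / s)\<^sup>2 = u\<^sup>2 + (x - r * u)\<^sup>2 / s\<^sup>2"
      proof -
        have "(x\<^sup>2 + ((u - r * x) / s)\<^sup>2) * s\<^sup>2 = x\<^sup>2 * s\<^sup>2 + (u - r * x)\<^sup>2"
          using s(1) by (simp add: field_simps)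
        also have "\<dots> = u\<^sup>2 * s\<^sup>2 + (x - r * u)\<^sup>2"
          unfolding s(2) by (simp add: power2_eq_square algebra_simps)
        also have "\<dots> = (u\<^sup>2 + (x - r * u)\<^sup>2 / s\<^sup>2) * s\<^sup>2"
          using s(1) by (simp add: field_simps)
        finally show ?thesis using s(1) by simp
      qed
      then have "- (u\<^sup>2 + (x - r * u)\<^sup>2 / s\<^sup>2) / 2 = - x\<^sup>2 / 2 + - ((u - r * x) / s)\<^sup>2 / 2"
        by (simp add: field_simps)
      then have "exp (- (u\<^sup>2 + (x - r * u)\<^sup>2 / s\<^sup>2) / 2) = exp (- x\<^sup>2 / 2) * exp (- ((u - r * x) / s)\<^sup>2 / 2)"
        by (simp only: exp_add)
      moreover have "1 / (2 * pi) = (1 / sqrt (2 * pi)) * (1 / sqrt (2 * pi))" by simp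
      moreover have "q * q * (e * e') * w / s ^ 3 = q * e * (q * e' * w / s ^ 3)" for q e e' w
        by simp
      ultimately show ?thesis
        unfolding h_def plackett_integrand_def s_def[symmetric] std_normal_density_def by (simp only:)
    qed
    finally show ?thesis by (rule DERIV_cong[OF G1])
  qed
  have h_cont: "isCont h x" for x
    unfolding h_def plackett_integrand_def std_normal_density_def s_def[symmetric]
    using s(1) by (intro continuous_intros) auto
  have int: "integrable std_normal_distribution (\<lambda>x. indicator {u..} x * plackett_integrand u r x)"
  proof (rule Bochner_Integration.integrable_bound)
    have "integrable std_normal_distribution (\<lambda>x. \<bar>x\<bar>)"
      using integrable_std_normal_moment_abs[of 1] by (subst integrable_density) auto
    then show "integrable std_normal_distribution (\<lambda>x. (\<bar>x\<bar> + \<bar>u\<bar>) / sqrt (1 - \<bar>r\<bar>\<^sup>2) ^ 3)" by simp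
    show "AE x in std_normal_distribution. norm (indicator {u..} x * plackett_integrand u r x) \<le> norm ((\<bar>x\<bar> + \<bar>u\<bar>) / sqrt (1 - \<bar>r\<bar>\<^sup>2) ^ 3)"
    proof (rule AE_I2)
      fix x
      have "norm (indicator {u..} x * plackett_integrand u r x) \<le> \<bar>plackett_integrand u r x\<bar>"
        by (simp add: abs_mult indicator_def)
      also have "\<dots> \<le> (\<bar>x\<bar> + \<bar>u\<bar>) / sqrt (1 - \<bar>r\<bar>\<^sup>2) ^ 3" by (rule plackett_integrand_bound) (use assms in auto)
      finally show "norm (indicator {u..} x * plackett_integrand u r x) \<le> norm ((\<bar>x\<bar> + \<bar>u\<bar>) / sqrt (1 - \<bar>r\<bar>\<^sup>2) ^ 3)"
        unfolding real_norm_def by (rule order_trans[OF _ abs_ge_self])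
    qed
  qed simp
  have lim1: "((\<lambda>y. \<integral>x. indicator {..y} x *\<^sub>R (indicator {u..} x * h x) \<partial>lborel) \<longlongrightarrow> (\<integral>x. indicator {u..} x * h x \<partial>lborel)) at_top"
  proof (rule tendsto_integral_at_top)
    show "integrable lborel (\<lambda>x. indicator {u..} x * h x)"
      using int by (subst (asm) integrable_density) (auto simp: h_def mult_ac)
  qed simp
  have lim2: "((\<lambda>y. \<integral>x. indicator {..y} x *\<^sub>R (indicator {u..} x * h x) \<partial>lborel) \<longlongrightarrow> 0 - G u) at_top"
  proof (rule Lim_transform_eventually)
    show "\<forall>\<^sub>F y in at_top. G y - G u = (\<integral>x. indicator {..y} x *\<^sub>R (indicator {u..} x * h x) \<partial>lborel)"
      using eventually_ge_at_top[of u]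
    proof eventually_elim
      case (elim y)
      have "(\<integral>x. indicator {..y} x *\<^sub>R (indicator {u..} x * h x) \<partial>lborel) = (\<integral>x. h x * indicator {u..y} x \<partial>lborel)"
        by (intro Bochner_Integration.integral_cong refl) (auto split: split_indicator)
      also have "\<dots> = G y - G u" by (rule integral_FTC_Icc_real[OF elim G' h_cont])
      finally show ?case by simp
    qed
    have "(G \<longlongrightarrow> 0) at_top"
      unfolding G_def using s(1) by real_asymp
    then show "((\<lambda>y. G y - G u) \<longlongrightarrow> 0 - G u) at_top" by (intro tendsto_intros)
  qed
  have "(\<integral>x. indicator {u..} x * plackett_integrand u r x \<partial>std_normal_distribution) = (\<integral>x. indicator {u..} x * h x \<partial>lborel)"
    by (subst integral_std_normal) (auto simp: h_def mult_ac)
  also have "\<dots> = 0 - G u" using lim1 lim2 by (rule tendsto_unique[rotated]) simp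
  also have "\<dots> = 1 / (2 * pi) * (1 / s * exp (- (u\<^sup>2 / (1 + r))))"
  proof -
    have r1: "1 + r > 0" "1 - r > 0" using assms by auto
    \<comment> \<open>At \<open>x = u\<close> this factorisation cancels one factor
      \<open>1 - r\<close> and collapses the exponent to
      \<open>- (u\<^sup>2 / (1 + r))\<close>.\<close>
    have s2: "s\<^sup>2 = (1 + r) * (1 - r)" unfolding s(2) by (simp add: power2_eq_square algebra_simps)
    have "(u - r * u)\<^sup>2 = u\<^sup>2 * ((1 - r) * (1 - r))" by (simp add: algebra_simps power2_eq_square)
    then have e: "(u - r * u)\<^sup>2 / s\<^sup>2 = u\<^sup>2 * (1 - r) / (1 + r)"
      unfolding s2 using r1 by simp
    have "u\<^sup>2 + u\<^sup>2 * (1 - r) / (1 + r) = 2 * (u\<^sup>2 / (1 + r))"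
      using r1 by (simp add: field_simps)
    moreover have "- (2 * w) / 2 = - w" for w :: real by simp
    ultimately have E: "- (u\<^sup>2 + (u - r * u)\<^sup>2 / s\<^sup>2) / 2 = - (u\<^sup>2 / (1 + r))"
      unfolding e by (simp only:)
    have "0 - (- (1 / (2 * pi * s)) * z) = 1 / (2 * pi) * (1 / s * z)" for z by simp
    then show ?thesis unfolding G_def E .
  qed
  finally show ?thesis unfolding s_def .
qed

section \<open>Joint tail probabilities of a bivariate normal law\<close>

lemma std_gaussian_pair_model:
  assumes "\<bar>\<rho>\<bar> < 1"
  shows "std_gaussian_pair (std_normal_distribution \<Otimes>\<^sub>M std_normal_distribution) fst
     (\<lambda>z. \<rho> * fst z + sqrt (1 - \<rho>\<^sup>2) * snd z) \<rho>"
proof -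
  interpret N: prob_space std_normal_distribution by (rule prob_space_std_normal)
  interpret P: pair_prob_space std_normal_distribution std_normal_distribution ..
  define s where "s = sqrt (1 - \<rho>\<^sup>2)"
  have s2: "s\<^sup>2 = 1 - \<rho>\<^sup>2" using assms by (simp add: s_def abs_square_less_1 less_imp_le)
  show ?thesis unfolding s_def[symmetric]
  proof
    fix a b :: real
    have "(\<integral>z. cis (a * fst z + b * (\<rho> * fst z + s * snd z)) \<partial>(std_normal_distribution \<Otimes>\<^sub>M std_normal_distribution))
      = (\<integral>x. (\<integral>y. cis (a * x + b * (\<rho> * x + s * y)) \<partial>std_normal_distribution) \<partial>std_normal_distribution)"
      by (rule Fubini_bounded_pair[OF N.finite_measure_axioms N.finite_measure_axioms, where k="\<lambda>_. 1"]) auto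
    also have "\<dots> = (\<integral>x. (\<integral>y. cis ((a + b * \<rho>) * x) * cis (b * s * y) \<partial>std_normal_distribution) \<partial>std_normal_distribution)"
      unfolding cis_mult by (simp add: algebra_simps)
    also have "\<dots> = of_real (exp (- (a + b * \<rho>)\<^sup>2 / 2)) * of_real (exp (- (b * s)\<^sup>2 / 2))"
      by (simp only: Bochner_Integration.integral_mult_right_zero Bochner_Integration.integral_mult_left_zero std_normal_cis)
    also have "\<dots> = of_real (exp (- (a + b * \<rho>)\<^sup>2 / 2 + - (b * s)\<^sup>2 / 2))"
      by (simp only: exp_add of_real_mult)
    also have "- (a + b * \<rho>)\<^sup>2 / 2 + - (b * s)\<^sup>2 / 2 = - (a\<^sup>2 + b\<^sup>2 + 2 * (a * b * \<rho>)) / 2"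
      unfolding power_mult_distrib s2 by (simp add: power2_eq_square field_simps)
    finally show "(\<integral>z. cis (a * fst z + b * (\<rho> * fst z + s * snd z)) \<partial>(std_normal_distribution \<Otimes>\<^sub>M std_normal_distribution))
      = of_real (exp (- (a\<^sup>2 + b\<^sup>2 + 2 * (a * b * \<rho>)) / 2))" .
  qed (use assms in auto)
qed

lemma borel_measurable_std_normal_tail [measurable]:
  "(\<lambda>y. measure std_normal_distribution {y..}) \<in> borel_measurable borel"
  by (intro borel_measurable_continuous_onI continuous_at_imp_continuous_on ballI DERIV_isCont[OF DERIV_std_normal_tail])

lemma finite_measure_restrict_Icc: "finite_measure (restrict_space lborel {lo..hi :: real})"
  by (rule finite_measureI) (simp add: emeasure_restrict_space space_restrict_space emeasure_lborel_Icc_eq)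

text \<open>For correlation \<open>r\<close> this is the probability that both coordinates are at
  least \<open>u\<close>, written by conditioning on the first, so that \<open>r\<close> enters only
  through a one-dimensional tail.\<close>

definition bivariate_tail :: "real \<Rightarrow> real \<Rightarrow> real" where
  "bivariate_tail u r = (\<integral>x. indicator {u..} x * measure std_normal_distribution {(u - r * x) / sqrt (1 - r\<^sup>2)..} \<partial>std_normal_distribution)"

text \<open>The fundamental theorem of calculus is applied in \<open>r\<close> for each fixed
  \<open>x\<close> and the integrals are exchanged afterwards, so \<open>bivariate_tail\<close>
  itself is never differentiated.\<close>

lemma bivariate_tail_diff:
  assumes "lo \<le> hi" "- 1 < lo" "hi < 1"
  shows "bivariate_tail u hi - bivariate_tail u lo =
     (\<integral>r. indicator {lo..hi} r * (1 / (2 * pi) * (1 / sqrt (1 - r\<^sup>2) * exp (- (u\<^sup>2 / (1 + r))))) \<partial>lborel)"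
proof -
  interpret N: prob_space std_normal_distribution by (rule prob_space_std_normal)
  define \<kappa> where "\<kappa> r x = measure std_normal_distribution {(u - r * x) / sqrt (1 - r\<^sup>2)..}" for r x
  define m where "m = max \<bar>lo\<bar> \<bar>hi\<bar>"
  have m: "m < 1" "\<And>r. r \<in> {lo..hi} \<Longrightarrow> \<bar>r\<bar> \<le> m" using assms by (auto simp: m_def)
  have r1: "\<bar>r\<bar> < 1" if "r \<in> {lo..hi}" for r using m(2)[OF that] m(1) by linarith
  have [measurable]: "\<kappa> r \<in> borel_measurable borel" for r unfolding \<kappa>_def by measurable
  have int: "integrable std_normal_distribution (\<lambda>x. indicator {u..} x * \<kappa> r x)" for r
    by (rule N.integrable_const_bound[where B=1]) (auto simp: \<kappa>_def indicator_def)
  have meas [measurable]: "(\<lambda>(r, x). plackett_integrand u r x) \<in> borel_measurable (borel \<Otimes>\<^sub>M borel)"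
    unfolding plackett_integrand_def by measurable
  have absint: "integrable std_normal_distribution (\<lambda>x. \<bar>x\<bar>)"
    using integrable_std_normal_moment_abs[of 1] by (subst integrable_density) auto
  have "bivariate_tail u hi - bivariate_tail u lo = (\<integral>x. indicator {u..} x * \<kappa> hi x - indicator {u..} x * \<kappa> lo x \<partial>std_normal_distribution)"
    unfolding bivariate_tail_def \<kappa>_def[symmetric] using int by simp
  also have "\<dots> = (\<integral>x. (\<integral>r. indicator {u..} x * plackett_integrand u r x \<partial>restrict_space lborel {lo..hi}) \<partial>std_normal_distribution)"
  proof (intro Bochner_Integration.integral_cong refl)
    fix x
    have "(\<integral>r. plackett_integrand u r x * indicator {lo..hi} r \<partial>lborel) = \<kappa> hi x - \<kappa> lo x"
    proof (rule integral_FTC_Icc_real[OF assms(1)])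
      fix r assume "lo \<le> r" "r \<le> hi"
      then have r: "\<bar>r\<bar> < 1" using r1 by simp
      show "((\<lambda>r. \<kappa> r x) has_real_derivative plackett_integrand u r x) (at r)"
        unfolding \<kappa>_def by (rule DERIV_conditional_tail[OF r])
      have "1 - r\<^sup>2 > 0" using r by (simp add: abs_square_less_1)
      then have "sqrt (1 - r\<^sup>2) \<noteq> 0" by simp
      then show "isCont (\<lambda>r. plackett_integrand u r x) r"
        unfolding plackett_integrand_def std_normal_density_def by (intro continuous_intros) auto
    qed
    then show "indicator {u..} x * \<kappa> hi x - indicator {u..} x * \<kappa> lo x
       = (\<integral>r. indicator {u..} x * plackett_integrand u r x \<partial>restrict_space lborel {lo..hi})"
      by (simp add: integral_restrict_space right_diff_distrib mult.commute[of "plackett_integrand _ _ _"])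
  qed
  also have "\<dots> = (\<integral>r. (\<integral>x. indicator {u..} x * plackett_integrand u r x \<partial>std_normal_distribution) \<partial>restrict_space lborel {lo..hi})"
  proof (rule Fubini_bounded_swap[OF finite_measure_restrict_Icc N.finite_measure_axioms, where k="\<lambda>x. (\<bar>x\<bar> + \<bar>u\<bar>) / sqrt (1 - m\<^sup>2) ^ 3"])
    have [measurable]: "(\<lambda>z. fst z) \<in> measurable (restrict_space lborel {lo..hi} \<Otimes>\<^sub>M std_normal_distribution) borel"
      by (rule measurable_compose[OF measurable_fst measurable_restrict_space1]) simp
    have "(\<lambda>z. indicator {u..} (snd z) * (\<lambda>(r, x). plackett_integrand u r x) (fst z, snd z)) \<in> borel_measurable (restrict_space lborel {lo..hi} \<Otimes>\<^sub>M std_normal_distribution)"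
      by measurable
    then show "(\<lambda>(r, x). indicator {u..} x * plackett_integrand u r x) \<in> borel_measurable (restrict_space lborel {lo..hi} \<Otimes>\<^sub>M std_normal_distribution)"
      by (simp add: case_prod_beta')
    show "integrable std_normal_distribution (\<lambda>x. (\<bar>x\<bar> + \<bar>u\<bar>) / sqrt (1 - m\<^sup>2) ^ 3)" using absint by simp
    fix r x assume "r \<in> space (restrict_space lborel {lo..hi})"
    then have r: "\<bar>r\<bar> \<le> m" using m by (simp add: space_restrict_space)
    have "norm (indicator {u..} x * plackett_integrand u r x) \<le> \<bar>plackett_integrand u r x\<bar>"
      by (simp add: abs_mult indicator_def)
    also have "\<dots> \<le> (\<bar>x\<bar> + \<bar>u\<bar>) / sqrt (1 - m\<^sup>2) ^ 3" by (rule plackett_integrand_bound[OF r m(1)])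
    finally show "norm (indicator {u..} x * plackett_integrand u r x) \<le> (\<bar>x\<bar> + \<bar>u\<bar>) / sqrt (1 - m\<^sup>2) ^ 3" .
  qed
  also have "\<dots> = (\<integral>r. 1 / (2 * pi) * (1 / sqrt (1 - r\<^sup>2) * exp (- (u\<^sup>2 / (1 + r)))) \<partial>restrict_space lborel {lo..hi})"
    by (intro Bochner_Integration.integral_cong refl plackett_inner_integral r1) (simp add: space_restrict_space)
  also have "\<dots> = (\<integral>r. indicator {lo..hi} r * (1 / (2 * pi) * (1 / sqrt (1 - r\<^sup>2) * exp (- (u\<^sup>2 / (1 + r))))) \<partial>lborel)"
    by (simp add: integral_restrict_space)
  finally show ?thesis .
qed

lemma bivariate_tail_eq_LBINT:
  assumes "\<bar>\<rho>\<bar> < 1"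
  shows "bivariate_tail u \<rho> - bivariate_tail u 0
    = 1 / (2 * pi) * (LBINT s=0..ereal \<rho>. 1 / sqrt (1 - s\<^sup>2) * exp (- (u\<^sup>2 / (1 + s))))"
proof -
  have *: "bivariate_tail u hi - bivariate_tail u lo =
     1 / (2 * pi) * (LBINT s=ereal lo..ereal hi. 1 / sqrt (1 - s\<^sup>2) * exp (- (u\<^sup>2 / (1 + s))))"
    if "lo \<le> hi" "- 1 < lo" "hi < 1" for lo hi
  proof -
    have "(\<integral>r. indicator {lo..hi} r * (1 / (2 * pi) * (1 / sqrt (1 - r\<^sup>2) * exp (- (u\<^sup>2 / (1 + r))))) \<partial>lborel)
       = (\<integral>r. 1 / (2 * pi) * (indicator {lo..hi} r *\<^sub>R (1 / sqrt (1 - r\<^sup>2) * exp (- (u\<^sup>2 / (1 + r))))) \<partial>lborel)"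
      by (intro Bochner_Integration.integral_cong refl) simp
    also have "\<dots> = 1 / (2 * pi) * (LBINT s=ereal lo..ereal hi. 1 / sqrt (1 - s\<^sup>2) * exp (- (u\<^sup>2 / (1 + s))))"
      unfolding interval_integral_Icc[OF that(1)] set_lebesgue_integral_def
      by (rule Bochner_Integration.integral_mult_right_zero)
    finally show ?thesis unfolding bivariate_tail_diff[OF that] .
  qed
  show ?thesis
  proof (cases "0 \<le> \<rho>")
    case True
    then show ?thesis using *[of 0 \<rho>] assms by (simp add: zero_ereal_def)
  next
    \<comment> \<open>For negative \<rho> the ordinary integral runs from \<rho> to 0; reversing the
      end points supplies the sign of the oriented integral.\<close>
    case False
    then show ?thesis using *[of \<rho> 0] assms unfolding zero_ereal_def
      by (subst interval_integral_endpoints_reverse) simp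
  qed
qed

text \<open>The pair is known through its characteristic function alone, so the moment is first
  moved to the product model, where conditioning on the first coordinate is Fubini's
  theorem.\<close>

lemma (in std_gaussian_pair) cov_indicator_eq_bivariate_tail:
  assumes "\<bar>\<rho>\<bar> < 1"
  shows "(\<integral>\<omega>. (indicator {u..} (X \<omega>) - measure std_normal_distribution {u..}) *
       (indicator {u..} (Y \<omega>) - measure std_normal_distribution {u..}) \<partial>M)
     = bivariate_tail u \<rho> - (measure std_normal_distribution {u..})\<^sup>2"
proof -
  define p where "p = measure std_normal_distribution {u..}"
  define s where "s = sqrt (1 - \<rho>\<^sup>2)"
  have s: "s > 0" using assms by (simp add: s_def abs_square_less_1)
  interpret N: prob_space std_normal_distribution by (rule prob_space_std_normal)
  interpret D: std_gaussian_pair "std_normal_distribution \<Otimes>\<^sub>M std_normal_distribution" fst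
     "\<lambda>z. \<rho> * fst z + s * snd z" \<rho>
    unfolding s_def by (rule std_gaussian_pair_model[OF assms])
  let ?P = "std_normal_distribution \<Otimes>\<^sub>M std_normal_distribution"
  let ?X = "\<lambda>z. indicator {u..} (fst z) :: real"
  let ?Y = "\<lambda>z. indicator {u..} (\<rho> * fst z + s * snd z) :: real"
  have "(\<integral>\<omega>. (indicator {u..} (X \<omega>) - p) * (indicator {u..} (Y \<omega>) - p) \<partial>M) = (\<integral>z. (?X z - p) * (?Y z - p) \<partial>?P)"
    using ctrig_limit_moment_unique[OF ctrig_limit_indicator D.std_gaussian_pair_axioms, of u] by (simp add: p_def)
  also have "\<dots> = (\<integral>z. ?X z * ?Y z - p * ?X z - (p * ?Y z - p * p) \<partial>?P)"
    by (intro Bochner_Integration.integral_cong refl) (simp add: algebra_simps)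
  also have "\<dots> = (\<integral>z. ?X z * ?Y z \<partial>?P) - p * (\<integral>z. ?X z \<partial>?P) - (p * (\<integral>z. ?Y z \<partial>?P) - p * p)"
  proof -
    have "integrable ?P ?X" "integrable ?P ?Y" "integrable ?P (\<lambda>z. ?X z * ?Y z)"
      by (rule D.integrable_const_bound[where B=1]; auto simp: indicator_def)+
    then show ?thesis by (simp add: D.prob_space)
  qed
  also have "(\<integral>z. ?X z \<partial>?P) = p"
  proof -
    have "(\<integral>z. ?X z \<partial>?P) = (\<integral>x. indicator {u..} x \<partial>distr ?P borel fst)" by (subst integral_distr) auto
    then show ?thesis unfolding D.distr_X by (simp add: p_def)
  qed
  also have "(\<integral>z. ?Y z \<partial>?P) = p"
  proof -
    have "(\<integral>z. ?Y z \<partial>?P) = (\<integral>x. indicator {u..} x \<partial>distr ?P borel (\<lambda>z. \<rho> * fst z + s * snd z))"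
      by (subst integral_distr) auto
    then show ?thesis unfolding D.distr_Y by (simp add: p_def)
  qed
  also have "(\<integral>z. ?X z * ?Y z \<partial>?P) = (\<integral>x. (\<integral>y. indicator {u..} x * indicator {u..} (\<rho> * x + s * y) \<partial>std_normal_distribution) \<partial>std_normal_distribution)"
    by (rule Fubini_bounded_pair[OF N.finite_measure_axioms N.finite_measure_axioms, where k="\<lambda>_. 1"])
       (auto simp: indicator_def)
  also have "\<dots> = bivariate_tail u \<rho>"
    unfolding bivariate_tail_def
  proof (intro Bochner_Integration.integral_cong refl)
    fix x
    have "indicator {u..} (\<rho> * x + s * y) = (indicator {(u - \<rho> * x) / s..} y :: real)" for y
      using s by (simp add: indicator_def field_simps)
    then show "(\<integral>y. indicator {u..} x * indicator {u..} (\<rho> * x + s * y) \<partial>std_normal_distribution)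
       = indicator {u..} x * measure std_normal_distribution {(u - \<rho> * x) / sqrt (1 - \<rho>\<^sup>2)..}"
      by (simp add: s_def[symmetric])
  qed
  finally show ?thesis unfolding p_def[symmetric] by (simp add: power2_eq_square)
qed

text \<open>At correlation 0 the conditional tail does not depend on \<open>x\<close>, so
  \<open>bivariate_tail u 0\<close> is the product of the two marginal tails subtracted in the
  covariance.\<close>

theorem (in std_gaussian_pair) plackett:
  assumes "\<bar>\<rho>\<bar> < 1"
  shows "(\<integral>\<omega>. (indicator {u..} (X \<omega>) - measure std_normal_distribution {u..}) *
       (indicator {u..} (Y \<omega>) - measure std_normal_distribution {u..}) \<partial>M)
     = 1 / (2 * pi) * (LBINT s=0..ereal \<rho>. 1 / sqrt (1 - s\<^sup>2) * exp (- (u\<^sup>2 / (1 + s))))"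
proof -
  interpret N: prob_space std_normal_distribution by (rule prob_space_std_normal)
  have "bivariate_tail u 0 = (measure std_normal_distribution {u..})\<^sup>2"
    by (simp add: bivariate_tail_def power2_eq_square)
  then show ?thesis
    using cov_indicator_eq_bivariate_tail[OF assms, of u] bivariate_tail_eq_LBINT[OF assms, of u] by simp
qed

subsection \<open>Stationary Gaussian fields\<close>

lemma normal_density_cis:
  assumes "\<sigma> > 0"
  shows "(\<integral>x. cis (b * x) \<partial>density lborel (\<lambda>x. ennreal (normal_density 0 \<sigma> x))) = of_real (exp (- (b * \<sigma>)\<^sup>2 / 2))"
proof -
  have "(\<integral>x. cis (b * x) \<partial>density lborel (\<lambda>x. ennreal (normal_density 0 \<sigma> x))) = (\<integral>x. normal_density 0 \<sigma> x *\<^sub>R cis (b * x) \<partial>lborel)"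
    by (subst integral_density) auto
  also have "\<dots> = \<bar>\<sigma>\<bar> *\<^sub>R (\<integral>x. normal_density 0 \<sigma> (0 + \<sigma> * x) *\<^sub>R cis (b * (0 + \<sigma> * x)) \<partial>lborel)"
    using assms by (intro lborel_integral_real_affine) simp
  also have "\<dots> = (\<integral>x. \<bar>\<sigma>\<bar> *\<^sub>R (normal_density 0 \<sigma> (0 + \<sigma> * x) *\<^sub>R cis (b * (0 + \<sigma> * x))) \<partial>lborel)"
    by (rule integral_scaleR_right[symmetric])
  also have "\<dots> = (\<integral>x. std_normal_density x *\<^sub>R cis (b * \<sigma> * x) \<partial>lborel)"
  proof (intro Bochner_Integration.integral_cong refl)
    fix x
    have "\<bar>\<sigma>\<bar> * normal_density 0 \<sigma> (0 + \<sigma> * x) = std_normal_density x"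
      using assms by (simp add: normal_density_def real_sqrt_mult power_mult_distrib)
    then show "\<bar>\<sigma>\<bar> *\<^sub>R (normal_density 0 \<sigma> (0 + \<sigma> * x) *\<^sub>R cis (b * (0 + \<sigma> * x))) = std_normal_density x *\<^sub>R cis (b * \<sigma> * x)"
      unfolding scaleR_scaleR by (simp add: mult.assoc)
  qed
  also have "\<dots> = (\<integral>x. cis (b * \<sigma> * x) \<partial>std_normal_distribution)"
    by (subst integral_density) auto
  finally show ?thesis unfolding std_normal_cis .
qed

lemma normal_law_cis: "0 \<le> s \<Longrightarrow> (\<integral>x. cis (b * x) \<partial>normal_law 0 s) = of_real (exp (- (b\<^sup>2 * s / 2)))"
  using normal_density_cis[of "sqrt s" b] by (auto simp: normal_law_def integral_return power_mult_distrib)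

text \<open>The parameters in \<open>gaussian_field\<close> are merely asserted to exist; these
  moments identify them as mean and variance, the Dirac case included.\<close>

lemma normal_law_moments:
  assumes "0 \<le> s"
  shows "integrable (normal_law m s) (\<lambda>x. x)" "integrable (normal_law m s) (\<lambda>x. x\<^sup>2)"
    "(\<integral>x. x \<partial>normal_law m s) = m" "(\<integral>x. (x - m)\<^sup>2 \<partial>normal_law m s) = s"
proof -
  have "integrable (normal_law m s) (\<lambda>x. x) \<and> integrable (normal_law m s) (\<lambda>x. x\<^sup>2) \<and>
    (\<integral>x. x \<partial>normal_law m s) = m \<and> (\<integral>x. (x - m)\<^sup>2 \<partial>normal_law m s) = s"
  proof (cases "s = 0")
    case True
    then show ?thesis
      by (auto simp: normal_law_def integral_return integrable_iff_bounded nn_integral_return)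
  next
    case False
    then have s: "sqrt s > 0" using assms by simp
    have [simp]: "normal_law m s = density lborel (\<lambda>x. ennreal (normal_density m (sqrt s) x))"
      using False by (simp add: normal_law_def)
    have 0: "integrable lborel (\<lambda>x. normal_density m (sqrt s) x * x)"
      "(\<integral>x. normal_density m (sqrt s) x * x \<partial>lborel) = m"
      using s by (auto intro: integrable_normal_moment_nz_1 integral_normal_moment_nz_1)
    have "has_bochner_integral lborel (\<lambda>x. normal_density m (sqrt s) x * (x - m)^(2 * 1)) (fact (2 * 1) / ((2 / (sqrt s)\<^sup>2)^1 * fact 1))"
      by (rule normal_moment_even[OF s])
    then have 2: "has_bochner_integral lborel (\<lambda>x. normal_density m (sqrt s) x * (x - m)\<^sup>2) s"
      using assms by simp
    have "(\<lambda>x. normal_density m (sqrt s) x * x\<^sup>2) = (\<lambda>x. normal_density m (sqrt s) x * (x - m)\<^sup>2 +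
        2 * m * (normal_density m (sqrt s) x * x) - m\<^sup>2 * normal_density m (sqrt s) x)"
      by (simp add: fun_eq_iff power2_eq_square algebra_simps)
    moreover have "integrable lborel (\<lambda>x. normal_density m (sqrt s) x * (x - m)\<^sup>2 +
        2 * m * (normal_density m (sqrt s) x * x) - m\<^sup>2 * normal_density m (sqrt s) x)"
      using 0 2 s by (auto simp: has_bochner_integral_iff)
    ultimately have "integrable lborel (\<lambda>x. normal_density m (sqrt s) x * x\<^sup>2)" by simp
    with 0 2 show ?thesis by (simp add: integrable_density integral_density has_bochner_integral_iff)
  qed
  then show "integrable (normal_law m s) (\<lambda>x. x)" "integrable (normal_law m s) (\<lambda>x. x\<^sup>2)"
    "(\<integral>x. x \<partial>normal_law m s) = m" "(\<integral>x. (x - m)\<^sup>2 \<partial>normal_law m s) = s" by auto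
qed

locale stationary_gaussian_field = prob_space M for M :: "'w measure" +
  fixes g :: "'w field2" and \<sigma> :: real
  assumes measurable_field: "measurable_field M g"
    and gaussian_field: "gaussian_field M g"
    and stationary: "stationary M g"
    and mean_0: "expectation (g 0) = 0"
    and \<sigma>_pos: "\<sigma> > 0"
    and variance_0: "variance (g 0) = \<sigma>\<^sup>2"
begin

definition H :: "('w \<Rightarrow> real) set" where
  "H = {h. \<exists>I a. finite I \<and> h = (\<lambda>\<omega>. \<Sum>t\<in>I. a t * g t \<omega>)}"

lemma g_measurable [measurable]: "g t \<in> borel_measurable M"
  using gaussian_field by (simp add: gaussian_field_def)

lemma H_normal_law: "h \<in> H \<Longrightarrow> \<exists>m s. s \<ge> 0 \<and> distr M borel h = normal_law m s"
  using gaussian_field unfolding gaussian_field_def H_def by blast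

lemma H_E:
  assumes "h \<in> H"
  obtains I a where "finite I" "h = (\<lambda>\<omega>. \<Sum>t\<in>I. a t * g t \<omega>)"
proof -
  from assms have "\<exists>I a. finite I \<and> h = (\<lambda>\<omega>. \<Sum>t\<in>I. a t * g t \<omega>)" by (simp only: H_def mem_Collect_eq)
  then show thesis by (elim exE conjE) (rule that)
qed

lemma H_I: "finite I \<Longrightarrow> (\<lambda>\<omega>. \<Sum>t\<in>I. a t * g t \<omega>) \<in> H"
  unfolding H_def mem_Collect_eq by (rule exI[of _ I], rule exI[of _ a]) simp

lemma H_measurable: "h \<in> H \<Longrightarrow> h \<in> borel_measurable M"
  by (elim H_E) (simp only:, intro borel_measurable_sum borel_measurable_times borel_measurable_const g_measurable)

text \<open>Zero mean is a hypothesis at this stage because the means of the \<open>g t\<close> are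
  obtained afterwards, from stationarity and integrability.\<close>

lemma H_moments:
  assumes h: "h \<in> H" and E: "expectation h = 0"
  shows "integrable M (\<lambda>\<omega>. (h \<omega>)\<^sup>2)" "(\<integral>\<omega>. cis (h \<omega>) \<partial>M) = of_real (exp (- (\<integral>\<omega>. (h \<omega>)\<^sup>2 \<partial>M) / 2))"
proof -
  have [measurable]: "h \<in> borel_measurable M" using H_measurable[OF h] .
  obtain m s where s: "s \<ge> 0" "distr M borel h = normal_law m s" using H_normal_law[OF h] by blast
  note mom = normal_law_moments[OF s(1), of m, unfolded s(2)[symmetric]]
  have "m = 0" using mom(3) E by (simp add: integral_distr)
  moreover have "(\<integral>\<omega>. (h \<omega> - m)\<^sup>2 \<partial>M) = s" using mom(4) by (simp add: integral_distr)
  ultimately have "(\<integral>\<omega>. (h \<omega>)\<^sup>2 \<partial>M) = s" by simp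
  moreover have "(\<integral>\<omega>. cis (h \<omega>) \<partial>M) = (\<integral>x. cis x \<partial>distr M borel h)" by (simp add: integral_distr)
  ultimately show "(\<integral>\<omega>. cis (h \<omega>) \<partial>M) = of_real (exp (- (\<integral>\<omega>. (h \<omega>)\<^sup>2 \<partial>M) / 2))"
    unfolding s(2) \<open>m = 0\<close> using normal_law_cis[OF s(1), of 1] by simp
  show "integrable M (\<lambda>\<omega>. (h \<omega>)\<^sup>2)" using mom(2) by (simp add: integrable_distr_eq)
qed

lemma g_in_H: "g t \<in> H"
  using H_I[of "{t}" "\<lambda>_. 1"] by simp

lemma g_integrable: "integrable M (g t)"
proof -
  obtain m s where s: "s \<ge> 0" "distr M borel (g t) = normal_law m s" using H_normal_law[OF g_in_H] by blast
  show ?thesis using normal_law_moments(1)[OF s(1), of m] unfolding s(2)[symmetric] by (simp add: integrable_distr_eq)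
qed

lemma stationary_integral:
  fixes f :: "(real^2 \<Rightarrow> real) \<Rightarrow> real"
  assumes "finite I" and [measurable]: "f \<in> borel_measurable (\<Pi>\<^sub>M t\<in>I. borel)"
  shows "(\<integral>\<omega>. f (\<lambda>t\<in>I. g (t + s) \<omega>) \<partial>M) = (\<integral>\<omega>. f (\<lambda>t\<in>I. g t \<omega>) \<partial>M)"
proof -
  have m: "(\<lambda>\<omega>. \<lambda>t\<in>I. g (t + s) \<omega>) \<in> measurable M (\<Pi>\<^sub>M t\<in>I. borel)" for s
    by (rule measurable_restrict) simp
  have "distr M (\<Pi>\<^sub>M t\<in>I. borel) (\<lambda>\<omega>. \<lambda>t\<in>I. g (t + s) \<omega>) = distr M (\<Pi>\<^sub>M t\<in>I. borel) (\<lambda>\<omega>. \<lambda>t\<in>I. g t \<omega>)"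
    using stationary assms(1) by (simp add: stationary_def fidi_def)
  then have "(\<integral>x. f x \<partial>distr M (\<Pi>\<^sub>M t\<in>I. borel) (\<lambda>\<omega>. \<lambda>t\<in>I. g (t + s) \<omega>)) = (\<integral>x. f x \<partial>distr M (\<Pi>\<^sub>M t\<in>I. borel) (\<lambda>\<omega>. \<lambda>t\<in>I. g t \<omega>))"
    by simp
  then show ?thesis using m[of s] m[of 0] by (simp add: integral_distr)
qed

lemma g_mean: "expectation (g t) = 0"
  using stationary_integral[of "{0}" "\<lambda>x. x 0" t] mean_0 by simp

lemma H_mean: "h \<in> H \<Longrightarrow> expectation h = 0"
  using g_integrable g_mean by (elim H_E) simp

sublocale gaussian_space M H
proof
  fix h k :: "'w \<Rightarrow> real" and a :: real
  assume h: "h \<in> H"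
  show "h \<in> borel_measurable M" by (rule H_measurable[OF h])
  show "integrable M (\<lambda>\<omega>. (h \<omega>)\<^sup>2)" "(\<integral>\<omega>. cis (h \<omega>) \<partial>M) = of_real (exp (- (\<integral>\<omega>. (h \<omega>)\<^sup>2 \<partial>M) / 2))"
    by (rule H_moments[OF h H_mean[OF h]])+
  obtain I c where I: "finite I" "h = (\<lambda>\<omega>. \<Sum>t\<in>I. c t * g t \<omega>)" using h by (rule H_E)
  show "(\<lambda>\<omega>. a * h \<omega>) \<in> H"
    using H_I[OF I(1), of "\<lambda>t. a * c t"] unfolding I(2) sum_distrib_left mult.assoc .
  assume k: "k \<in> H"
  obtain J d where J: "finite J" "k = (\<lambda>\<omega>. \<Sum>t\<in>J. d t * g t \<omega>)" using k by (rule H_E)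
  have "(\<Sum>t\<in>I. c t * g t \<omega>) = (\<Sum>t\<in>I \<union> J. (if t \<in> I then c t else 0) * g t \<omega>)"
    "(\<Sum>t\<in>J. d t * g t \<omega>) = (\<Sum>t\<in>I \<union> J. (if t \<in> J then d t else 0) * g t \<omega>)" for \<omega>
    using I(1) J(1) by (intro sum.mono_neutral_cong_left; auto)+
  then have "(\<lambda>\<omega>. h \<omega> + k \<omega>) = (\<lambda>\<omega>. \<Sum>t\<in>I \<union> J. ((if t \<in> I then c t else 0) + (if t \<in> J then d t else 0)) * g t \<omega>)"
    unfolding I(2) J(2) by (simp only: distrib_right sum.distrib)
  then show "(\<lambda>\<omega>. h \<omega> + k \<omega>) \<in> H"
    by (simp only:) (rule H_I, use I(1) J(1) in simp)
qed

lemma cov_g: "cov (g s) (g t) = field_cov M g (t - s)"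
proof -
  have "(\<integral>\<omega>. g (0 + s) \<omega> * g (t - s + s) \<omega> \<partial>M) = (\<integral>\<omega>. g 0 \<omega> * g (t - s) \<omega> \<partial>M)"
    using stationary_integral[of "{0, t - s}" "\<lambda>x. x 0 * x (t - s)" s] by simp
  then show ?thesis by (simp add: cov_def field_cov_def covariance_def g_mean)
qed

lemma field_cov_0: "field_cov M g 0 = \<sigma>\<^sup>2"
  using variance_0 by (simp add: field_cov_def covariance_def mean_0 power2_eq_square)

definition gn :: "real^2 \<Rightarrow> 'w \<Rightarrow> real" where
  "gn t \<omega> = (1 / \<sigma>) * g t \<omega>"

definition rho :: "real^2 \<Rightarrow> real" where
  "rho t = field_cov M g t / \<sigma>\<^sup>2"

lemma gn_in_H: "gn t \<in> H"
  unfolding gn_def[abs_def] by (intro H_scale g_in_H)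

lemma cov_gn: "cov (gn s) (gn t) = rho (t - s)"
  unfolding gn_def[abs_def] cov_scale_left cov_scale_right cov_g rho_def by (simp add: power2_eq_square)

lemma rho_0: "rho 0 = 1"
  using \<sigma>_pos by (simp add: rho_def field_cov_0)

lemma abs_rho_le_1: "\<bar>rho t\<bar> \<le> 1"
  using abs_cov_le[OF gn_in_H gn_in_H, of 0 t] cov_gn[of 0 t] cov_gn[of 0 0] cov_gn[of t t] by (simp add: rho_0)

lemma gn_pair: "std_gaussian_pair M (gn s) (gn t) (rho (t - s))"
proof
  fix a b :: real
  have "(\<integral>\<omega>. cis (a * gn s \<omega> + b * gn t \<omega>) \<partial>M) = of_real (exp (- (cov (\<lambda>\<omega>. a * gn s \<omega>) (\<lambda>\<omega>. a * gn s \<omega>) + cov (\<lambda>\<omega>. b * gn t \<omega>) (\<lambda>\<omega>. b * gn t \<omega>) + 2 * cov (\<lambda>\<omega>. a * gn s \<omega>) (\<lambda>\<omega>. b * gn t \<omega>)) / 2))"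
    by (intro char_H_add H_scale gn_in_H)
  then show "(\<integral>\<omega>. cis (a * gn s \<omega> + b * gn t \<omega>) \<partial>M) = of_real (exp (- (a\<^sup>2 + b\<^sup>2 + 2 * (a * b * rho (t - s))) / 2))"
    unfolding cov_scale_left cov_scale_right cov_gn by (simp add: rho_0 power2_eq_square mult.assoc)
qed (auto intro: H_measurable gn_in_H abs_rho_le_1)

end

section \<open>Integrability of a decaying covariance in the plane\<close>

lemma nn_integral_norm_powr_finite:
  assumes "\<alpha> > 2"
  shows "(\<integral>\<^sup>+t. indicator {t. 1 \<le> norm t} t * ennreal (norm (t :: real^2) powr - \<alpha>) \<partial>lborel) < \<infinity>"
proof -
  \<comment> \<open>On the shell \<open>2 ^ k \<le> norm t < 2 ^ Suc k\<close> the power is at most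
    \<open>a k\<close>, while the enclosing ball has area of order \<open>4 ^ k\<close>. The
    products form a geometric series with ratio \<open>2 powr (2 - \<alpha>)\<close>, below
    1.\<close>
  define a where "a k = 2 powr - (\<alpha> * real k)" for k :: nat
  have single_le: "f k \<le> (\<Sum>k. f k)" for f :: "nat \<Rightarrow> ennreal" and k
    using sum_le_suminf[of f "{k}"] by simp
  have "(\<integral>\<^sup>+t. indicator {t. 1 \<le> norm t} t * ennreal (norm (t :: real^2) powr - \<alpha>) \<partial>lborel)
     \<le> (\<integral>\<^sup>+t. (\<Sum>k. ennreal (a k) * indicator (cball 0 (2 ^ Suc k)) (t :: real^2)) \<partial>lborel)"
  proof (rule nn_integral_mono)
    fix t :: "real^2"
    show "indicator {t. 1 \<le> norm t} t * ennreal (norm t powr - \<alpha>) \<le> (\<Sum>k. ennreal (a k) * indicator (cball 0 (2 ^ Suc k)) t)"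
    proof (cases "1 \<le> norm t")
      case True
      \<comment> \<open>The least exponent is positive because \<open>1 \<le> norm t\<close>, and
        its predecessor \<open>k\<close> is the index of the shell containing
        \<open>t\<close>.\<close>
      define n where "n = (LEAST n. norm t < 2 ^ n)"
      obtain n0 where "norm t < 2 ^ n0" using real_arch_pow[of 2 "norm t"] by auto
      then have n: "norm t < 2 ^ n" unfolding n_def by (rule LeastI)
      have "n \<noteq> 0" using n True by (cases n) auto
      then obtain k where k: "n = Suc k" by (cases n) auto
      have "\<not> norm t < 2 ^ k" using not_less_Least[of k "\<lambda>n. norm t < 2 ^ n"] unfolding n_def[symmetric] k by simp
      then have "2 powr real k \<le> norm t" by (simp add: powr_realpow)
      then have "norm t powr - \<alpha> \<le> (2 powr real k) powr - \<alpha>" using assms by (intro powr_mono2') auto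
      also have "\<dots> = a k" unfolding a_def powr_powr by (simp add: mult.commute)
      finally have "indicator {t. 1 \<le> norm t} t * ennreal (norm t powr - \<alpha>) \<le> ennreal (a k) * indicator (cball 0 (2 ^ Suc k)) t"
        using True n k by (auto simp: indicator_def ennreal_leI)
      also have "\<dots> \<le> (\<Sum>k. ennreal (a k) * indicator (cball 0 (2 ^ Suc k)) t)"
        by (rule single_le)
      finally show ?thesis .
    qed simp
  qed
  also have "\<dots> = (\<Sum>k. \<integral>\<^sup>+t. ennreal (a k) * indicator (cball 0 (2 ^ Suc k)) (t :: real^2) \<partial>lborel)"
    by (rule nn_integral_suminf) (intro borel_measurable_times_ennreal borel_measurable_const borel_measurable_indicator, simp)
  also have "\<dots> = (\<Sum>k. ennreal (4 * unit_ball_vol 2 * (2 powr (2 - \<alpha>)) ^ k))"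
  proof (rule suminf_cong)
    fix k
    have "(\<integral>\<^sup>+t. ennreal (a k) * indicator (cball 0 (2 ^ Suc k)) (t :: real^2) \<partial>lborel) = ennreal (a k) * emeasure lborel (cball (0 :: real^2) (2 ^ Suc k))"
      by (rule nn_integral_cmult_indicator) simp
    also have "\<dots> = ennreal (a k) * ennreal (unit_ball_vol 2 * (2 ^ Suc k) ^ 2)"
      by (subst emeasure_cball) auto
    also have "\<dots> = ennreal (a k * (unit_ball_vol 2 * (2 ^ Suc k) ^ 2))"
      by (simp add: ennreal_mult' a_def)
    also have "a k * (unit_ball_vol 2 * (2 ^ Suc k) ^ 2) = 4 * unit_ball_vol 2 * (2 powr (2 - \<alpha>)) ^ k"
    proof -
      have "(2 powr (2 - \<alpha>)) ^ k = 2 powr ((2 - \<alpha>) * real k)" by (simp add: powr_power mult.commute)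
      also have "(2 - \<alpha>) * real k = - (\<alpha> * real k) + real (2 * k)" by (simp add: algebra_simps)
      also have "2 powr \<dots> = a k * 2 ^ (2 * k)"
        unfolding powr_add a_def by (simp only: powr_realpow zero_less_numeral)
      finally show ?thesis by (simp add: power_mult_distrib power_mult[symmetric] mult.commute[of k])
    qed
    finally show "(\<integral>\<^sup>+t. ennreal (a k) * indicator (cball 0 (2 ^ Suc k)) (t :: real^2) \<partial>lborel)
       = ennreal (4 * unit_ball_vol 2 * (2 powr (2 - \<alpha>)) ^ k)" .
  qed
  also have "\<dots> < \<infinity>"
  proof -
    have "2 powr (2 - \<alpha>) < 2 powr 0" using assms by (intro powr_less_mono) auto
    then have "summable (\<lambda>k. 4 * unit_ball_vol 2 * (2 powr (2 - \<alpha>)) ^ k)"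
      by (intro summable_mult summable_geometric) simp
    then show ?thesis using ennreal_suminf_neq_top by (simp add: less_top[symmetric])
  qed
  finally show ?thesis .
qed

lemma integrable_decay:
  fixes f :: "real^2 \<Rightarrow> real"
  assumes "\<alpha> > 2" and [measurable]: "f \<in> borel_measurable borel" and K: "\<And>t. \<bar>f t\<bar> \<le> K"
    and b: "\<And>t. b \<le> norm t \<Longrightarrow> \<bar>f t\<bar> \<le> C * norm t powr - \<alpha>"
  shows "integrable lborel f"
proof (rule integrableI_bounded)
  \<comment> \<open>Outside this radius both the decay estimate and the convergence of the power
    integral are available; inside, the bound \<open>K\<close> suffices.\<close>
  define B where "B = max 1 b"
  have "(\<integral>\<^sup>+t. ennreal (norm (f t)) \<partial>lborel) \<le>
    (\<integral>\<^sup>+t. ennreal K * indicator (cball 0 B) t + ennreal \<bar>C\<bar> * (indicator {t. 1 \<le> norm t} t * ennreal (norm (t :: real^2) powr - \<alpha>)) \<partial>lborel)"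
  proof (rule nn_integral_mono)
    fix t :: "real^2"
    show "ennreal (norm (f t)) \<le> ennreal K * indicator (cball 0 B) t + ennreal \<bar>C\<bar> * (indicator {t. 1 \<le> norm t} t * ennreal (norm t powr - \<alpha>))"
    proof (cases "norm t \<le> B")
      case True
      then have "ennreal (norm (f t)) \<le> ennreal K * indicator (cball 0 B) t + 0"
        using K[of t] by (simp add: ennreal_leI)
      also have "\<dots> \<le> ennreal K * indicator (cball 0 B) t + ennreal \<bar>C\<bar> * (indicator {t. 1 \<le> norm t} t * ennreal (norm t powr - \<alpha>))"
        by (intro add_left_mono) simp
      finally show ?thesis .
    next
      case False
      then have t: "1 \<le> norm t" "b \<le> norm t" by (auto simp: B_def)
      have "norm (f t) \<le> C * norm t powr - \<alpha>" using b[OF t(2)] by simp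
      also have "\<dots> \<le> \<bar>C\<bar> * norm t powr - \<alpha>" by (intro mult_right_mono) auto
      finally have "norm (f t) \<le> \<bar>C\<bar> * norm t powr - \<alpha>" .
      then show ?thesis using False t by (simp add: ennreal_mult'[symmetric] ennreal_leI)
    qed
  qed
  also have "\<dots> = ennreal K * emeasure lborel (cball (0 :: real^2) B) + ennreal \<bar>C\<bar> *
      (\<integral>\<^sup>+t. indicator {t. 1 \<le> norm t} t * ennreal (norm (t :: real^2) powr - \<alpha>) \<partial>lborel)"
  proof -
    have [measurable]: "cball (0 :: real^2) B \<in> sets borel" by simp
    show ?thesis by (subst nn_integral_add) (auto simp: nn_integral_cmult nn_integral_cmult_indicator)
  qed
  also have "\<dots> < \<infinity>"
    using nn_integral_norm_powr_finite[OF assms(1)] emeasure_lborel_cball_finite[of "0 :: real^2" B]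
    by (auto simp: ennreal_mult_less_top)
  finally show "(\<integral>\<^sup>+t. ennreal (norm (f t)) \<partial>lborel) < \<infinity>" .
qed simp

lemma bigo_norm_powrE:
  fixes f :: "real^2 \<Rightarrow> real"
  assumes "f \<in> O[at_infinity](\<lambda>t. norm t powr - \<alpha>)"
  obtains C b where "\<And>t. b \<le> norm t \<Longrightarrow> \<bar>f t\<bar> \<le> C * norm t powr - \<alpha>"
proof -
  obtain C where "\<forall>\<^sub>F t in at_infinity. norm (f t) \<le> C * norm (norm t powr - \<alpha>)"
    using assms by (rule landau_o.bigE)
  then show thesis using that by (auto simp: eventually_at_infinity)
qed

section \<open>Geometry of the windows and their rescaling\<close>

lemma rectangle_facts:
  assumes "bounded_rectangle T"
  shows "T \<in> sets borel" "bounded T" "convex T"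
proof -
  obtain Q I J where Q: "rotation_matrix Q" and I: "is_interval I" "bounded I" and J: "is_interval J" "bounded J"
    and T: "T = (\<lambda>t. Q *v t) ` {t :: real^2. t $ 1 \<in> I \<and> t $ 2 \<in> J}"
    using assms unfolding bounded_rectangle_def by blast
  have orth: "transpose Q ** Q = mat 1" "Q ** transpose Q = mat 1"
    using Q by (auto simp: rotation_matrix_def orthogonal_matrix_def)
  let ?S = "{t :: real^2. t $ 1 \<in> I \<and> t $ 2 \<in> J}"
  have lin: "linear (\<lambda>t. Q *v t)" by (rule matrix_vector_mul_linear)
  \<comment> \<open>The transpose inverts the rotation, so the image \<open>T\<close> is also a
    preimage under a continuous map, which yields Borel measurability.\<close>
  have T': "T = {x. (transpose Q *v x) $ 1 \<in> I \<and> (transpose Q *v x) $ 2 \<in> J}"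
  proof (intro set_eqI iffI)
    fix x assume "x \<in> T"
    then obtain t where "x = Q *v t" "t $ 1 \<in> I" "t $ 2 \<in> J" using T by blast
    moreover have "transpose Q *v (Q *v t) = t"
      by (simp only: matrix_vector_mul_assoc orth matrix_vector_mul_lid)
    ultimately show "x \<in> {x. (transpose Q *v x) $ 1 \<in> I \<and> (transpose Q *v x) $ 2 \<in> J}"
      by (simp only: mem_Collect_eq)
  next
    fix x assume "x \<in> {x. (transpose Q *v x) $ 1 \<in> I \<and> (transpose Q *v x) $ 2 \<in> J}"
    moreover have "x = Q *v (transpose Q *v x)"
      by (simp only: matrix_vector_mul_assoc orth matrix_vector_mul_lid)
    ultimately show "x \<in> T" unfolding T by blast
  qed
  have [measurable]: "I \<in> sets borel" "J \<in> sets borel"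
    using I J real_interval_borel_measurable by auto
  have cont: "continuous_on UNIV (\<lambda>x. (transpose Q *v x) $ i)" for i
    by (intro continuous_intros matrix_vector_mult_linear_continuous_on)
  have [measurable]: "(\<lambda>x. (transpose Q *v x) $ i) \<in> borel_measurable borel" for i
    by (rule borel_measurable_continuous_onI[OF cont])
  show "T \<in> sets borel" unfolding T' by measurable
  have S_conv: "convex ?S"
  proof -
    have "?S = (\<lambda>t. t $ 1) -` I \<inter> (\<lambda>t. t $ 2) -` J" by auto
    moreover have "convex ((\<lambda>t :: real^2. t $ i) -` K)" if "is_interval K" for i K
      using is_interval_convex[OF that] by (intro convex_linear_vimage bounded_linear.linear bounded_linear_vec_nth)
    ultimately show ?thesis using I J by (simp add: convex_Int)
  qed
  show "convex T" unfolding T by (rule convex_linear_image[OF lin S_conv])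
  have "bounded ?S"
  proof -
    obtain a b where ab: "\<And>x. x \<in> I \<Longrightarrow> \<bar>x\<bar> \<le> a" "\<And>x. x \<in> J \<Longrightarrow> \<bar>x\<bar> \<le> b"
      using I(2) J(2) by (auto simp: bounded_real)
    have "norm t \<le> a + b" if "t \<in> ?S" for t
    proof -
      have "norm t \<le> (\<Sum>i\<in>UNIV. \<bar>t $ i\<bar>)" by (rule norm_le_l1_cart)
      also have "\<dots> = \<bar>t $ 1\<bar> + \<bar>t $ 2\<bar>" by (simp add: sum_2)
      also have "\<dots> \<le> a + b" using that ab by (intro add_mono) auto
      finally show ?thesis .
    qed
    then show ?thesis by (auto simp: bounded_iff)
  qed
  then show "bounded T" unfolding T by (rule bounded_linear_image) (rule matrix_vector_mul_bounded_linear)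
qed

lemma convex_frontier_null: "convex (T :: (real^2) set) \<Longrightarrow> AE t in lborel. t \<notin> frontier T"
proof -
  assume "convex T"
  then have "negligible (frontier T)" by (rule negligible_convex_frontier)
  then have "frontier T \<in> null_sets (completion lborel)" by (simp add: negligible_iff_null_sets)
  then have "frontier T \<in> null_sets lborel"
    using null_sets_completion_iff[of "frontier T" lborel] by (simp add: borel_closed)
  then show ?thesis by (rule AE_not_in)
qed

lemma area_pos:
  fixes T :: "(real^2) set"
  assumes "bounded T" "T \<in> sets borel" "interior T \<noteq> {}"
  shows "0 < area T"
proof -
  obtain x e where "e > 0" "ball x e \<subseteq> T"
    using assms(3) by (metis ex_in_conv mem_interior)
  have fin: "emeasure lborel T < \<infinity>" using assms(1) by (rule emeasure_bounded_finite)
  have "0 < measure lborel (ball x e)" using \<open>e > 0\<close> by (simp add: content_ball)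
  also have "\<dots> \<le> measure lborel T"
    by (rule measure_mono_fmeasurable[OF \<open>ball x e \<subseteq> T\<close>]) (use assms(2) fin in \<open>auto simp: fmeasurable_def\<close>)
  finally show ?thesis .
qed

lemma lborel_integral_affine:
  fixes f :: "real^2 \<Rightarrow> 'b::{banach, second_countable_topology}"
  assumes "c \<noteq> 0" and [measurable]: "f \<in> borel_measurable borel"
  shows "(\<integral>x. f x \<partial>lborel) = c\<^sup>2 *\<^sub>R (\<integral>x. f (t + c *\<^sub>R x) \<partial>lborel)"
proof -
  have "(\<integral>x. f x \<partial>lborel) = (\<integral>x. f x \<partial>density (distr lborel borel (\<lambda>x. t + c *\<^sub>R x)) (\<lambda>_. ennreal (\<bar>c\<bar> ^ DIM(real^2))))"
    using lborel_affine[OF assms(1), of t] by simp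
  also have "\<dots> = c\<^sup>2 *\<^sub>R (\<integral>x. f (t + c *\<^sub>R x) \<partial>lborel)"
    by (subst integral_density) (auto simp: integral_distr)
  finally show ?thesis .
qed

text \<open>Rescaling \<open>T\<close> to size \<open>n\<close> turns the normalised double integral of \<open>c (s - t)\<close> into an integral
  over \<open>T\<close> in which the shift by \<open>x\<close> is shrunk to \<open>x / n\<close>; dominated convergence applies off the
  frontier of \<open>T\<close>.\<close>

lemma scaled_set_average:
  fixes c :: "real^2 \<Rightarrow> real" and T :: "(real^2) set"
  assumes c: "integrable lborel c" and T: "T \<in> sets borel" "bounded T" "convex T" "0 < area T"
  shows "(\<lambda>n. (1 / (real n ^ 2 * area T)) *
      (\<integral>t. indicator ((*\<^sub>R) (real n) ` T) t * (\<integral>s. indicator ((*\<^sub>R) (real n) ` T) s * c (s - t) \<partial>lborel) \<partial>lborel))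
      \<longlonglongrightarrow> (\<integral>x. c x \<partial>lborel)"
proof -
  note T(1)[measurable] borel_measurable_integrable[OF c, measurable]
  have fin: "emeasure lborel T < \<infinity>" using T(2) by (rule emeasure_bounded_finite)
  define q where "q n t = (\<integral>x. indicator T (t + (1 / real n) *\<^sub>R x) * c x \<partial>lborel)" for n :: nat and t
  have q_meas: "q n \<in> borel_measurable borel" for n
    unfolding q_def by measurable
  define C where "C = (\<integral>x. norm (c x) \<partial>lborel)"
  have q_le: "norm (q n t) \<le> C" for n t
    unfolding q_def C_def by (rule norm_integral_le) (use c in \<open>auto simp: indicator_def\<close>)
  have q_lim: "(\<lambda>n. q n t) \<longlonglongrightarrow> (\<integral>x. c x \<partial>lborel)" if t: "t \<in> interior T" for t
    unfolding q_def
  proof (rule integral_dominated_convergence[where w="\<lambda>x. norm (c x)"])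
    show "AE x in lborel. (\<lambda>n. indicator T (t + (1 / real n) *\<^sub>R x) * c x) \<longlonglongrightarrow> c x"
    proof (rule AE_I2)
      fix x
      have "(\<lambda>n. t + (1 / real n) *\<^sub>R x) \<longlonglongrightarrow> t + 0 *\<^sub>R x"
        by (intro tendsto_intros lim_1_over_n)
      then have "\<forall>\<^sub>F n in sequentially. t + (1 / real n) *\<^sub>R x \<in> interior T"
        using t by (intro topological_tendstoD) auto
      then have "\<forall>\<^sub>F n in sequentially. indicator T (t + (1 / real n) *\<^sub>R x) * c x = c x"
        by eventually_elim (use interior_subset in \<open>auto simp: indicator_def\<close>)
      then show "(\<lambda>n. indicator T (t + (1 / real n) *\<^sub>R x) * c x) \<longlonglongrightarrow> c x"
        by (rule tendsto_eventually)
    qed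
  qed (use c in \<open>auto simp: indicator_def\<close>)
  have lim: "(\<lambda>n. \<integral>t. indicator T t * q n t \<partial>lborel) \<longlonglongrightarrow> (\<integral>t. indicator T t * (\<integral>x. c x \<partial>lborel) \<partial>lborel)"
  proof (rule integral_dominated_convergence[where w="\<lambda>t. indicator T t * C"])
    show "AE t in lborel. (\<lambda>n. indicator T t * q n t) \<longlonglongrightarrow> indicator T t * (\<integral>x. c x \<partial>lborel)"
      using convex_frontier_null[OF T(3)]
    proof eventually_elim
      case (elim t)
      then consider "t \<in> interior T" | "t \<notin> T"
        using closure_subset by (auto simp: frontier_def)
      then show ?case
      proof cases
        case 1
        then show ?thesis by (intro tendsto_mult tendsto_const q_lim)
      qed simp
    qed
    show "integrable lborel (\<lambda>t. indicator T t * C)" using fin by simp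
    show "AE t in lborel. norm (indicator T t * q n t) \<le> indicator T t * C" for n
      using q_le by (auto simp: indicator_def)
    show "(\<lambda>t. indicator T t * q n t) \<in> borel_measurable lborel" for n using q_meas[of n] by measurable
  qed measurable
  have "(\<integral>t. indicator T t * (\<integral>x. c x \<partial>lborel) \<partial>lborel) = area T * (\<integral>x. c x \<partial>lborel)" by simp
  with lim have lim': "(\<lambda>n. (1 / area T) * (\<integral>t. indicator T t * q n t \<partial>lborel)) \<longlonglongrightarrow> (1 / area T) * (area T * (\<integral>x. c x \<partial>lborel))"
    by (intro tendsto_mult tendsto_const) simp
  have eq: "(1 / (real n ^ 2 * area T)) *
      (\<integral>t. indicator ((*\<^sub>R) (real n) ` T) t * (\<integral>s. indicator ((*\<^sub>R) (real n) ` T) s * c (s - t) \<partial>lborel) \<partial>lborel)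
    = (1 / area T) * (\<integral>t. indicator T t * q n t \<partial>lborel)" if n: "n \<ge> 1" for n :: nat
  proof -
    have ind: "indicator ((*\<^sub>R) (real n) ` T) t = (indicator T ((1 / real n) *\<^sub>R t) :: real)" for t
    proof -
      have "t \<in> (*\<^sub>R) (real n) ` T \<longleftrightarrow> (1 / real n) *\<^sub>R t \<in> T"
      proof
        assume "(1 / real n) *\<^sub>R t \<in> T"
        moreover have "t = real n *\<^sub>R ((1 / real n) *\<^sub>R t)" using n by simp
        ultimately show "t \<in> (*\<^sub>R) (real n) ` T" by (rule rev_image_eqI)
      qed (use n in auto)
      then show ?thesis by (simp add: indicator_def)
    qed
    have inner: "(\<integral>s. indicator T ((1 / real n) *\<^sub>R s) * c (s - t) \<partial>lborel) = q n ((1 / real n) *\<^sub>R t)" for t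
      using lborel_integral_affine[of 1 "\<lambda>s. indicator T ((1 / real n) *\<^sub>R s) * c (s - t)" t]
      by (simp add: q_def scaleR_add_right)
    have "(\<integral>t. indicator T ((1 / real n) *\<^sub>R t) * q n ((1 / real n) *\<^sub>R t) \<partial>lborel)
       = (real n)\<^sup>2 * (\<integral>t. indicator T t * q n t \<partial>lborel)"
    proof -
      have "(\<lambda>t. indicator T ((1 / real n) *\<^sub>R t) * q n ((1 / real n) *\<^sub>R t)) \<in> borel_measurable borel"
        using q_meas[of n] by measurable
      from lborel_integral_affine[OF _ this, of "real n" 0] show ?thesis using n by simp
    qed
    then show ?thesis unfolding ind inner using n by simp
  qed
  show ?thesis
  proof (rule Lim_transform_eventually)
    show "(\<lambda>n. (1 / area T) * (\<integral>t. indicator T t * q n t \<partial>lborel)) \<longlonglongrightarrow> (\<integral>x. c x \<partial>lborel)"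
      using lim' T(4) by simp
    show "\<forall>\<^sub>F n in sequentially. (1 / area T) * (\<integral>t. indicator T t * q n t \<partial>lborel) = (1 / (real n ^ 2 * area T)) *
      (\<integral>t. indicator ((*\<^sub>R) (real n) ` T) t * (\<integral>s. indicator ((*\<^sub>R) (real n) ` T) s * c (s - t) \<partial>lborel) \<partial>lborel)"
      using eventually_ge_at_top[of 1] by eventually_elim (rule eq[symmetric])
  qed
qed

section \<open>Correlations strictly inside the unit interval\<close>

context stationary_gaussian_field begin

text \<open>If \<open>e = rho t\<close> has modulus 1, then \<open>gn (s + t) - e * gn s\<close> has
  variance \<open>2 - 2 * e * e = 0\<close> and vanishes almost surely. Each further step by
  \<open>t\<close> therefore multiplies the correlation by \<open>e\<close>.\<close>

lemma rho_periodic: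
  assumes "\<bar>rho t\<bar> = 1"
  shows "\<bar>rho (real n *\<^sub>R t)\<bar> = 1"
proof (induction n)
  case 0
  then show ?case by (simp add: rho_0)
next
  case (Suc n)
  define e where "e = rho t"
  have e: "e * e = 1" using assms by (auto simp: e_def abs_if split: if_splits)
  let ?s = "real n *\<^sub>R t"
  define v where "v \<omega> = (- e) * gn ?s \<omega>" for \<omega>
  define d where "d \<omega> = gn (?s + t) \<omega> + v \<omega>" for \<omega>
  have v_H: "v \<in> H" unfolding v_def[abs_def] by (intro H_scale gn_in_H)
  then have d_H: "d \<in> H" unfolding d_def[abs_def] by (intro H_add gn_in_H)
  have cov_v: "cov v h = - e * cov (gn ?s) h" "cov h v = - e * cov h (gn ?s)" for h
    unfolding v_def[abs_def] by (rule cov_scale_left, rule cov_scale_right)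
  have "cov d d = cov (gn (?s + t)) (gn (?s + t)) + cov (gn (?s + t)) v + (cov v (gn (?s + t)) + cov v v)"
    unfolding d_def[abs_def] by (simp only: cov_add_left cov_add_right H_add gn_in_H v_H)
  then have "cov d d = rho 0 - e * rho (- t) + (- e * rho t + e * e * rho 0)"
    unfolding cov_v cov_gn by simp
  moreover have "rho (- t) = rho t" using cov_commute[of "gn 0" "gn t"] by (simp add: cov_gn)
  ultimately have "cov d d = 0" using e by (simp add: rho_0 e_def[symmetric] algebra_simps)
  then have "AE \<omega> in M. (d \<omega>)\<^sup>2 = 0"
    using H_square[OF d_H] by (subst (asm) cov_def, subst (asm) power2_eq_square[symmetric], subst (asm) integral_nonneg_eq_0_iff_AE) auto
  then have "AE \<omega> in M. gn 0 \<omega> * d \<omega> = 0" by eventually_elim simp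
  then have "cov (gn 0) d = 0" unfolding cov_def by (rule integral_eq_zero_AE)
  moreover have "cov (gn 0) d = rho (?s + t) + (- e) * rho ?s"
    unfolding d_def[abs_def] by (simp only: cov_add_right gn_in_H v_H cov_v cov_gn diff_zero)
  ultimately have "rho (real (Suc n) *\<^sub>R t) = e * rho ?s" by (simp add: algebra_simps)
  then show ?case using Suc.IH assms by (simp add: abs_mult e_def)
qed

lemma abs_rho_less_1:
  assumes b: "\<And>t. b \<le> norm t \<Longrightarrow> \<bar>rho t\<bar> \<le> C * norm t powr - \<alpha>" and "\<alpha> > 2" and "t \<noteq> 0"
  shows "\<bar>rho t\<bar> < 1"
proof (rule ccontr)
  assume "\<not> \<bar>rho t\<bar> < 1"
  then have "\<bar>rho t\<bar> = 1" using abs_rho_le_1[of t] by linarith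
  then have 1: "\<bar>rho (real n *\<^sub>R t)\<bar> = 1" for n by (rule rho_periodic)
  define d where "d = norm t"
  have d: "d > 0" using assms by (simp add: d_def)
  have lim: "(\<lambda>n. C * (real n * d) powr - \<alpha>) \<longlonglongrightarrow> 0"
  proof -
    have "filterlim (\<lambda>n. real n * d) at_top sequentially"
      by (rule filterlim_tendsto_pos_mult_at_top[OF tendsto_const d filterlim_real_sequentially, THEN filterlim_cong[THEN iffD1, rotated -1]]) (auto simp: mult.commute)
    then have "(\<lambda>n. (real n * d) powr - \<alpha>) \<longlonglongrightarrow> 0" using assms by (intro tendsto_neg_powr) auto
    then show ?thesis using tendsto_mult_right_zero by blast
  qed
  have "\<forall>\<^sub>F n in sequentially. b \<le> real n * d"
    using d by (intro eventually_sequentiallyI[of "nat \<lceil>b / d\<rceil>"]) (simp add: pos_divide_le_eq[symmetric] nat_ceiling_le_eq)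
  moreover have "\<forall>\<^sub>F n in sequentially. C * (real n * d) powr - \<alpha> < 1"
    using lim by (rule order_tendstoD) simp
  ultimately have "\<forall>\<^sub>F n::nat in sequentially. False"
  proof eventually_elim
    case (elim n)
    then show ?case using b[of "real n *\<^sub>R t"] 1[of n] by (simp add: d_def)
  qed
  then show False by simp
qed

end

subsection \<open>The central limit theorem\<close>

lemma area_scaled_set:
  fixes T :: "(real^2) set"
  assumes "n > 0" "T \<in> sets borel"
  shows "(*\<^sub>R) n ` T \<in> sets borel" "area ((*\<^sub>R) n ` T) = n\<^sup>2 * area T"
proof -
  have ind: "t \<in> (*\<^sub>R) n ` T \<longleftrightarrow> (1 / n) *\<^sub>R t \<in> T" for t
  proof
    assume "(1 / n) *\<^sub>R t \<in> T"
    moreover have "t = n *\<^sub>R ((1 / n) *\<^sub>R t)" using assms(1) by simp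
    ultimately show "t \<in> (*\<^sub>R) n ` T" by (rule rev_image_eqI)
  qed (use assms(1) in auto)
  note assms(2)[measurable]
  have "(*\<^sub>R) n ` T = {t. (1 / n) *\<^sub>R t \<in> T}" using ind by blast
  also have "\<dots> \<in> sets borel" by measurable
  finally show S: "(*\<^sub>R) n ` T \<in> sets borel" .
  have "area ((*\<^sub>R) n ` T) = (\<integral>t. indicator ((*\<^sub>R) n ` T) t \<partial>lborel)" using S by simp
  also have "\<dots> = n\<^sup>2 *\<^sub>R (\<integral>t. indicator ((*\<^sub>R) n ` T) (0 + n *\<^sub>R t) \<partial>lborel)"
    using S assms(1) by (intro lborel_integral_affine) auto
  also have "(\<lambda>t. indicator ((*\<^sub>R) n ` T) (0 + n *\<^sub>R t)) = (indicator T :: _ \<Rightarrow> real)"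
    using assms(1) by (simp add: fun_eq_iff indicator_def ind)
  finally show "area ((*\<^sub>R) n ` T) = n\<^sup>2 * area T" using assms(2) by simp
qed

lemma (in prob_space) norm_expectation_cis_diff_le:
  fixes X Y :: "'a \<Rightarrow> real"
  assumes [measurable]: "X \<in> borel_measurable M" "Y \<in> borel_measurable M" and "integrable M (\<lambda>\<omega>. \<bar>X \<omega> - Y \<omega>\<bar>)"
  shows "norm ((\<integral>\<omega>. cis (s * X \<omega>) \<partial>M) - (\<integral>\<omega>. cis (s * Y \<omega>) \<partial>M)) \<le> \<bar>s\<bar> * (\<integral>\<omega>. \<bar>X \<omega> - Y \<omega>\<bar> \<partial>M)"
proof -
  have "integrable M (\<lambda>\<omega>. cis (s * X \<omega>))" "integrable M (\<lambda>\<omega>. cis (s * Y \<omega>))"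
    by (rule integrable_const_bound[where B=1]; simp)+
  then have "(\<integral>\<omega>. cis (s * X \<omega>) \<partial>M) - (\<integral>\<omega>. cis (s * Y \<omega>) \<partial>M) = (\<integral>\<omega>. cis (s * X \<omega>) - cis (s * Y \<omega>) \<partial>M)"
    by simp
  then have "norm ((\<integral>\<omega>. cis (s * X \<omega>) \<partial>M) - (\<integral>\<omega>. cis (s * Y \<omega>) \<partial>M)) = norm (\<integral>\<omega>. cis (s * X \<omega>) - cis (s * Y \<omega>) \<partial>M)"
    by (simp only:)
  also have "\<dots> \<le> (\<integral>\<omega>. \<bar>s\<bar> * \<bar>X \<omega> - Y \<omega>\<bar> \<partial>M)"
  proof (rule norm_integral_le)
    show "norm (cis (s * X \<omega>) - cis (s * Y \<omega>)) \<le> \<bar>s\<bar> * \<bar>X \<omega> - Y \<omega>\<bar>" for \<omega>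
      using norm_cis_diff_le[of "s * X \<omega>" "s * Y \<omega>"] by (simp add: abs_mult[symmetric] right_diff_distrib)
  qed (use assms in simp)
  finally show ?thesis by simp
qed

text \<open>Bounded convergence off one point becomes approximation in the mean square of the normal
  law, the norm appearing in Gebelein's inequality.\<close>

lemma ctrig_limit_approx:
  assumes "ctrig_limit u \<psi>" "\<And>x. \<bar>\<psi> x\<bar> \<le> L" "\<delta> > 0"
  obtains f K where "ctrig f" "\<And>x. \<bar>f x\<bar> \<le> K" "(\<integral>x. (\<psi> x - f x)\<^sup>2 \<partial>std_normal_distribution) \<le> \<delta>"
proof -
  obtain f K where f: "\<And>m. ctrig (f m)" "\<And>m x. \<bar>f m x\<bar> \<le> K" "\<And>x. x \<noteq> u \<Longrightarrow> (\<lambda>m. f m x) \<longlonglongrightarrow> \<psi> x"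
    and [measurable]: "\<psi> \<in> borel_measurable borel"
    using assms(1) unfolding ctrig_limit_def by blast
  interpret prob_space std_normal_distribution by (rule prob_space_std_normal)
  have [measurable]: "f m \<in> borel_measurable borel" for m using f(1) by (rule ctrig_measurable)
  have "(\<lambda>m. \<integral>x. (\<psi> x - f m x)\<^sup>2 \<partial>std_normal_distribution) \<longlonglongrightarrow> (\<integral>x. 0 \<partial>std_normal_distribution)"
  proof (rule integral_dominated_convergence[where w="\<lambda>_. (L + K)\<^sup>2"])
    show "AE x in std_normal_distribution. (\<lambda>m. (\<psi> x - f m x)\<^sup>2) \<longlonglongrightarrow> 0"
      using AE_std_normal_neq[of u]
    proof eventually_elim
      case (elim x)
      have "(\<lambda>m. (\<psi> x - f m x)\<^sup>2) \<longlonglongrightarrow> (\<psi> x - \<psi> x)\<^sup>2" by (intro tendsto_intros f elim)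
      then show ?case by simp
    qed
    show "AE x in std_normal_distribution. norm ((\<psi> x - f m x)\<^sup>2) \<le> (L + K)\<^sup>2" for m
    proof (rule AE_I2)
      fix x
      have "\<bar>\<psi> x - f m x\<bar> \<le> \<bar>L + K\<bar>" using assms(2)[of x] f(2)[of m x] by linarith
      then show "norm ((\<psi> x - f m x)\<^sup>2) \<le> (L + K)\<^sup>2" by (simp add: abs_le_square_iff)
    qed
  qed simp_all
  then have "\<forall>\<^sub>F m in sequentially. (\<integral>x. (\<psi> x - f m x)\<^sup>2 \<partial>std_normal_distribution) < \<delta>"
    using assms(3) by (intro order_tendstoD) auto
  then obtain m where "(\<integral>x. (\<psi> x - f m x)\<^sup>2 \<partial>std_normal_distribution) < \<delta>"
    by (auto simp: eventually_sequentially)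
  then show thesis using that[of "f m" K] f by auto
qed

lemma sup_norm_integral_sq_le:
  "(\<integral>x. (\<psi> x)\<^sup>2 \<partial>std_normal_distribution) \<le> 1" if "\<And>x. \<bar>\<psi> x\<bar> \<le> (1::real)" for \<psi> :: "real \<Rightarrow> real"
proof -
  interpret prob_space std_normal_distribution by (rule prob_space_std_normal)
  have "norm (\<integral>x. (\<psi> x)\<^sup>2 \<partial>std_normal_distribution) \<le> (\<integral>x. 1 \<partial>std_normal_distribution)"
    using that by (intro norm_integral_le) (auto simp: abs_square_le_1)
  then show ?thesis using prob_space by simp
qed

lemma finite_measure_restrict:
  assumes "S \<in> sets borel" "bounded S"
  shows "finite_measure (restrict_space lborel (S :: (real^2) set))"
  using assms emeasure_bounded_finite[of S]
  by (intro finite_measureI) (auto simp: emeasure_restrict_space space_restrict_space)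

lemma measure_restrict: "S \<in> sets borel \<Longrightarrow> measure (restrict_space lborel S) (space (restrict_space lborel S)) = area S"
  by (simp add: measure_restrict_space space_restrict_space)

lemma restrict_id_measurable: "(\<lambda>t. t) \<in> measurable (restrict_space lborel S) borel"
  by (rule measurable_restrict_space1) simp

lemma fst_restrict_measurable: "fst \<in> measurable (restrict_space lborel S \<Otimes>\<^sub>M N) borel"
  by (rule measurable_compose[OF measurable_fst restrict_id_measurable])

lemma snd_restrict_measurable: "snd \<in> measurable (N \<Otimes>\<^sub>M restrict_space lborel S) borel"
  by (rule measurable_compose[OF measurable_snd restrict_id_measurable])

section \<open>Area integrals over bounded windows\<close>

context stationary_gaussian_field begin

lemma gn_measurable_pair: "(\<lambda>(t, \<omega>). gn t \<omega>) \<in> borel_measurable (borel \<Otimes>\<^sub>M M)"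
  using measurable_field unfolding measurable_field_def gn_def case_prod_beta' by measurable

lemma measurable_gn [measurable (raw)]:
  assumes [measurable]: "f \<in> measurable N borel" "h \<in> measurable N M"
  shows "(\<lambda>x. gn (f x) (h x)) \<in> borel_measurable N"
proof -
  have "(\<lambda>x. (\<lambda>(t, \<omega>). gn t \<omega>) (f x, h x)) \<in> borel_measurable N"
    by (rule measurable_compose[OF _ gn_measurable_pair]) measurable
  then show ?thesis by simp
qed

text \<open>Enlarging \<open>S\<close> to the plane and translating makes the bound uniform in
  \<open>t\<close> and \<open>S\<close>; it plays the role of \<open>R\<close> in the abstract
  estimates.\<close>

lemma nn_integral_rho_le:
  assumes "integrable lborel rho" and [measurable]: "S \<in> sets borel"
  shows "(\<integral>\<^sup>+s. ennreal \<bar>rho (s - t)\<bar> \<partial>restrict_space lborel S) \<le> ennreal (\<integral>x. \<bar>rho x\<bar> \<partial>lborel)"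
proof -
  have [measurable]: "rho \<in> borel_measurable borel" using borel_measurable_integrable[OF assms(1)] by simp
  have "(\<integral>\<^sup>+s. ennreal \<bar>rho (s - t)\<bar> \<partial>restrict_space lborel S) \<le> (\<integral>\<^sup>+s. ennreal \<bar>rho (s - t)\<bar> \<partial>lborel)"
    by (subst nn_integral_restrict_space) (auto intro!: nn_integral_mono simp: indicator_def)
  also have "\<dots> = (\<integral>\<^sup>+s. ennreal \<bar>rho (s - t)\<bar> \<partial>distr lborel borel ((+) t))"
    by (simp add: lborel_distr_plus)
  also have "\<dots> = (\<integral>\<^sup>+x. ennreal \<bar>rho x\<bar> \<partial>lborel)"
    by (subst nn_integral_distr) auto
  also have "\<dots> = ennreal (\<integral>x. \<bar>rho x\<bar> \<partial>lborel)"
    by (rule nn_integral_eq_integral) (use assms in auto)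
  finally show ?thesis .
qed

definition area_integral :: "(real \<Rightarrow> real) \<Rightarrow> (real^2) set \<Rightarrow> 'w \<Rightarrow> real" where
  "area_integral \<psi> S \<omega> = (\<integral>t. \<psi> (gn t \<omega>) \<partial>restrict_space lborel S)"

lemma area_integral_bounded:
  assumes S: "S \<in> sets borel" "bounded S" and [measurable]: "\<psi> \<in> borel_measurable borel" and K: "\<And>x. \<bar>\<psi> x\<bar> \<le> K"
  shows "area_integral \<psi> S \<in> borel_measurable M" "\<bar>area_integral \<psi> S \<omega>\<bar> \<le> K * area S"
proof -
  interpret mu: finite_measure "restrict_space lborel S" by (rule finite_measure_restrict[OF S])
  note snd_restrict_measurable[measurable]
  show "area_integral \<psi> S \<in> borel_measurable M"
    unfolding area_integral_def by (rule mu.borel_measurable_lebesgue_integral) measurable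
  have "norm (area_integral \<psi> S \<omega>) \<le> (\<integral>t. K \<partial>restrict_space lborel S)"
    unfolding area_integral_def by (rule norm_integral_le) (auto simp: K)
  then show "\<bar>area_integral \<psi> S \<omega>\<bar> \<le> K * area S" using measure_restrict[OF S(1)] by (simp add: mult.commute)
qed

text \<open>Gebelein's inequality is inserted in the double integral of covariances: one integration
  gives the integral of \<open>\<bar>rho\<bar>\<close>, the other the area. Growth linear in the
  area is what survives division by \<open>sqrt (area S)\<close>.\<close>

lemma area_integral_second_moment_le:
  assumes rho: "integrable lborel rho" and S: "S \<in> sets borel" "bounded S"
    and lim: "ctrig_limit u \<psi>" and K: "\<And>x. \<bar>\<psi> x\<bar> \<le> K"
  shows "(\<integral>\<omega>. (area_integral \<psi> S \<omega>)\<^sup>2 \<partial>M) \<le> (\<integral>x. (\<psi> x)\<^sup>2 \<partial>std_normal_distribution) * (\<integral>x. \<bar>rho x\<bar> \<partial>lborel) * area S"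
proof -
  define \<eta> where "\<eta> = (\<integral>x. (\<psi> x)\<^sup>2 \<partial>std_normal_distribution)"
  define R where "R = (\<integral>x. \<bar>rho x\<bar> \<partial>lborel)"
  have pos: "0 \<le> \<eta>" "0 \<le> R" by (auto simp: \<eta>_def R_def)
  interpret mu: finite_measure "restrict_space lborel S" by (rule finite_measure_restrict[OF S])
  note fst_restrict_measurable[measurable]
  have [measurable]: "\<psi> \<in> borel_measurable borel" using lim by (simp add: ctrig_limit_def)
  let ?Z = "\<lambda>t \<omega>. complex_of_real (\<psi> (gn t \<omega>))"
  have E: "norm (\<integral>\<omega>. ?Z t \<omega> * cnj (?Z s \<omega>) \<partial>M) \<le> \<eta> * \<bar>rho (s - t)\<bar>" for t s
  proof -
    have "(\<integral>\<omega>. ?Z t \<omega> * cnj (?Z s \<omega>) \<partial>M) = of_real (\<integral>\<omega>. \<psi> (gn t \<omega>) * \<psi> (gn s \<omega>) \<partial>M)"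
      by (simp only: complex_cnj_complex_of_real of_real_mult[symmetric] integral_complex_of_real)
    then show ?thesis
      using std_gaussian_pair.gebelein_limit[OF gn_pair lim, of t s] by (simp add: \<eta>_def mult.commute)
  qed
  have "(\<integral>\<omega>. (norm (\<integral>t. ?Z t \<omega> \<partial>restrict_space lborel S))\<^sup>2 \<partial>M) \<le> \<eta> * R * area S"
  proof (rule second_moment_integral_le[OF mu.finite_measure_axioms])
    show "(\<lambda>(t, \<omega>). ?Z t \<omega>) \<in> borel_measurable (restrict_space lborel S \<Otimes>\<^sub>M M)" by measurable
    show "norm (?Z t \<omega>) \<le> K" for t \<omega> by (simp add: K)
    have "(\<integral>\<^sup>+t. (\<integral>\<^sup>+s. ennreal (norm (\<integral>\<omega>. ?Z t \<omega> * cnj (?Z s \<omega>) \<partial>M)) \<partial>restrict_space lborel S) \<partial>restrict_space lborel S)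
      \<le> (\<integral>\<^sup>+t. ennreal \<eta> * ennreal R \<partial>restrict_space lborel S)"
    proof (rule nn_integral_mono)
      fix t
      have [measurable]: "rho \<in> borel_measurable borel" using borel_measurable_integrable[OF rho] by simp
      note restrict_id_measurable[measurable]
      have "(\<integral>\<^sup>+s. ennreal (norm (\<integral>\<omega>. ?Z t \<omega> * cnj (?Z s \<omega>) \<partial>M)) \<partial>restrict_space lborel S)
        \<le> (\<integral>\<^sup>+s. ennreal \<eta> * ennreal \<bar>rho (s - t)\<bar> \<partial>restrict_space lborel S)"
        using E pos by (intro nn_integral_mono) (simp add: ennreal_mult[symmetric] ennreal_leI)
      also have "\<dots> = ennreal \<eta> * (\<integral>\<^sup>+s. ennreal \<bar>rho (s - t)\<bar> \<partial>restrict_space lborel S)"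
        by (rule nn_integral_cmult) measurable
      also have "\<dots> \<le> ennreal \<eta> * ennreal R"
        unfolding R_def by (intro mult_left_mono nn_integral_rho_le[OF rho S(1)]) auto
      finally show "(\<integral>\<^sup>+s. ennreal (norm (\<integral>\<omega>. ?Z t \<omega> * cnj (?Z s \<omega>) \<partial>M)) \<partial>restrict_space lborel S) \<le> ennreal \<eta> * ennreal R" .
    qed
    also have "\<dots> = ennreal (\<eta> * R * area S)"
      using pos measure_restrict[OF S(1)] by (simp add: mu.emeasure_eq_measure ennreal_mult)
    finally show "(\<integral>\<^sup>+t. (\<integral>\<^sup>+s. ennreal (norm (\<integral>\<omega>. ?Z t \<omega> * cnj (?Z s \<omega>) \<partial>M)) \<partial>restrict_space lborel S) \<partial>restrict_space lborel S) \<le> ennreal (\<eta> * R * area S)" .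
  qed (use pos in simp)
  moreover have "(norm (\<integral>t. ?Z t \<omega> \<partial>restrict_space lborel S))\<^sup>2 = (area_integral \<psi> S \<omega>)\<^sup>2" for \<omega>
    unfolding integral_complex_of_real norm_of_real power2_abs area_integral_def ..
  ultimately show ?thesis by (simp add: \<eta>_def R_def)
qed

lemma area_integral_diff:
  assumes S: "S \<in> sets borel" "bounded S"
    and "\<psi> \<in> borel_measurable borel" "\<And>x. \<bar>\<psi> x\<bar> \<le> K" "f \<in> borel_measurable borel" "\<And>x. \<bar>f x\<bar> \<le> L"
  shows "\<omega> \<in> space M \<Longrightarrow> area_integral (\<lambda>x. \<psi> x - f x) S \<omega> = area_integral \<psi> S \<omega> - area_integral f S \<omega>"
proof -
  assume [simp]: "\<omega> \<in> space M"
  interpret mu: finite_measure "restrict_space lborel S" by (rule finite_measure_restrict[OF S])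
  note restrict_id_measurable[measurable] assms(3,5)[measurable]
  have "integrable (restrict_space lborel S) (\<lambda>t. \<psi> (gn t \<omega>))"
    by (rule mu.integrable_const_bound[where B=K]) (use assms in auto)
  moreover have "integrable (restrict_space lborel S) (\<lambda>t. f (gn t \<omega>))"
    by (rule mu.integrable_const_bound[where B=L]) (use assms in auto)
  ultimately show ?thesis by (simp add: area_integral_def)
qed

text \<open>At the frequency \<open>s / sqrt (area S)\<close> the square contributes
  \<open>1 / area S\<close> and the constant of \<open>char_estimate\<close> contributes
  \<open>sqrt (area S)\<close>. \<open>C\<close> depends on \<open>f\<close> and on the field, but
  neither on \<open>S\<close> nor on \<open>s\<close>.\<close>

lemma char_bound_ctrig:
  assumes rho: "integrable lborel rho" and f: "ctrig f" "\<And>x. \<bar>f x\<bar> \<le> K"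
  obtains C where "\<And>S s. S \<in> sets borel \<Longrightarrow> bounded S \<Longrightarrow> 0 < area S \<Longrightarrow>
     norm ((\<integral>\<omega>. cis (s * (area_integral f S \<omega> / sqrt (area S))) \<partial>M)
       - of_real (exp (- (s\<^sup>2 * ((\<integral>\<omega>. (area_integral f S \<omega>)\<^sup>2 \<partial>M) / area S) / 2)))) \<le> s\<^sup>2 * C / sqrt (area S)"
proof -
  obtain I c where Ic: "finite I" "\<And>x. trig I c x = of_real (f x)"
    and cent: "(\<Sum>a\<in>I. c a * of_real (exp (- a\<^sup>2 / 2))) = 0"
    using f(1) unfolding ctrig_def by blast
  define A where "A = (\<Sum>a\<in>I. \<bar>a\<bar>)"
  have A: "\<bar>a\<bar> \<le> A" if "a \<in> I" for a unfolding A_def using that Ic(1) by (intro member_le_sum) auto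
  have A0: "0 \<le> A" by (simp add: A_def sum_nonneg)
  define R where "R = (\<integral>x. \<bar>rho x\<bar> \<partial>lborel)"
  have R0: "0 \<le> R" by (simp add: R_def)
  define C where "C = 2 * sqrt (4 * (\<Sum>a\<in>I. norm (dcoef c a)) ^ 4 * A\<^sup>2 * R ^ 3)"
  show thesis
  proof (rule that[of C])
    fix S s assume S: "S \<in> sets borel" "bounded S" and pos: "0 < area S"
    interpret mu: finite_measure "restrict_space lborel S" by (rule finite_measure_restrict[OF S])
    interpret gaussian_integral M H "restrict_space lborel S" gn I c
    proof
      note fst_restrict_measurable[measurable]
      show "gn t \<in> H" for t by (rule gn_in_H)
      show "cov (gn t) (gn t) = 1" for t by (simp add: cov_gn rho_0)
      show "(\<lambda>(t, \<omega>). gn t \<omega>) \<in> borel_measurable (restrict_space lborel S \<Otimes>\<^sub>M M)" by measurable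
      show "finite I" by fact
    qed
    have F: "Re (F \<omega>) = area_integral f S \<omega>" for \<omega>
      unfolding F_def Ic(2) area_integral_def by (simp only: integral_complex_of_real Re_complex_of_real)
    have "norm ((\<integral>\<omega>. cis ((s / sqrt (area S)) * Re (F \<omega>)) \<partial>M)
        - of_real (exp (- ((s / sqrt (area S))\<^sup>2 * (\<integral>\<omega>. (Re (F \<omega>))\<^sup>2 \<partial>M) / 2))))
      \<le> (s / sqrt (area S))\<^sup>2 * (2 * sqrt (4 * (\<Sum>a\<in>I. norm (dcoef c a)) ^ 4 * A\<^sup>2 *
            measure (restrict_space lborel S) (space (restrict_space lborel S)) * R ^ 3))"
    proof (rule char_estimate[OF _ cent _ R0 A A0])
      show "Im (trig I c x) = 0" for x unfolding Ic(2) by simp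
      show "(\<integral>\<^sup>+s. ennreal \<bar>cov (gn t) (gn s)\<bar> \<partial>restrict_space lborel S) \<le> ennreal R" for t
        unfolding cov_gn R_def by (rule nn_integral_rho_le[OF rho S(1)])
    qed auto
    also have "(s / sqrt (area S))\<^sup>2 * (2 * sqrt (4 * (\<Sum>a\<in>I. norm (dcoef c a)) ^ 4 * A\<^sup>2 *
            measure (restrict_space lborel S) (space (restrict_space lborel S)) * R ^ 3)) = s\<^sup>2 * C / sqrt (area S)"
    proof -
      have "sqrt (4 * E * A\<^sup>2 * area S * R ^ 3) = sqrt (4 * E * A\<^sup>2 * R ^ 3) * sqrt (area S)" for E
        by (simp add: real_sqrt_mult mult_ac)
      moreover have "(s / q)\<^sup>2 * (2 * (x * q)) = s\<^sup>2 * (2 * x) / q" if "0 < q" for q x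
        using that by (simp add: power2_eq_square)
      ultimately show ?thesis unfolding measure_restrict[OF S(1)] C_def using pos by (simp only: real_sqrt_gt_zero)
    qed
    finally show "norm ((\<integral>\<omega>. cis (s * (area_integral f S \<omega> / sqrt (area S))) \<partial>M)
       - of_real (exp (- (s\<^sup>2 * ((\<integral>\<omega>. (area_integral f S \<omega>)\<^sup>2 \<partial>M) / area S) / 2)))) \<le> s\<^sup>2 * C / sqrt (area S)"
      unfolding F using pos by (simp add: power_divide)
  qed
qed

text \<open>The three terms pay for replacing \<psi> by a polynomial \<open>f\<close> in the
  characteristic function, for the Stein error of \<open>f\<close>, and for the change of variance.
  \<open>C\<close> depends on \<open>f\<close>, hence on \<delta>, but on neither \<open>S\<close>
  nor \<open>s\<close>.\<close>

lemma char_bound_limit: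
  assumes rho: "integrable lborel rho" and lim: "ctrig_limit u \<psi>" and \<psi>: "\<And>x. \<bar>\<psi> x\<bar> \<le> 1"
    and \<delta>: "0 < \<delta>" "\<delta> \<le> 1"
  defines "R \<equiv> \<integral>x. \<bar>rho x\<bar> \<partial>lborel"
  obtains C where "\<And>S s. S \<in> sets borel \<Longrightarrow> bounded S \<Longrightarrow> 0 < area S \<Longrightarrow>
     norm ((\<integral>\<omega>. cis (s * (area_integral \<psi> S \<omega> / sqrt (area S))) \<partial>M)
       - of_real (exp (- (s\<^sup>2 * ((\<integral>\<omega>. (area_integral \<psi> S \<omega>)\<^sup>2 \<partial>M) / area S) / 2))))
     \<le> \<bar>s\<bar> * (\<delta> * sqrt R) + s\<^sup>2 * C / sqrt (area S) + s\<^sup>2 * (3 * \<delta> * R) / 2"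
proof -
  have R0: "0 \<le> R" by (simp add: R_def)
  have \<psi>_meas: "\<psi> \<in> borel_measurable borel" using lim by (simp add: ctrig_limit_def)
  \<comment> \<open>The mean square error is \<open>\<delta>\<^sup>2\<close> so that the first
    moment of the difference is linear in \<delta>.\<close>
  obtain f K where f: "ctrig f" "\<And>x. \<bar>f x\<bar> \<le> K" and \<eta>: "(\<integral>x. (\<psi> x - f x)\<^sup>2 \<partial>std_normal_distribution) \<le> \<delta>\<^sup>2"
    using ctrig_limit_approx[OF lim \<psi>, of "\<delta>\<^sup>2"] \<delta> by auto
  have f_meas: "f \<in> borel_measurable borel" using f(1) by (rule ctrig_measurable)
  obtain C where C: "\<And>S s. S \<in> sets borel \<Longrightarrow> bounded S \<Longrightarrow> 0 < area S \<Longrightarrow>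
     norm ((\<integral>\<omega>. cis (s * (area_integral f S \<omega> / sqrt (area S))) \<partial>M)
       - of_real (exp (- (s\<^sup>2 * ((\<integral>\<omega>. (area_integral f S \<omega>)\<^sup>2 \<partial>M) / area S) / 2)))) \<le> s\<^sup>2 * C / sqrt (area S)"
    using char_bound_ctrig[OF rho f] by blast
  show thesis
  proof (rule that[of C])
    fix S s assume S: "S \<in> sets borel" "bounded S" and pos: "0 < area S"
    define a where "a = area S"
    have a: "0 < a" using pos by (simp add: a_def)
    define Z where "Z = area_integral \<psi> S"
    define G where "G = area_integral f S"
    have [measurable]: "Z \<in> borel_measurable M" "G \<in> borel_measurable M"
      unfolding Z_def G_def by (rule area_integral_bounded(1)[OF S \<psi>_meas \<psi>], rule area_integral_bounded(1)[OF S f_meas f(2)])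
    have Zb: "\<bar>Z \<omega>\<bar> \<le> a" for \<omega> using area_integral_bounded(2)[OF S \<psi>_meas \<psi>] by (simp add: Z_def a_def)
    have Gb: "\<bar>G \<omega>\<bar> \<le> K * a" for \<omega> using area_integral_bounded(2)[OF S f_meas f(2)] by (simp add: G_def a_def)
    define D where "D \<omega> = Z \<omega> - G \<omega>" for \<omega>
    have [measurable]: "D \<in> borel_measurable M" unfolding D_def by measurable
    have Db: "\<bar>D \<omega>\<bar> \<le> a + K * a" for \<omega> using Zb[of \<omega>] Gb[of \<omega>] unfolding D_def by linarith
    have sqint: "integrable M (\<lambda>\<omega>. (X \<omega>)\<^sup>2)" if [measurable]: "X \<in> borel_measurable M" and "\<And>\<omega>. \<bar>X \<omega>\<bar> \<le> B" for X :: "'w \<Rightarrow> real" and B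
    proof (rule integrable_const_bound[where B="B\<^sup>2"])
      have "0 \<le> B" using that(2)[of undefined] by linarith
      then show "AE \<omega> in M. norm ((X \<omega>)\<^sup>2) \<le> B\<^sup>2" using that(2) by (simp add: abs_le_square_iff[symmetric])
    qed simp
    have int: "integrable M (\<lambda>\<omega>. (Z \<omega>)\<^sup>2)" "integrable M (\<lambda>\<omega>. (G \<omega>)\<^sup>2)" "integrable M (\<lambda>\<omega>. (D \<omega>)\<^sup>2)"
      by (rule sqint[OF _ Zb], simp, rule sqint[OF _ Gb], simp, rule sqint[OF _ Db], simp)
    have Dint: "integrable M (\<lambda>\<omega>. \<bar>D \<omega>\<bar>)" using integrable_of_square[OF _ int(3)] by simp
    have ED: "(\<integral>\<omega>. (D \<omega>)\<^sup>2 \<partial>M) \<le> \<delta>\<^sup>2 * R * a"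
    proof -
      have "(\<integral>\<omega>. (D \<omega>)\<^sup>2 \<partial>M) = (\<integral>\<omega>. (area_integral (\<lambda>x. \<psi> x - f x) S \<omega>)\<^sup>2 \<partial>M)"
        by (intro Bochner_Integration.integral_cong refl)
           (simp add: area_integral_diff[OF S \<psi>_meas \<psi> f_meas f(2)] D_def Z_def G_def)
      also have "\<dots> \<le> (\<integral>x. (\<psi> x - f x)\<^sup>2 \<partial>std_normal_distribution) * R * a"
        unfolding R_def a_def
      proof (rule area_integral_second_moment_le[OF rho S ctrig_limit_diff[OF lim f]])
        show "\<bar>\<psi> x - f x\<bar> \<le> 1 + K" for x using \<psi>[of x] f(2)[of x] by linarith
      qed
      also have "\<dots> \<le> \<delta>\<^sup>2 * R * a" using \<eta> R0 a by (intro mult_right_mono) auto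
      finally show ?thesis .
    qed
    have EZ: "(\<integral>\<omega>. (Z \<omega>)\<^sup>2 \<partial>M) \<le> R * a"
    proof -
      have "(\<integral>\<omega>. (Z \<omega>)\<^sup>2 \<partial>M) \<le> (\<integral>x. (\<psi> x)\<^sup>2 \<partial>std_normal_distribution) * R * a"
        unfolding R_def a_def Z_def by (rule area_integral_second_moment_le[OF rho S lim \<psi>])
      also have "\<dots> \<le> 1 * R * a"
        using sup_norm_integral_sq_le[OF \<psi>] R0 a by (intro mult_right_mono) auto
      finally show ?thesis by simp
    qed
    have E1: "(\<integral>\<omega>. \<bar>D \<omega>\<bar> \<partial>M) \<le> \<delta> * sqrt R * sqrt a"
    proof -
      have "(\<integral>\<omega>. \<bar>D \<omega>\<bar> \<partial>M)\<^sup>2 \<le> (\<integral>\<omega>. (D \<omega>)\<^sup>2 \<partial>M)"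
        using variance_eq[of "\<lambda>\<omega>. \<bar>D \<omega>\<bar>"] variance_positive[of "\<lambda>\<omega>. \<bar>D \<omega>\<bar>"] Dint int(3) by simp
      then have "(\<integral>\<omega>. \<bar>D \<omega>\<bar> \<partial>M) \<le> sqrt (\<delta>\<^sup>2 * R * a)" using ED by (intro real_le_rsqrt) simp
      then show ?thesis using \<delta> by (simp add: real_sqrt_mult)
    qed
    have EGZ: "\<bar>(\<integral>\<omega>. (G \<omega>)\<^sup>2 \<partial>M) - (\<integral>\<omega>. (Z \<omega>)\<^sup>2 \<partial>M)\<bar> \<le> 3 * \<delta> * R * a"
    proof -
      \<comment> \<open>The cross term \<open>2 * D * Z\<close> is split by the weighted
        arithmetic-geometric inequality. Weight \<delta> balances the moment of \<open>D\<close>, of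
        order \<open>\<delta>\<^sup>2\<close>, against that of \<open>Z\<close>, and both parts
        become of order \<delta>.\<close>
      have pt: "\<bar>(G \<omega>)\<^sup>2 - (Z \<omega>)\<^sup>2\<bar> \<le> (D \<omega>)\<^sup>2 + ((D \<omega>)\<^sup>2 / \<delta> + \<delta> * (Z \<omega>)\<^sup>2)" for \<omega>
      proof -
        have "(G \<omega>)\<^sup>2 - (Z \<omega>)\<^sup>2 = (D \<omega>)\<^sup>2 - 2 * (D \<omega> * Z \<omega>)"
          by (simp add: D_def power2_eq_square algebra_simps)
        moreover have "2 * \<bar>D \<omega> * Z \<omega>\<bar> \<le> (D \<omega>)\<^sup>2 / \<delta> + \<delta> * (Z \<omega>)\<^sup>2"
        proof -
          have "0 \<le> (\<bar>D \<omega>\<bar> - \<delta> * \<bar>Z \<omega>\<bar>)\<^sup>2 / \<delta>" using \<delta> by simp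
          also have "\<dots> = (D \<omega>)\<^sup>2 / \<delta> + \<delta> * (Z \<omega>)\<^sup>2 - 2 * \<bar>D \<omega> * Z \<omega>\<bar>"
          proof -
            have "(p - \<delta> * z)\<^sup>2 / \<delta> = p\<^sup>2 / \<delta> + \<delta> * z\<^sup>2 - 2 * (p * z)" for p z
              using \<delta> by (simp add: field_simps power2_eq_square)
            from this[of "\<bar>D \<omega>\<bar>" "\<bar>Z \<omega>\<bar>"] show ?thesis by (simp only: power2_abs abs_mult)
          qed
          finally show ?thesis by simp
        qed
        moreover have "0 \<le> (D \<omega>)\<^sup>2" by simp
        ultimately show ?thesis by linarith
      qed
      have "\<bar>(\<integral>\<omega>. (G \<omega>)\<^sup>2 \<partial>M) - (\<integral>\<omega>. (Z \<omega>)\<^sup>2 \<partial>M)\<bar> = norm (\<integral>\<omega>. (G \<omega>)\<^sup>2 - (Z \<omega>)\<^sup>2 \<partial>M)"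
        using int by simp
      also have "\<dots> \<le> (\<integral>\<omega>. (D \<omega>)\<^sup>2 + ((D \<omega>)\<^sup>2 / \<delta> + \<delta> * (Z \<omega>)\<^sup>2) \<partial>M)"
        by (rule norm_integral_le) (use int pt in auto)
      also have "\<dots> = (\<integral>\<omega>. (D \<omega>)\<^sup>2 \<partial>M) + ((\<integral>\<omega>. (D \<omega>)\<^sup>2 \<partial>M) / \<delta> + \<delta> * (\<integral>\<omega>. (Z \<omega>)\<^sup>2 \<partial>M))"
        using int by simp
      also have "\<dots> \<le> \<delta>\<^sup>2 * R * a + (\<delta>\<^sup>2 * R * a / \<delta> + \<delta> * (R * a))"
        using \<delta> by (intro add_mono ED EZ divide_right_mono mult_left_mono) auto
      \<comment> \<open>The three terms carry \<open>\<delta>\<^sup>2\<close>, \<delta> and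
        \<delta>; since \<delta> is at most 1, each is bounded by \<delta>.\<close>
      also have "\<dots> \<le> 3 * \<delta> * R * a"
      proof -
        have "\<delta>\<^sup>2 \<le> \<delta>" using \<delta> by (simp add: power2_eq_square mult_left_le)
        then have "\<delta>\<^sup>2 * (R * a) \<le> \<delta> * (R * a)" using R0 a by (intro mult_right_mono) auto
        then show ?thesis using \<delta> by (simp add: power2_eq_square mult.assoc)
      qed
      finally show ?thesis .
    qed
    define sZ where "sZ = (\<integral>\<omega>. (Z \<omega>)\<^sup>2 \<partial>M) / a"
    define sG where "sG = (\<integral>\<omega>. (G \<omega>)\<^sup>2 \<partial>M) / a"
    have 1: "norm ((\<integral>\<omega>. cis (s * (Z \<omega> / sqrt a)) \<partial>M) - (\<integral>\<omega>. cis (s * (G \<omega> / sqrt a)) \<partial>M)) \<le> \<bar>s\<bar> * (\<delta> * sqrt R)"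
    proof -
      have eq: "\<bar>Z \<omega> / sqrt a - G \<omega> / sqrt a\<bar> = \<bar>D \<omega>\<bar> / sqrt a" for \<omega>
        using a by (simp add: D_def diff_divide_distrib[symmetric])
      have "norm ((\<integral>\<omega>. cis (s * (Z \<omega> / sqrt a)) \<partial>M) - (\<integral>\<omega>. cis (s * (G \<omega> / sqrt a)) \<partial>M))
         \<le> \<bar>s\<bar> * (\<integral>\<omega>. \<bar>Z \<omega> / sqrt a - G \<omega> / sqrt a\<bar> \<partial>M)"
        by (rule norm_expectation_cis_diff_le) (use Dint in \<open>simp_all add: eq\<close>)
      also have "\<dots> \<le> \<bar>s\<bar> * (\<delta> * sqrt R)"
        unfolding eq using E1 a by (intro mult_left_mono) (auto simp: divide_le_eq)
      finally show ?thesis .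
    qed
    have 2: "norm ((\<integral>\<omega>. cis (s * (G \<omega> / sqrt a)) \<partial>M) - of_real (exp (- (s\<^sup>2 * sG / 2)))) \<le> s\<^sup>2 * C / sqrt a"
      using C[OF S pos, of s] by (simp only: G_def a_def sG_def)
    have 3: "norm (complex_of_real (exp (- (s\<^sup>2 * sG / 2))) - of_real (exp (- (s\<^sup>2 * sZ / 2)))) \<le> s\<^sup>2 * (3 * \<delta> * R) / 2"
    proof -
      have "norm (complex_of_real (exp (- (s\<^sup>2 * sG / 2))) - of_real (exp (- (s\<^sup>2 * sZ / 2)))) = \<bar>exp (- (s\<^sup>2 * sG / 2)) - exp (- (s\<^sup>2 * sZ / 2))\<bar>"
        by (simp only: of_real_diff[symmetric] norm_of_real)
      also have "\<dots> \<le> \<bar>s\<^sup>2 * sG / 2 - s\<^sup>2 * sZ / 2\<bar>"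
        using a by (intro exp_neg_lipschitz) (simp_all add: sG_def sZ_def)
      also have "\<dots> = s\<^sup>2 * \<bar>sG - sZ\<bar> / 2"
        by (simp add: diff_divide_distrib[symmetric] right_diff_distrib[symmetric] abs_mult)
      also have "\<dots> \<le> s\<^sup>2 * (3 * \<delta> * R) / 2"
      proof (intro divide_right_mono mult_left_mono)
        have "\<bar>sG - sZ\<bar> = \<bar>(\<integral>\<omega>. (G \<omega>)\<^sup>2 \<partial>M) - (\<integral>\<omega>. (Z \<omega>)\<^sup>2 \<partial>M)\<bar> / a"
          using a by (simp add: sG_def sZ_def diff_divide_distrib[symmetric])
        then show "\<bar>sG - sZ\<bar> \<le> 3 * \<delta> * R" using EGZ a by (simp add: divide_le_eq)
      qed auto
      finally show ?thesis .
    qed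
    have "norm ((\<integral>\<omega>. cis (s * (Z \<omega> / sqrt a)) \<partial>M) - of_real (exp (- (s\<^sup>2 * sZ / 2))))
       \<le> \<bar>s\<bar> * (\<delta> * sqrt R) + s\<^sup>2 * C / sqrt a + s\<^sup>2 * (3 * \<delta> * R) / 2"
    proof -
      have "norm (p - z) \<le> x + y + w" if "norm (p - q) \<le> x" "norm (q - r) \<le> y" "norm (r - z) \<le> w"
        for p q r z :: complex and x y w
        using norm_triangle_ineq[of "p - q" "q - r"] norm_triangle_ineq[of "p - r" "r - z"] that by simp
      from this[OF 1 2 3] show ?thesis .
    qed
    then show "norm ((\<integral>\<omega>. cis (s * (area_integral \<psi> S \<omega> / sqrt (area S))) \<partial>M)
       - of_real (exp (- (s\<^sup>2 * ((\<integral>\<omega>. (area_integral \<psi> S \<omega>)\<^sup>2 \<partial>M) / area S) / 2))))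
     \<le> \<bar>s\<bar> * (\<delta> * sqrt R) + s\<^sup>2 * C / sqrt (area S) + s\<^sup>2 * (3 * \<delta> * R) / 2"
      by (simp only: sZ_def Z_def a_def)
  qed
qed

section \<open>Covariance of the centred indicator and the limiting variance\<close>

definition centred_indicator :: "real \<Rightarrow> real \<Rightarrow> real" where
  "centred_indicator u x = indicator {u / \<sigma>..} x - measure std_normal_distribution {u / \<sigma>..}"

lemma centred_indicator_limit: "ctrig_limit (u / \<sigma>) (centred_indicator u)"
  unfolding centred_indicator_def[abs_def] by (rule ctrig_limit_indicator)

lemma centred_indicator_measurable [measurable]: "centred_indicator u \<in> borel_measurable borel"
  using centred_indicator_limit by (simp add: ctrig_limit_def)

lemma centred_indicator_le: "\<bar>centred_indicator u x\<bar> \<le> 1"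
proof -
  interpret N: prob_space std_normal_distribution by (rule prob_space_std_normal)
  have "0 \<le> N.prob {u / \<sigma>..}" "N.prob {u / \<sigma>..} \<le> 1" by auto
  then show ?thesis by (auto simp: centred_indicator_def indicator_def)
qed

definition indicator_cov :: "real \<Rightarrow> real^2 \<Rightarrow> real" where
  "indicator_cov u x = (\<integral>\<omega>. centred_indicator u (gn 0 \<omega>) * centred_indicator u (gn x \<omega>) \<partial>M)"

lemma indicator_cov_measurable [measurable]: "indicator_cov u \<in> borel_measurable borel"
  unfolding indicator_cov_def by measurable

text \<open>Both pairs have correlation \<open>rho (s - t)\<close>, and the moment depends on a pair
  through its correlation alone.\<close>

lemma indicator_cov_stationary:
  "(\<integral>\<omega>. centred_indicator u (gn t \<omega>) * centred_indicator u (gn s \<omega>) \<partial>M) = indicator_cov u (s - t)"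
  unfolding indicator_cov_def
  by (rule std_gaussian_pair.ctrig_limit_moment_unique[OF gn_pair centred_indicator_limit])
     (use gn_pair[of 0 "s - t"] in simp)

lemma indicator_cov_le: "\<bar>indicator_cov u x\<bar> \<le> \<bar>rho x\<bar>"
proof -
  have "\<bar>indicator_cov u x\<bar> \<le> \<bar>rho x\<bar> * (\<integral>x. (centred_indicator u x)\<^sup>2 \<partial>std_normal_distribution)"
    using std_gaussian_pair.gebelein_limit[OF gn_pair[of 0 x] centred_indicator_limit[of u]] by (simp add: indicator_cov_def)
  also have "\<dots> \<le> \<bar>rho x\<bar> * 1"
    by (intro mult_left_mono sup_norm_integral_sq_le centred_indicator_le) auto
  finally show ?thesis by simp
qed

lemma indicator_cov_integrable: "integrable lborel rho \<Longrightarrow> integrable lborel (indicator_cov u)"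
  using indicator_cov_le by (elim Bochner_Integration.integrable_bound) auto

text \<open>Plackett's identity holds at every \<open>t \<noteq> 0\<close>; the origin, where the
  correlation is 1, is a null set.\<close>

lemma integral_indicator_cov:
  assumes rho1: "\<And>t. t \<noteq> 0 \<Longrightarrow> \<bar>rho t\<bar> < 1"
  shows "(\<integral>x. indicator_cov u x \<partial>lborel) = asymptotic_variance \<sigma> (field_cov M g) u"
proof -
  define L where "L t = (LBINT s=0..ereal (rho t). 1 / sqrt (1 - s\<^sup>2) * exp (- (u\<^sup>2 / (\<sigma>\<^sup>2 * (1 + s)))))" for t
  have cL: "indicator_cov u t = 1 / (2 * pi) * L t" if "t \<noteq> 0" for t
  proof -
    have "(u / \<sigma>)\<^sup>2 / (1 + s) = u\<^sup>2 / (\<sigma>\<^sup>2 * (1 + s))" for s by (simp add: power_divide)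
    then show ?thesis
      using std_gaussian_pair.plackett[OF gn_pair[of 0 t], of "u / \<sigma>"] rho1[OF that]
      by (simp add: indicator_cov_def centred_indicator_def L_def)
  qed
  \<comment> \<open>Measurability of the parametrised interval integral is borrowed from
    \<open>indicator_cov\<close>, with which it agrees off the origin up to a factor.\<close>
  have "L = (\<lambda>t. if t = 0 then L 0 else 2 * pi * indicator_cov u t)"
    using cL by (auto simp: fun_eq_iff)
  moreover have "(\<lambda>t. if t = 0 then L 0 else 2 * pi * indicator_cov u t) \<in> borel_measurable borel"
    by measurable
  ultimately have L_meas [measurable]: "L \<in> borel_measurable borel" by simp
  have "(\<integral>x. indicator_cov u x \<partial>lborel) = (\<integral>x. 1 / (2 * pi) * L x \<partial>lborel)"
    using AE_lborel_singleton[of "0 :: real^2"] cL by (intro integral_cong_AE) (auto elim!: eventually_mono)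
  also have "\<dots> = 1 / (2 * pi) * (\<integral>x. L x \<partial>lborel)" by (rule Bochner_Integration.integral_mult_right_zero)
  finally show ?thesis unfolding asymptotic_variance_def L_def rho_def .
qed

lemma area_integral_second_moment:
  assumes S: "S \<in> sets borel" "bounded S"
  shows "(\<integral>\<omega>. (area_integral (centred_indicator u) S \<omega>)\<^sup>2 \<partial>M)
     = (\<integral>t. indicator S t * (\<integral>s. indicator S s * indicator_cov u (s - t) \<partial>lborel) \<partial>lborel)"
proof -
  interpret mu: finite_measure "restrict_space lborel S" by (rule finite_measure_restrict[OF S])
  note fst_restrict_measurable[measurable]
  let ?Z = "\<lambda>t \<omega>. complex_of_real (centred_indicator u (gn t \<omega>))"
  have "complex_of_real (\<integral>\<omega>. (norm (\<integral>t. ?Z t \<omega> \<partial>restrict_space lborel S))\<^sup>2 \<partial>M)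
     = (\<integral>t. (\<integral>s. (\<integral>\<omega>. ?Z t \<omega> * cnj (?Z s \<omega>) \<partial>M) \<partial>restrict_space lborel S) \<partial>restrict_space lborel S)"
  proof (rule second_moment_integral_eq[OF mu.finite_measure_axioms])
    show "(\<lambda>(t, \<omega>). ?Z t \<omega>) \<in> borel_measurable (restrict_space lborel S \<Otimes>\<^sub>M M)" by measurable
    show "norm (?Z t \<omega>) \<le> 1" for t \<omega> using centred_indicator_le by simp
  qed
  also have "\<dots> = of_real (\<integral>t. (\<integral>s. indicator_cov u (s - t) \<partial>restrict_space lborel S) \<partial>restrict_space lborel S)"
    by (simp only: complex_cnj_complex_of_real of_real_mult[symmetric] integral_complex_of_real indicator_cov_stationary)
  finally have "(\<integral>\<omega>. (norm (\<integral>t. ?Z t \<omega> \<partial>restrict_space lborel S))\<^sup>2 \<partial>M)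
     = (\<integral>t. (\<integral>s. indicator_cov u (s - t) \<partial>restrict_space lborel S) \<partial>restrict_space lborel S)"
    unfolding of_real_eq_iff .
  moreover have "(norm (\<integral>t. ?Z t \<omega> \<partial>restrict_space lborel S))\<^sup>2 = (area_integral (centred_indicator u) S \<omega>)\<^sup>2" for \<omega>
    unfolding integral_complex_of_real norm_of_real power2_abs area_integral_def ..
  ultimately show ?thesis using S by (simp add: integral_restrict_space)
qed

lemma variance_limit:
  assumes rho: "integrable lborel rho" and rho1: "\<And>t. t \<noteq> 0 \<Longrightarrow> \<bar>rho t\<bar> < 1"
    and T: "T \<in> sets borel" "bounded T" "convex T" "0 < area T"
  shows "(\<lambda>n. (\<integral>\<omega>. (area_integral (centred_indicator u) ((*\<^sub>R) (real n) ` T) \<omega>)\<^sup>2 \<partial>M) / area ((*\<^sub>R) (real n) ` T))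
     \<longlonglongrightarrow> asymptotic_variance \<sigma> (field_cov M g) u"
proof (rule Lim_transform_eventually)
  show "(\<lambda>n. (1 / (real n ^ 2 * area T)) *
      (\<integral>t. indicator ((*\<^sub>R) (real n) ` T) t * (\<integral>s. indicator ((*\<^sub>R) (real n) ` T) s * indicator_cov u (s - t) \<partial>lborel) \<partial>lborel))
     \<longlonglongrightarrow> asymptotic_variance \<sigma> (field_cov M g) u"
    using scaled_set_average[OF indicator_cov_integrable[OF rho] T, of u] integral_indicator_cov[OF rho1, of u] by simp
  show "\<forall>\<^sub>F n in sequentially. (1 / (real n ^ 2 * area T)) *
      (\<integral>t. indicator ((*\<^sub>R) (real n) ` T) t * (\<integral>s. indicator ((*\<^sub>R) (real n) ` T) s * indicator_cov u (s - t) \<partial>lborel) \<partial>lborel)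
     = (\<integral>\<omega>. (area_integral (centred_indicator u) ((*\<^sub>R) (real n) ` T) \<omega>)\<^sup>2 \<partial>M) / area ((*\<^sub>R) (real n) ` T)"
    using eventually_ge_at_top[of 1]
  proof eventually_elim
    case (elim n)
    then have "real n > 0" by simp
    note sc = area_scaled_set[OF this T(1)]
    have "bounded ((*\<^sub>R) (real n) ` T)" using T(2) by (rule bounded_scaling)
    then show ?case by (simp add: area_integral_second_moment[OF sc(1)] sc(2))
  qed
qed

lemma char_limit_unperturbed:
  assumes rho: "integrable lborel rho" and rho1: "\<And>t. t \<noteq> 0 \<Longrightarrow> \<bar>rho t\<bar> < 1"
    and T: "T \<in> sets borel" "bounded T" "convex T" "0 < area T"
  shows "(\<lambda>n. \<integral>\<omega>. cis (s * (area_integral (centred_indicator u) ((*\<^sub>R) (real n) ` T) \<omega> / sqrt (area ((*\<^sub>R) (real n) ` T)))) \<partial>M)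
     \<longlonglongrightarrow> of_real (exp (- (s\<^sup>2 * asymptotic_variance \<sigma> (field_cov M g) u / 2)))"
proof (rule LIMSEQ_I)
  fix r :: real assume r: "r > 0"
  define S where "S n = (*\<^sub>R) (real n) ` T" for n
  define v where "v = asymptotic_variance \<sigma> (field_cov M g) u"
  define V where "V n = (\<integral>\<omega>. (area_integral (centred_indicator u) (S n) \<omega>)\<^sup>2 \<partial>M) / area (S n)" for n
  define R where "R = (\<integral>x. \<bar>rho x\<bar> \<partial>lborel)"
  have R0: "0 \<le> R" by (simp add: R_def)
  \<comment> \<open>\<open>B\<close> collects the coefficients of \<delta> in
    \<open>char_bound_limit\<close>, with 1 added to keep it positive. \<delta> is determined by
    \<open>r\<close> before the constant \<open>C\<close>, which depends on it, is obtained; only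
    then does \<open>n\<close> grow.\<close>
  define B where "B = \<bar>s\<bar> * sqrt R + s\<^sup>2 * (3 * R) / 2 + 1"
  have B: "B > 0" using R0 by (simp add: B_def add_nonneg_pos)
  define \<delta> where "\<delta> = min 1 (r / (3 * B))"
  have \<delta>: "0 < \<delta>" "\<delta> \<le> 1" "\<delta> * B \<le> r / 3" using r B by (auto simp: \<delta>_def min_def field_simps)
  obtain C where C: "\<And>S s. S \<in> sets borel \<Longrightarrow> bounded S \<Longrightarrow> 0 < area S \<Longrightarrow>
     norm ((\<integral>\<omega>. cis (s * (area_integral (centred_indicator u) S \<omega> / sqrt (area S))) \<partial>M)
       - of_real (exp (- (s\<^sup>2 * ((\<integral>\<omega>. (area_integral (centred_indicator u) S \<omega>)\<^sup>2 \<partial>M) / area S) / 2))))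
     \<le> \<bar>s\<bar> * (\<delta> * sqrt R) + s\<^sup>2 * C / sqrt (area S) + s\<^sup>2 * (3 * \<delta> * R) / 2"
    unfolding R_def using char_bound_limit[OF rho centred_indicator_limit centred_indicator_le \<delta>(1,2)] by metis
  have sc: "S n \<in> sets borel" "area (S n) = (real n)\<^sup>2 * area T" "bounded (S n)" "0 < area (S n)" if "n \<ge> 1" for n
  proof -
    have "real n > 0" using that by simp
    note e = area_scaled_set[OF this T(1)]
    show "S n \<in> sets borel" "area (S n) = (real n)\<^sup>2 * area T" using e by (auto simp: S_def)
    then show "0 < area (S n)" using T(4) that by simp
    show "bounded (S n)" unfolding S_def using T(2) by (rule bounded_scaling)
  qed
  have "(\<lambda>n. s\<^sup>2 * C / (real n * sqrt (area T))) \<longlonglongrightarrow> 0"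
    using T(4) by real_asymp
  then have e1: "\<forall>\<^sub>F n in sequentially. s\<^sup>2 * C / (real n * sqrt (area T)) < r / 3"
    using r by (intro order_tendstoD) auto
  have "V \<longlonglongrightarrow> v" using variance_limit[OF rho rho1 T] by (simp add: V_def[abs_def] S_def v_def)
  then have ex: "(\<lambda>n. complex_of_real (exp (- (s\<^sup>2 * V n / 2)))) \<longlonglongrightarrow> of_real (exp (- (s\<^sup>2 * v / 2)))"
    by (intro tendsto_intros) auto
  have e2: "\<forall>\<^sub>F n in sequentially. norm (complex_of_real (exp (- (s\<^sup>2 * V n / 2))) - of_real (exp (- (s\<^sup>2 * v / 2)))) < r / 3"
    using r tendstoD[OF ex, of "r / 3"] by (simp add: dist_norm)
  have "\<forall>\<^sub>F n in sequentially. norm ((\<integral>\<omega>. cis (s * (area_integral (centred_indicator u) (S n) \<omega> / sqrt (area (S n)))) \<partial>M) - of_real (exp (- (s\<^sup>2 * v / 2)))) < r"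
    using e1 e2 eventually_ge_at_top[of 1]
  proof eventually_elim
    case (elim n)
    have "norm ((\<integral>\<omega>. cis (s * (area_integral (centred_indicator u) (S n) \<omega> / sqrt (area (S n)))) \<partial>M) - of_real (exp (- (s\<^sup>2 * V n / 2))))
      \<le> \<bar>s\<bar> * (\<delta> * sqrt R) + s\<^sup>2 * C / sqrt (area (S n)) + s\<^sup>2 * (3 * \<delta> * R) / 2"
      unfolding V_def by (rule C[OF sc(1,3,4)[OF elim(3)]])
    also have "\<dots> \<le> \<delta> * B + s\<^sup>2 * C / (real n * sqrt (area T))"
    proof -
      have "sqrt (area (S n)) = real n * sqrt (area T)" by (simp add: sc(2)[OF elim(3)] real_sqrt_mult)
      moreover have "\<bar>s\<bar> * (\<delta> * sqrt R) + s\<^sup>2 * (3 * \<delta> * R) / 2 \<le> \<delta> * B"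
        using \<delta>(1) by (simp add: B_def field_simps)
      ultimately show ?thesis by simp
    qed
    also have "\<dots> < r / 3 + r / 3" using \<delta>(3) elim(1) by linarith
    finally have 1: "norm ((\<integral>\<omega>. cis (s * (area_integral (centred_indicator u) (S n) \<omega> / sqrt (area (S n)))) \<partial>M) - of_real (exp (- (s\<^sup>2 * V n / 2)))) < r / 3 + r / 3" .
    have "norm (p - z) < r" if "norm (p - q) < r / 3 + r / 3" "norm (q - z) < r / 3" for p q z :: complex
      using norm_triangle_ineq[of "p - q" "q - z"] that by simp
    from this[OF 1 elim(2)] show ?case .
  qed
  then show "\<exists>no. \<forall>n\<ge>no. norm ((\<integral>\<omega>. cis (s * (area_integral (centred_indicator u) ((*\<^sub>R) (real n) ` T) \<omega> / sqrt (area ((*\<^sub>R) (real n) ` T)))) \<partial>M)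
      - of_real (exp (- (s\<^sup>2 * asymptotic_variance \<sigma> (field_cov M g) u / 2)))) < r"
    by (simp add: eventually_sequentially S_def v_def)
qed

end

section \<open>The effect of the perturbation on the area\<close>

lemma measure_std_normal_Icc_le: "0 \<le> d \<Longrightarrow> measure std_normal_distribution {a - d..a + d} \<le> 2 * d"
proof -
  assume d: "0 \<le> d"
  interpret prob_space std_normal_distribution by (rule prob_space_std_normal)
  have "prob {a - d..a + d} = (\<integral>x. indicator {a - d..a + d} x \<partial>std_normal_distribution)" by simp
  also have "\<dots> = (\<integral>x. std_normal_density x * indicator {a - d..a + d} x \<partial>lborel)"
    by (rule integral_std_normal) simp
  also have "\<dots> \<le> (\<integral>x. indicator {a - d..a + d} x \<partial>lborel)"
  proof (rule integral_mono')
    show "std_normal_density x * indicator {a - d..a + d} x \<le> indicator {a - d..a + d} x" for x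
      by (simp add: indicator_def std_normal_density_le)
    show "integrable lborel (indicator {a - d..a + d} :: real \<Rightarrow> real)"
      by (rule integrable_real_indicator) (auto simp: emeasure_lborel_Icc_eq)
  qed simp
  also have "\<dots> = 2 * d" using d by simp
  finally show ?thesis .
qed

lemma measurable_Collect_near: "{z :: real \<times> real. \<bar>snd z - a\<bar> \<le> e * \<bar>fst z\<bar>} \<in> sets (borel \<Otimes>\<^sub>M borel)"
proof -
  have "{z \<in> space (borel \<Otimes>\<^sub>M borel). \<bar>snd z - a\<bar> \<le> e * \<bar>fst z :: real\<bar>} \<in> sets (borel \<Otimes>\<^sub>M borel)"
    by measurable
  then show ?thesis by (simp add: space_pair_measure)
qed

lemma normal_law_char:
  assumes "0 \<le> v"
  shows "real_distribution (normal_law 0 v)" "char (normal_law 0 v) s = of_real (exp (- (s\<^sup>2 * v / 2)))"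
proof -
  have "prob_space (normal_law 0 v)"
    using assms by (auto simp: normal_law_def intro: prob_space_return prob_space_normal_density)
  moreover have "sets (normal_law 0 v) = sets borel" by (simp add: normal_law_def)
  ultimately show "real_distribution (normal_law 0 v)"
    by (simp add: real_distribution_def real_distribution_axioms_def)
  show "char (normal_law 0 v) s = of_real (exp (- (s\<^sup>2 * v / 2)))"
    using normal_law_cis[OF assms, of s] by (simp add: char_def cis_conv_exp)
qed

context stationary_gaussian_field begin

lemma gn_distr: "distr M borel (gn t) = std_normal_distribution"
  using std_gaussian_pair.distr_X[OF gn_pair] .

text \<open>With \<open>Y = e / \<sigma> * X\<close> this is the excursion area of the perturbed
  field, with \<open>Y = 0\<close> that of the unperturbed one; dividing the level by \<sigma>
  matches the unit variance of \<open>gn\<close>.\<close>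

definition level_area :: "('w \<Rightarrow> real) \<Rightarrow> real \<Rightarrow> (real^2) set \<Rightarrow> 'w \<Rightarrow> real" where
  "level_area Y u S \<omega> = (\<integral>t. indicator {u / \<sigma>..} (gn t \<omega> + Y \<omega>) \<partial>restrict_space lborel S)"

lemma level_area_facts:
  assumes S: "S \<in> sets borel" "bounded S" and [measurable]: "Y \<in> borel_measurable M"
  shows "level_area Y u S \<in> borel_measurable M" "0 \<le> level_area Y u S \<omega>" "level_area Y u S \<omega> \<le> area S"
proof -
  interpret mu: finite_measure "restrict_space lborel S" by (rule finite_measure_restrict[OF S])
  note snd_restrict_measurable[measurable]
  show "level_area Y u S \<in> borel_measurable M"
    unfolding level_area_def by (rule mu.borel_measurable_lebesgue_integral) measurable
  show "0 \<le> level_area Y u S \<omega>" unfolding level_area_def by (rule integral_nonneg_AE) auto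
  have "norm (level_area Y u S \<omega>) \<le> (\<integral>t. 1 \<partial>restrict_space lborel S)"
    unfolding level_area_def by (rule norm_integral_le) (auto simp: indicator_def)
  then show "level_area Y u S \<omega> \<le> area S" using measure_restrict[OF S(1)] by simp
qed

lemma level_area_integrable:
  assumes S: "S \<in> sets borel" "bounded S" and Y: "Y \<in> borel_measurable M"
  shows "integrable M (level_area Y u S)"
  using level_area_facts[OF assms] by (intro integrable_const_bound[where B="area S"]) auto

lemma excursion_area_perturbed:
  assumes S: "S \<in> sets borel" "bounded S" and [measurable]: "X \<in> borel_measurable M" and \<omega>: "\<omega> \<in> space M"
  shows "excursion_area S (\<lambda>t. perturbed_field g X e t \<omega>) u = level_area (\<lambda>\<omega>. e / \<sigma> * X \<omega>) u S \<omega> / area S"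
proof -
  note restrict_id_measurable[measurable] \<omega>[measurable]
  have *: "perturbed_field g X e t \<omega> \<ge> u \<longleftrightarrow> gn t \<omega> + e / \<sigma> * X \<omega> \<in> {u / \<sigma>..}" for t
  proof -
    have "gn t \<omega> + e / \<sigma> * X \<omega> = perturbed_field g X e t \<omega> / \<sigma>"
      by (simp add: gn_def perturbed_field_def add_divide_distrib)
    then show ?thesis using \<sigma>_pos by (simp add: divide_le_cancel)
  qed
  have E: "{t \<in> S. perturbed_field g X e t \<omega> \<ge> u} = S \<inter> {t. gn t \<omega> + e / \<sigma> * X \<omega> \<in> {u / \<sigma>..}}"
    using * by blast
  have [measurable]: "{t. gn t \<omega> + e / \<sigma> * X \<omega> \<in> {u / \<sigma>..}} \<in> sets borel"
    by measurable
  have "area {t \<in> S. perturbed_field g X e t \<omega> \<ge> u} = (\<integral>t. indicator (S \<inter> {t. gn t \<omega> + e / \<sigma> * X \<omega> \<in> {u / \<sigma>..}}) t \<partial>lborel)"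
    unfolding E using S by simp
  also have "\<dots> = (\<integral>t. indicator S t *\<^sub>R indicator {u / \<sigma>..} (gn t \<omega> + e / \<sigma> * X \<omega>) \<partial>lborel)"
    by (intro Bochner_Integration.integral_cong refl) (simp add: indicator_def)
  also have "\<dots> = level_area (\<lambda>\<omega>. e / \<sigma> * X \<omega>) u S \<omega>"
    unfolding level_area_def using S by (simp add: integral_restrict_space)
  finally show ?thesis by (simp add: excursion_area_def)
qed

lemma normalized_area_perturbed:
  assumes S: "S \<in> sets borel" "bounded S" and X: "X \<in> borel_measurable M" and \<omega>: "\<omega> \<in> space M"
  shows "normalized_area M (perturbed_field g X e) S u \<omega> =
    (level_area (\<lambda>\<omega>. e / \<sigma> * X \<omega>) u S \<omega> - expectation (level_area (\<lambda>\<omega>. e / \<sigma> * X \<omega>) u S)) / sqrt (area S)"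
proof -
  have "(\<integral>\<omega>'. excursion_area S (\<lambda>t. perturbed_field g X e t \<omega>') u \<partial>M)
     = (\<integral>\<omega>'. level_area (\<lambda>\<omega>. e / \<sigma> * X \<omega>) u S \<omega>' / area S \<partial>M)"
    by (intro Bochner_Integration.integral_cong refl excursion_area_perturbed[OF S X])
  then have "normalized_area M (perturbed_field g X e) S u \<omega> =
    sqrt (area S) * ((level_area (\<lambda>\<omega>. e / \<sigma> * X \<omega>) u S \<omega> - expectation (level_area (\<lambda>\<omega>. e / \<sigma> * X \<omega>) u S)) / area S)"
    unfolding normalized_area_def excursion_area_perturbed[OF S X \<omega>] by (simp add: diff_divide_distrib)
  also have "\<dots> = (level_area (\<lambda>\<omega>. e / \<sigma> * X \<omega>) u S \<omega> - expectation (level_area (\<lambda>\<omega>. e / \<sigma> * X \<omega>) u S)) * (sqrt (area S) / area S)"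
    by simp
  \<comment> \<open>For area 0 both sides are 0, division by 0 being 0; this covers the degenerate
    window at index 0.\<close>
  also have "sqrt (area S) / area S = 1 / sqrt (area S)"
    by (cases "area S = 0") (auto simp: real_div_sqrt divide_simps)
  finally show ?thesis by simp
qed

text \<open>Each \<open>gn t\<close> is standard normal, so by Fubini's theorem the mean area is
  \<open>area S\<close> times the normal tail: centring the integrand at each \<open>t\<close> is
  the same as centring the integral.\<close>

lemma area_integral_level_area:
  assumes S: "S \<in> sets borel" "bounded S" and \<omega>: "\<omega> \<in> space M"
  shows "area_integral (centred_indicator u) S \<omega> = level_area (\<lambda>_. 0) u S \<omega> - expectation (level_area (\<lambda>_. 0) u S)"
proof -
  interpret mu: finite_measure "restrict_space lborel S" by (rule finite_measure_restrict[OF S])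
  note restrict_id_measurable[measurable] fst_restrict_measurable[measurable]
  let ?p = "measure std_normal_distribution {u / \<sigma>..}"
  have "integrable (restrict_space lborel S) (\<lambda>t. indicator {u / \<sigma>..} (gn t \<omega>) :: real)"
    by (rule mu.integrable_const_bound[where B=1]) (use \<omega> in \<open>auto simp: indicator_def\<close>)
  then have 1: "area_integral (centred_indicator u) S \<omega> = level_area (\<lambda>_. 0) u S \<omega> - ?p * area S"
    unfolding area_integral_def centred_indicator_def level_area_def
    using measure_restrict[OF S(1)] by (simp add: mult.commute)
  have "expectation (level_area (\<lambda>_. 0) u S) = (\<integral>t. (\<integral>\<omega>. indicator {u / \<sigma>..} (gn t \<omega> + 0) \<partial>M) \<partial>restrict_space lborel S)"
    unfolding level_area_def[abs_def]
    by (rule Fubini_bounded_swap[OF mu.finite_measure_axioms finite_measure_axioms, where k="\<lambda>_. 1"])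
       (auto simp: indicator_def)
  also have "\<dots> = (\<integral>t. ?p \<partial>restrict_space lborel S)"
  proof (intro Bochner_Integration.integral_cong refl)
    fix t
    have "(\<integral>\<omega>. indicator {u / \<sigma>..} (gn t \<omega> + 0) \<partial>M) = (\<integral>x. (indicator {u / \<sigma>..} x :: real) \<partial>distr M borel (gn t))"
      by (subst integral_distr) auto
    then show "(\<integral>\<omega>. indicator {u / \<sigma>..} (gn t \<omega> + 0) \<partial>M) = ?p" unfolding gn_distr by simp
  qed
  finally show ?thesis using 1 measure_restrict[OF S(1)] by (simp add: mult.commute)
qed

text \<open>Independence from the sigma-algebra of the whole field passes to the smaller one
  generated by the single value \<open>gn t\<close>, and then turns the joint law into a
  product.\<close>

lemma indep_gn:
  assumes ind: "indep_of_field M X g" and X: "X \<in> borel_measurable M"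
  shows "distr M (borel \<Otimes>\<^sub>M borel) (\<lambda>\<omega>. (X \<omega>, gn t \<omega>)) = distr M borel X \<Otimes>\<^sub>M std_normal_distribution"
proof -
  let ?A = "sets (vimage_algebra (space M) X borel)"
  let ?B = "sets (vimage_algebra (space M) (\<lambda>\<omega> t. g t \<omega>) (\<Pi>\<^sub>M t\<in>UNIV. borel))"
  have AB: "indep_set ?A ?B" using ind by (simp add: indep_of_field_def)
  have gm: "gn t \<in> measurable (vimage_algebra (space M) (\<lambda>\<omega> t. g t \<omega>) (\<Pi>\<^sub>M t\<in>UNIV. borel)) borel"
  proof -
    have "(\<lambda>\<omega> t. g t \<omega>) \<in> measurable (vimage_algebra (space M) (\<lambda>\<omega> t. g t \<omega>) (\<Pi>\<^sub>M t\<in>UNIV. borel)) (\<Pi>\<^sub>M t\<in>UNIV. borel)"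
      by (rule measurable_vimage_algebra1) (auto simp: space_PiM)
    from measurable_compose[OF this measurable_component_singleton[of t]]
    have "g t \<in> measurable (vimage_algebra (space M) (\<lambda>\<omega> t. g t \<omega>) (\<Pi>\<^sub>M t\<in>UNIV. borel)) borel" by simp
    then show ?thesis unfolding gn_def[abs_def] by measurable
  qed
  have "indep_set (sigma_sets (space M) {X -` A \<inter> space M | A. A \<in> sets borel})
      (sigma_sets (space M) {gn t -` A \<inter> space M | A. A \<in> sets borel})"
  proof -
    have 1: "sigma_sets (space M) {X -` A \<inter> space M | A. A \<in> sets borel} = ?A"
      by (simp add: sets_vimage_algebra)
    have 2: "sigma_sets (space M) {gn t -` A \<inter> space M | A. A \<in> sets borel} \<subseteq> ?B"
    proof -
      have "{gn t -` A \<inter> space M | A. A \<in> sets borel} \<subseteq> ?B"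
        using measurable_sets[OF gm] by auto
      then show ?thesis
        using sets.sigma_sets_subset[of _ "vimage_algebra (space M) (\<lambda>\<omega> t. g t \<omega>) (\<Pi>\<^sub>M t\<in>UNIV. borel)"] by simp
    qed
    show ?thesis using AB 2 unfolding 1 indep_sets2_eq by blast
  qed
  moreover have "gn t \<in> borel_measurable M" by measurable
  ultimately have "indep_var borel X borel (gn t)" using X by (simp add: indep_var_eq)
  then show ?thesis unfolding gn_distr[of t, symmetric] by (simp add: indep_var_distribution_eq)
qed

text \<open>Given \<open>X = x\<close>, the event asks a standard normal variable to lie in an
  interval of length \<open>2 * e * \<bar>x\<bar>\<close>, whose probability is at most that length
  because the density is at most 1.\<close>

lemma expectation_near_level_le:
  assumes ind: "indep_of_field M X g" and [measurable]: "X \<in> borel_measurable M" and Xint: "integrable M X" and e: "0 \<le> e"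
  shows "(\<integral>\<omega>. indicator {z. \<bar>snd z - a\<bar> \<le> e * \<bar>fst z\<bar>} (X \<omega>, gn t \<omega>) \<partial>M) \<le> 2 * e * (\<integral>\<omega>. \<bar>X \<omega>\<bar> \<partial>M)"
proof -
  let ?E = "{z :: real \<times> real. \<bar>snd z - a\<bar> \<le> e * \<bar>fst z\<bar>}"
  let ?I = "indicator ?E :: real \<times> real \<Rightarrow> real"
  have [measurable]: "?E \<in> sets (borel \<Otimes>\<^sub>M borel)"
    by (rule measurable_Collect_near)
  interpret N: prob_space std_normal_distribution by (rule prob_space_std_normal)
  interpret DX: prob_space "distr M borel X" by (rule prob_space_distr) simp
  have "(\<integral>\<omega>. ?I (X \<omega>, gn t \<omega>) \<partial>M) = (\<integral>z. ?I z \<partial>distr M (borel \<Otimes>\<^sub>M borel) (\<lambda>\<omega>. (X \<omega>, gn t \<omega>)))"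
    by (subst integral_distr) auto
  also have "\<dots> = (\<integral>z. ?I (fst z, snd z) \<partial>(distr M borel X \<Otimes>\<^sub>M std_normal_distribution))"
    unfolding indep_gn[OF ind assms(2)] by simp
  also have "\<dots> = (\<integral>x. (\<integral>y. ?I (x, y) \<partial>std_normal_distribution) \<partial>distr M borel X)"
    by (rule Fubini_bounded_pair[OF DX.finite_measure_axioms N.finite_measure_axioms, where k="\<lambda>_. 1"])
       (auto simp: indicator_def)
  also have "\<dots> = (\<integral>x. measure std_normal_distribution {a - e * \<bar>x\<bar>..a + e * \<bar>x\<bar>} \<partial>distr M borel X)"
  proof (intro Bochner_Integration.integral_cong refl)
    fix x
    have "?I (x, y) = (indicator {a - e * \<bar>x\<bar>..a + e * \<bar>x\<bar>} y :: real)" for y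
      by (auto simp: indicator_def abs_le_iff)
    then show "(\<integral>y. ?I (x, y) \<partial>std_normal_distribution) = measure std_normal_distribution {a - e * \<bar>x\<bar>..a + e * \<bar>x\<bar>}"
      by simp
  qed
  also have "\<dots> \<le> (\<integral>x. 2 * (e * \<bar>x\<bar>) \<partial>distr M borel X)"
    using Xint e by (intro integral_mono' measure_std_normal_Icc_le) (auto simp: integrable_distr_eq)
  also have "\<dots> = 2 * e * (\<integral>\<omega>. \<bar>X \<omega>\<bar> \<partial>M)" by (simp add: integral_distr)
  finally show ?thesis .
qed

text \<open>The shift \<open>e * X\<close> moves a value across the level only if the value lies
  within \<open>e * \<bar>X\<bar>\<close> of the level. The area where this happens is averaged by
  Fubini's theorem.\<close>

lemma level_area_perturbation:
  assumes S: "S \<in> sets borel" "bounded S"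
    and ind: "indep_of_field M X g" and X [measurable]: "X \<in> borel_measurable M" and Xint: "integrable M X" and e: "0 \<le> e"
  shows "(\<integral>\<omega>. \<bar>level_area (\<lambda>\<omega>. e * X \<omega>) u S \<omega> - level_area (\<lambda>_. 0) u S \<omega>\<bar> \<partial>M) \<le> 2 * e * (\<integral>\<omega>. \<bar>X \<omega>\<bar> \<partial>M) * area S"
proof -
  interpret mu: finite_measure "restrict_space lborel S" by (rule finite_measure_restrict[OF S])
  note restrict_id_measurable[measurable] fst_restrict_measurable[measurable] snd_restrict_measurable[measurable]
  let ?E = "{z :: real \<times> real. \<bar>snd z - u / \<sigma>\<bar> \<le> e * \<bar>fst z\<bar>}"
  let ?I = "indicator ?E :: real \<times> real \<Rightarrow> real"
  have [measurable]: "?E \<in> sets (borel \<Otimes>\<^sub>M borel)"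
    by (rule measurable_Collect_near)
  have int: "integrable M (\<lambda>\<omega>. \<integral>t. ?I (X \<omega>, gn t \<omega>) \<partial>restrict_space lborel S)"
  proof (rule integrable_const_bound)
    show "AE \<omega> in M. norm (\<integral>t. ?I (X \<omega>, gn t \<omega>) \<partial>restrict_space lborel S) \<le> (\<integral>t. 1 \<partial>restrict_space lborel S)"
      by (intro AE_I2 norm_integral_le) (auto simp: indicator_def)
    show "(\<lambda>\<omega>. \<integral>t. ?I (X \<omega>, gn t \<omega>) \<partial>restrict_space lborel S) \<in> borel_measurable M"
      by (rule mu.borel_measurable_lebesgue_integral) measurable
  qed
  have "(\<integral>\<omega>. \<bar>level_area (\<lambda>\<omega>. e * X \<omega>) u S \<omega> - level_area (\<lambda>_. 0) u S \<omega>\<bar> \<partial>M)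
     \<le> (\<integral>\<omega>. (\<integral>t. ?I (X \<omega>, gn t \<omega>) \<partial>restrict_space lborel S) \<partial>M)"
  proof (rule integral_mono'[OF int])
    fix \<omega> assume \<omega>[measurable]: "\<omega> \<in> space M"
    have I: "integrable (restrict_space lborel S) (\<lambda>t. indicator {u / \<sigma>..} (gn t \<omega> + y) :: real)" for y
      by (rule mu.integrable_const_bound[where B=1]) (auto simp: indicator_def)
    have "level_area (\<lambda>\<omega>. e * X \<omega>) u S \<omega> - level_area (\<lambda>_. 0) u S \<omega>
       = (\<integral>t. indicator {u / \<sigma>..} (gn t \<omega> + e * X \<omega>) - indicator {u / \<sigma>..} (gn t \<omega> + 0) \<partial>restrict_space lborel S)"
      unfolding level_area_def by (rule Bochner_Integration.integral_diff[OF I I, symmetric])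
    moreover have "norm (\<integral>t. indicator {u / \<sigma>..} (gn t \<omega> + e * X \<omega>) - (indicator {u / \<sigma>..} (gn t \<omega> + 0) :: real) \<partial>restrict_space lborel S)
       \<le> (\<integral>t. ?I (X \<omega>, gn t \<omega>) \<partial>restrict_space lborel S)"
    proof (rule norm_integral_le)
      show "integrable (restrict_space lborel S) (\<lambda>t. ?I (X \<omega>, gn t \<omega>) :: real)"
        by (rule mu.integrable_const_bound[where B=1]) (auto simp: indicator_def)
      fix t
      have eX: "e * \<bar>X \<omega>\<bar> = \<bar>e * X \<omega>\<bar>" using e by (simp add: abs_mult)
      show "norm (indicator {u / \<sigma>..} (gn t \<omega> + e * X \<omega>) - indicator {u / \<sigma>..} (gn t \<omega> + 0) :: real) \<le> ?I (X \<omega>, gn t \<omega>)"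
      proof (cases "u / \<sigma> \<le> gn t \<omega> + e * X \<omega> \<longleftrightarrow> u / \<sigma> \<le> gn t \<omega> + 0")
        case True
        then show ?thesis by (simp add: indicator_def)
      next
        case False
        then have "\<bar>gn t \<omega> - u / \<sigma>\<bar> \<le> \<bar>e * X \<omega>\<bar>" by linarith
        then have "?I (X \<omega>, gn t \<omega>) = 1" unfolding eX[symmetric] by simp
        then show ?thesis by (simp add: indicator_def)
      qed
    qed
    ultimately show "\<bar>level_area (\<lambda>\<omega>. e * X \<omega>) u S \<omega> - level_area (\<lambda>_. 0) u S \<omega>\<bar> \<le> (\<integral>t. ?I (X \<omega>, gn t \<omega>) \<partial>restrict_space lborel S)"
      by simp
  qed (auto intro!: integral_nonneg_AE)
  also have "\<dots> = (\<integral>t. (\<integral>\<omega>. ?I (X \<omega>, gn t \<omega>) \<partial>M) \<partial>restrict_space lborel S)"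
  proof (rule Fubini_bounded_swap[OF mu.finite_measure_axioms finite_measure_axioms, where k="\<lambda>_. 1"])
    show "(\<lambda>(t, \<omega>). ?I (X \<omega>, gn t \<omega>)) \<in> borel_measurable (restrict_space lborel S \<Otimes>\<^sub>M M)" by measurable
    show "norm (?I z) \<le> 1" for z by (simp add: indicator_def)
  qed simp
  also have "\<dots> \<le> (\<integral>t. 2 * e * (\<integral>\<omega>. \<bar>X \<omega>\<bar> \<partial>M) \<partial>restrict_space lborel S)"
    using e by (intro integral_mono' expectation_near_level_le[OF ind X Xint e]) auto
  also have "\<dots> = 2 * e * (\<integral>\<omega>. \<bar>X \<omega>\<bar> \<partial>M) * area S" using measure_restrict[OF S(1)] by (simp add: mult.commute)
  finally show ?thesis .
qed

end

theorem theorem3p3: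
  fixes M :: "'w measure"
    and g :: "real^2 \<Rightarrow> 'w \<Rightarrow> real"
    and X :: "'w \<Rightarrow> real"
    and g' :: "'w \<Rightarrow> real^2"
    and \<sigma> \<kappa> \<alpha> u :: real
    and \<epsilon> :: "nat \<Rightarrow> real"
    and T :: "(real^2) set"
  assumes "prob_space M"
    and "measurable_field M g"
    and "gaussian_field M g"
    and "stationary M g"
    and "isotropic M g"
    and "prob_space.expectation M (g 0) = 0"
    and "\<sigma> > 0"
    and "prob_space.variance M (g 0) = \<sigma>\<^sup>2"
    and "\<kappa> > 0"
    and "ms_gradient_at M g 0 g'"
    and "covariance_matrix M g' = mat \<kappa>"
    and "C_k 4 (field_cov M g)"
    and "\<alpha> > 2"
    and "field_cov M g \<in> O[at_infinity](\<lambda>t. norm t powr (- \<alpha>))"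
    and "X \<in> borel_measurable M"
    and "indep_of_field M X g"
    and "integrable M (\<lambda>\<omega>. \<bar>X \<omega>\<bar> ^ 3)"
    and "prob_space.expectation M X = 0"
    and "\<And>N. N \<ge> 1 \<Longrightarrow> \<epsilon> N > 0"
    and "(\<lambda>N. real N * \<epsilon> N) \<longlonglongrightarrow> 0"
    and "bounded_rectangle T"
    and "interior T \<noteq> {}"
  shows "weak_conv_m
    (\<lambda>N. distr M borel
       (normalized_area M (perturbed_field g X (\<epsilon> N)) ((\<lambda>t. real N *\<^sub>R t) ` T) u))
    (normal_law 0 (asymptotic_variance \<sigma> (field_cov M g) u))"
proof -
  note prob = assms(1) and meas = assms(2) and gauss = assms(3) and stat = assms(4) and mean = assms(6)
    and \<sigma> = assms(7) and var = assms(8) and C4 = assms(12) and \<alpha> = assms(13) and decay = assms(14)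
    and X = assms(15) and ind = assms(16) and X3 = assms(17) and \<epsilon> = assms(19) and lim\<epsilon> = assms(20)
    and rect = assms(21) and int = assms(22)
  interpret prob_space M by (rule prob)
  interpret stationary_gaussian_field M g \<sigma>
    using meas gauss stat mean \<sigma> var by unfold_locales
  define v where "v = asymptotic_variance \<sigma> (field_cov M g) u"
  \<comment> \<open>The numeral is exposed as a successor so that one unfolding of
    \<open>C_k\<close> gives differentiability, hence continuity and measurability of the
    covariance.\<close>
  have "C_k (Suc 3) (field_cov M g)" using C4 by (simp add: eval_nat_numeral)
  then have "continuous_on UNIV (field_cov M g)"
    by (simp only: C_k.simps) (blast intro: differentiable_imp_continuous_on)
  then have [measurable]: "field_cov M g \<in> borel_measurable borel" by (rule borel_measurable_continuous_onI)
  have rho_meas: "rho \<in> borel_measurable borel" unfolding rho_def by measurable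
  obtain C b where "\<And>t. b \<le> norm t \<Longrightarrow> \<bar>field_cov M g t\<bar> \<le> C * norm t powr - \<alpha>"
    using bigo_norm_powrE[OF decay] by blast
  then have rho_decay: "\<bar>rho t\<bar> \<le> C / \<sigma>\<^sup>2 * norm t powr - \<alpha>" if "b \<le> norm t" for t
    using that \<sigma> by (simp add: rho_def divide_right_mono)
  have rho: "integrable lborel rho"
    by (rule integrable_decay[OF \<alpha> rho_meas abs_rho_le_1 rho_decay])
  have rho1: "\<bar>rho t\<bar> < 1" if "t \<noteq> 0" for t
    by (rule abs_rho_less_1[OF rho_decay \<alpha> that])
  note T = rectangle_facts[OF rect]
  have aT: "0 < area T" by (rule area_pos[OF T(2,1) int])
  have Xint: "integrable M X"
  proof (rule Bochner_Integration.integrable_bound[OF _ X])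
    show "integrable M (\<lambda>\<omega>. 1 + \<bar>X \<omega>\<bar> ^ 3)" using X3 by simp
    have "x \<le> 1 + x ^ 3" if "0 \<le> x" for x :: real
    proof (cases "x \<le> 1")
      case False
      then have "x * 1 \<le> x * x\<^sup>2" by (intro mult_left_mono) auto
      then show ?thesis by (simp add: power3_eq_cube power2_eq_square)
    qed (use that in \<open>simp add: add_increasing2\<close>)
    then show "AE \<omega> in M. norm (X \<omega>) \<le> norm (1 + \<bar>X \<omega>\<bar> ^ 3)"
      by (auto intro!: AE_I2 order_trans[OF _ abs_ge_self])
  qed
  define S where "S n = (*\<^sub>R) (real n) ` T" for n
  have S_eq: "(\<lambda>t. real n *\<^sub>R t) ` T = S n" for n by (simp add: S_def)
  \<comment> \<open>At \<open>n = 0\<close> the window collapses into the origin; it is included so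
    that the random variables below are measurable for every index.\<close>
  have S: "S n \<in> sets borel" "bounded (S n)" for n
  proof -
    show "S n \<in> sets borel"
    proof (cases "n = 0")
      case True
      have "S n \<subseteq> {0}" unfolding S_def True by auto
      then have "finite (S n)" by (rule finite_subset) simp
      then show ?thesis by (intro borel_closed finite_imp_closed)
    next
      case False
      then show ?thesis unfolding S_def using T by (intro area_scaled_set) auto
    qed
    show "bounded (S n)" unfolding S_def using T(2) by (rule bounded_scaling)
  qed
  have areaS: "area (S n) = (real n)\<^sup>2 * area T" "0 < area (S n)" if "n \<ge> 1" for n
  proof -
    show "area (S n) = (real n)\<^sup>2 * area T" unfolding S_def using that T by (intro area_scaled_set) auto
    then show "0 < area (S n)" using aT that by simp
  qed
  \<comment> \<open>The sign cannot be read off the formula, whose inner integral is negative where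
    the covariance is; it follows because \<open>v\<close> is a limit of normalised second
    moments.\<close>
  have v0: "0 \<le> v"
    unfolding v_def
    by (rule LIMSEQ_le_const[OF variance_limit[OF rho rho1 T aT]]) (auto intro!: exI[of _ 0] divide_nonneg_nonneg)
  define L where "L n = level_area (\<lambda>\<omega>. \<epsilon> n / \<sigma> * X \<omega>) u (S n)" for n
  define L0 where "L0 n = level_area (\<lambda>_. 0) u (S n)" for n
  define Y where "Y n \<omega> = (L n \<omega> - expectation (L n)) / sqrt (area (S n))" for n \<omega>
  define Z where "Z n \<omega> = area_integral (centred_indicator u) (S n) \<omega> / sqrt (area (S n))" for n \<omega>
  have eX: "(\<lambda>\<omega>. \<epsilon> n / \<sigma> * X \<omega>) \<in> borel_measurable M" for n using X by measurable
  have L_meas [measurable]: "L n \<in> borel_measurable M" "L0 n \<in> borel_measurable M" for n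
    unfolding L_def L0_def by (rule level_area_facts(1)[OF S eX], rule level_area_facts(1)[OF S]) simp
  have L_int: "integrable M (L n)" "integrable M (L0 n)" for n
    unfolding L_def L0_def by (rule level_area_integrable[OF S eX], rule level_area_integrable[OF S]) simp
  have Y_meas [measurable]: "Y n \<in> borel_measurable M" for n unfolding Y_def by measurable
  have Z_meas [measurable]: "Z n \<in> borel_measurable M" for n
    unfolding Z_def using area_integral_bounded(1)[OF S[of n] centred_indicator_measurable[of u] centred_indicator_le]
    by measurable
  have Y_eq: "normalized_area M (perturbed_field g X (\<epsilon> n)) (S n) u \<omega> = Y n \<omega>" if "\<omega> \<in> space M" for n \<omega>
    unfolding Y_def L_def by (rule normalized_area_perturbed[OF S X that])
  have distr_Y: "distr M borel (normalized_area M (perturbed_field g X (\<epsilon> n)) (S n) u) = distr M borel (Y n)" for n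
    by (intro distr_cong refl Y_eq)
  have char_Y: "char (distr M borel (Y n)) s = (\<integral>\<omega>. cis (s * Y n \<omega>) \<partial>M)" for n s
    by (simp add: char_def integral_distr cis_conv_exp)
  have YZ_int: "integrable M (\<lambda>\<omega>. \<bar>Y n \<omega> - Z n \<omega>\<bar>)"
    and YZ: "(\<integral>\<omega>. \<bar>Y n \<omega> - Z n \<omega>\<bar> \<partial>M) \<le> 4 / \<sigma> * (\<integral>\<omega>. \<bar>X \<omega>\<bar> \<partial>M) * sqrt (area T) * (real n * \<epsilon> n)" if n: "n \<ge> 1" for n
  proof -
    define D where "D \<omega> = L n \<omega> - L0 n \<omega>" for \<omega>
    have D_int: "integrable M D" unfolding D_def using L_int by simp
    have YZ_eq: "Y n \<omega> - Z n \<omega> = (D \<omega> - expectation D) / sqrt (area (S n))" if "\<omega> \<in> space M" for \<omega>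
    proof -
      have "expectation D = expectation (L n) - expectation (L0 n)" unfolding D_def using L_int by simp
      then show ?thesis
        unfolding Y_def Z_def area_integral_level_area[OF S that] D_def L0_def[symmetric] by (simp add: diff_divide_distrib)
    qed
    have "integrable M (\<lambda>\<omega>. \<bar>(D \<omega> - expectation D) / sqrt (area (S n))\<bar>)" using D_int by simp
    then show "integrable M (\<lambda>\<omega>. \<bar>Y n \<omega> - Z n \<omega>\<bar>)"
      using YZ_eq by (subst Bochner_Integration.integrable_cong[OF refl]) auto
    \<comment> \<open>Centring \<open>D\<close> costs a factor 2 in mean and the interval around the
      level another 2, whence 4. The area divided by its square root leaves
      \<open>real n * sqrt (area T)\<close>, so \<open>real n * \<epsilon> n\<close>
      appears.\<close>
    have "(\<integral>\<omega>. \<bar>Y n \<omega> - Z n \<omega>\<bar> \<partial>M) \<le> (\<integral>\<omega>. (\<bar>D \<omega>\<bar> + (\<integral>\<omega>. \<bar>D \<omega>\<bar> \<partial>M)) / sqrt (area (S n)) \<partial>M)"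
    proof (rule integral_mono')
      fix \<omega> assume \<omega>: "\<omega> \<in> space M"
      have "\<bar>expectation D\<bar> \<le> (\<integral>\<omega>. \<bar>D \<omega>\<bar> \<partial>M)" by (rule integral_abs_bound)
      then have "\<bar>D \<omega> - expectation D\<bar> \<le> \<bar>D \<omega>\<bar> + (\<integral>\<omega>. \<bar>D \<omega>\<bar> \<partial>M)" by linarith
      then show "\<bar>Y n \<omega> - Z n \<omega>\<bar> \<le> (\<bar>D \<omega>\<bar> + (\<integral>\<omega>. \<bar>D \<omega>\<bar> \<partial>M)) / sqrt (area (S n))"
        unfolding YZ_eq[OF \<omega>] by (simp add: divide_right_mono)
    qed (use D_int in \<open>auto intro!: divide_nonneg_nonneg add_nonneg_nonneg integral_nonneg_AE\<close>)
    also have "\<dots> = 2 * (\<integral>\<omega>. \<bar>D \<omega>\<bar> \<partial>M) / sqrt (area (S n))"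
      using D_int by (simp add: prob_space)
    also have "\<dots> \<le> 2 * (2 * (\<epsilon> n / \<sigma>) * (\<integral>\<omega>. \<bar>X \<omega>\<bar> \<partial>M) * area (S n)) / sqrt (area (S n))"
    proof (intro divide_right_mono mult_left_mono)
      have "0 \<le> \<epsilon> n / \<sigma>" using \<epsilon>[OF n] \<sigma> by simp
      from level_area_perturbation[OF S ind X Xint this]
      show "(\<integral>\<omega>. \<bar>D \<omega>\<bar> \<partial>M) \<le> 2 * (\<epsilon> n / \<sigma>) * (\<integral>\<omega>. \<bar>X \<omega>\<bar> \<partial>M) * area (S n)"
        unfolding D_def L_def L0_def .
    qed auto
    also have "\<dots> = 4 / \<sigma> * (\<integral>\<omega>. \<bar>X \<omega>\<bar> \<partial>M) * \<epsilon> n * (area (S n) / sqrt (area (S n)))" by simp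
    also have "area (S n) / sqrt (area (S n)) = sqrt (area (S n))" using areaS(2)[OF n] by (simp add: real_div_sqrt)
    also have "\<dots> = real n * sqrt (area T)" unfolding areaS(1)[OF n] by (simp add: real_sqrt_mult)
    finally show "(\<integral>\<omega>. \<bar>Y n \<omega> - Z n \<omega>\<bar> \<partial>M) \<le> 4 / \<sigma> * (\<integral>\<omega>. \<bar>X \<omega>\<bar> \<partial>M) * sqrt (area T) * (real n * \<epsilon> n)"
      by (simp add: mult_ac)
  qed
  have "weak_conv_m (\<lambda>n. distr M borel (Y n)) (normal_law 0 v)"
  proof (rule levy_continuity)
    show "real_distribution (distr M borel (Y n))" for n by (rule real_distribution_distr) simp
    show "real_distribution (normal_law 0 v)" by (rule normal_law_char(1)[OF v0])
    fix s
    have limZ: "(\<lambda>n. \<integral>\<omega>. cis (s * Z n \<omega>) \<partial>M) \<longlonglongrightarrow> of_real (exp (- (s\<^sup>2 * v / 2)))"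
      unfolding Z_def S_def v_def by (rule char_limit_unperturbed[OF rho rho1 T aT])
    have "(\<lambda>n. (\<integral>\<omega>. cis (s * Y n \<omega>) \<partial>M) - (\<integral>\<omega>. cis (s * Z n \<omega>) \<partial>M)) \<longlonglongrightarrow> 0"
    proof (rule Lim_null_comparison)
      show "\<forall>\<^sub>F n in sequentially. norm ((\<integral>\<omega>. cis (s * Y n \<omega>) \<partial>M) - (\<integral>\<omega>. cis (s * Z n \<omega>) \<partial>M))
         \<le> \<bar>s\<bar> * (4 / \<sigma> * (\<integral>\<omega>. \<bar>X \<omega>\<bar> \<partial>M) * sqrt (area T) * (real n * \<epsilon> n))"
        using eventually_ge_at_top[of 1]
      proof eventually_elim
        case (elim n)
        show ?case
          by (rule order_trans[OF norm_expectation_cis_diff_le[OF Y_meas Z_meas YZ_int[OF elim]]])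
             (intro mult_left_mono YZ[OF elim] abs_ge_zero)
      qed
      have "(\<lambda>n. \<bar>s\<bar> * (4 / \<sigma> * (\<integral>\<omega>. \<bar>X \<omega>\<bar> \<partial>M) * sqrt (area T) * (real n * \<epsilon> n)))
         \<longlonglongrightarrow> \<bar>s\<bar> * (4 / \<sigma> * (\<integral>\<omega>. \<bar>X \<omega>\<bar> \<partial>M) * sqrt (area T) * 0)"
        by (intro tendsto_mult tendsto_const lim\<epsilon>)
      then show "(\<lambda>n. \<bar>s\<bar> * (4 / \<sigma> * (\<integral>\<omega>. \<bar>X \<omega>\<bar> \<partial>M) * sqrt (area T) * (real n * \<epsilon> n))) \<longlonglongrightarrow> 0" by simp
    qed
    from tendsto_add[OF this limZ]
    show "(\<lambda>n. char (distr M borel (Y n)) s) \<longlonglongrightarrow> char (normal_law 0 v) s"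
      unfolding char_Y normal_law_char(2)[OF v0] by simp
  qed
  then show ?thesis unfolding S_eq distr_Y v_def .
qed

end
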